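(* Let $n\ge 2$ and let $K\subset\mathbb{R}^n$ be a closed convex cone with vertex at the origin $O$ which is pointed, i.e. $K\cap(-K)=\{O\}$, and has non-empty interior. Let $A\in\partial K\setminus\{O\}$, and let $m_A$ be the infimum of the $(n-1)$-volumes of $K\cap\mathcal{H}$ over all admissible hyperplanes $\mathcal{H}$ through $A$. (i) If there is no hyperplane $\mathcal{T}\ni O$ such that $A$ is an interior point, relative to $\mathcal{T}$, of $K'=\partial K\cap\mathcal{T}$, then $m_A=0$. (ii) Otherwise, such a hyperplane $\mathcal{T}$ is unique and $m_A>0$. If, in addition, $m_A$ is not attained (by any admissible hyperplane through $A$), then $m_A$ is equal to the minimal $(n-1)$-volume of a cone segment $K''$ of $K'=\partial K\cap\mathcal{T}$ cut off by an $(n-2)$-plane $\mathcal{T}'\subset\mathcal{T}$ through $A$; moreover, in this degenerate case the relation $\overrightarrow{AH}=n\overrightarrow{AG}$ remains true with $H=O$ (the orthogonal projection of $O$ on $\mathcal{T}$) and $G$ the centroid of the cone segment $K''$ of minimal $(n-1)$-volume, i.e. $\overrightarrow{AO}=n\overrightarrow{AG}$.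
   Context: $(\cdot,\cdot)$ is the standard inner product in $\mathbb{R}^n$. The dual cone is $K^*=\{y:(y,x)\ge 0\ \forall x\in K\}$, and $K^+=(K^* )^o$ is its interior. A hyperplane is called admissible (for $K$) if it has the form $\mathcal{H}(b)=\{x\in\mathbb{R}^n:(b,x)=1\}$ with $b\in K^+$; equivalently, $K\cap\mathcal{H}(b)$ has finite $(n-1)$-volume and is compact. The cone segment $K''$ of the $(n-1)$-dimensional cone $K'\subset\mathcal{T}$ cut off by an $(n-2)$-plane $\mathcal{T}'\subset\mathcal{T}$ with $O\notin\mathcal{T}'$ is the part of $K'$ lying on the same side of $\mathcal{T}'$ (within $\mathcal{T}$) as $O$, including $K'\cap\mathcal{T}'$. *)

theory Defs
  imports "HOL-Analysis.Analysis"
begin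

definition dual_cone :: "'a::euclidean_space set \<Rightarrow> 'a set" where
  "dual_cone K = {y. \<forall>x\<in>K. 0 \<le> y \<bullet> x}"

definition admissible :: "'a::euclidean_space set \<Rightarrow> 'a set \<Rightarrow> bool" where
  "admissible K H \<longleftrightarrow> (\<exists>b \<in> interior (dual_cone K). H = {x. b \<bullet> x = 1})"

definition orthonormal_basis_of :: "'a::euclidean_space set \<Rightarrow> 'a set \<Rightarrow> bool" where
  "orthonormal_basis_of V B \<longleftrightarrow>
     pairwise orthogonal B \<and> (\<forall>b\<in>B. norm b = 1) \<and> span B = V"

text \<open>
  The \<open>k\<close>-dimensional volume on a \<open>k\<close>-dimensional affine subspace \<open>S\<close>: Lebesgue measure in the
  coordinates of an orthonormal frame of \<open>S\<close>. The construction is that of \<^const>\<open>lborel\<close>, with an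
  origin in \<open>S\<close> and an orthonormal basis of the direction space of \<open>S\<close> in place of \<open>0\<close> and
  \<^const>\<open>Basis\<close>. The resulting measure does not depend on the choice of the frame, because
  Lebesgue measure is invariant under isometries.
\<close>
definition flat_lborel :: "'a::euclidean_space set \<Rightarrow> 'a measure" where
  "flat_lborel S =
     (let p = (SOME p. p \<in> S);
          B = (SOME B. orthonormal_basis_of ((\<lambda>x. x - p) ` S) B)
      in distr (\<Pi>\<^sub>M b\<in>B. lborel) borel (\<lambda>f. p + (\<Sum>b\<in>B. f b *\<^sub>R b)))"

text \<open>Volumes are extended reals, so that unbounded cone segments have volume \<open>\<infinity>\<close>, not \<open>0\<close>.\<close>
definition flat_volume :: "'a::euclidean_space set \<Rightarrow> 'a set \<Rightarrow> ennreal" where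
  "flat_volume S X = emeasure (flat_lborel S) X"

definition flat_centroid :: "'a::euclidean_space set \<Rightarrow> 'a set \<Rightarrow> 'a" where
  "flat_centroid S X =
     (1 / measure (flat_lborel S) X) *\<^sub>R set_lebesgue_integral (flat_lborel S) X (\<lambda>x. x)"

definition min_section_volume :: "'a::euclidean_space set \<Rightarrow> 'a \<Rightarrow> ennreal" where
  "min_section_volume K A = (INF H \<in> {H. admissible K H \<and> A \<in> H}. flat_volume H (K \<inter> H))"

definition facet_hyperplane :: "'a::euclidean_space set \<Rightarrow> 'a \<Rightarrow> 'a set \<Rightarrow> bool" where
  "facet_hyperplane K A T \<longleftrightarrow>
     affine T \<and> aff_dim T = int DIM('a) - 1 \<and> 0 \<in> T \<and>
     A \<in> (top_of_set T) interior_of (frontier K \<inter> T)"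

definition cutting_plane :: "'a::euclidean_space set \<Rightarrow> 'a \<Rightarrow> 'a set \<Rightarrow> bool" where
  "cutting_plane T A T' \<longleftrightarrow>
     affine T' \<and> aff_dim T' = int DIM('a) - 2 \<and> T' \<subseteq> T \<and> 0 \<notin> T' \<and> A \<in> T'"

text \<open>
  A point of the hyperplane \<open>T\<close> off \<open>T'\<close> lies on the same side of \<open>T'\<close> as \<open>0\<close> iff the segment
  joining it to \<open>0\<close> misses \<open>T'\<close>.
\<close>
definition cone_segment :: "'a::euclidean_space set \<Rightarrow> 'a set \<Rightarrow> 'a set" where
  "cone_segment K' T' = {x \<in> K'. x \<in> T' \<or> closed_segment 0 x \<inter> T' = {}}"

end

(*
  For b in the interior of the dual cone, the section of K by {b . x = 1} is the base of a cone of
  volume F(b) = vol {x in K. b . x <= 1} and height 1 / |b|, so its volume is n |b| F(b).  Let u be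
  the unit inner normal of a supporting hyperplane T at A and write b = beta + r u with beta in T.
  Stretching space by the factor r in the direction u shows that, for r -> infinity, the volume of
  the section tends to the volume G(beta) of the segment {y in K Int T. beta . y <= 1}; so the
  infimum is at most G(beta).  If A is not interior to K Int T relative to T, then K Int T has a
  supporting functional vanishing at A, and adding large multiples of it to beta makes G(beta)
  arbitrarily small.  If A is interior, then the components beta of a minimizing sequence are
  bounded.  Either a subsequence of b converges, and by Fatou's lemma the infimum is attained, or
  r -> infinity, and the infimum is the minimum of G.

  The centroid of a minimal segment comes from the first variation of G: G(beta) / n is the integral
  of the positive part of 1 - beta . y over K Int T, whose derivative in the direction v is the
  integral of - v . y over the segment.
*)
theory Submission
  imports Defs
begin

section \<open>Lebesgue measure in orthonormal frames\<close>

text \<open>Sections through A lie in different hyperplanes, and the limiting segment lies in yet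
  another one, so the limit arguments trade these volumes for volumes of bodies of full dimension: a
  section for the truncated cone below it, a segment of K Int T for the pyramid of height 1 over it,
  whose volume is G(beta) / n. After the stretch, n |b| F(b) becomes n |b / r| times the volume of
  the stretched cone, with |b / r| tending to 1, and convergence is convergence of sets under one
  fixed measure. It is checked only at interior points of the limit body (for lower bounds) or
  outside it (for upper bounds); the frontier is null because the limit body is convex.

  Volumes are extended reals, and pointedness makes pieces with a direction of recession infinite.
  This closes the two open ends: a limit functional on the boundary of the dual cone would give an
  infinite section although the infimum is finite, and a functional that is not positive on the
  facet cuts off an infinite segment, which no upper bound has to fear.\<close>

lemma nn_integral_lborel_add:
  fixes a :: "'a::euclidean_space"
  assumes [measurable]: "f \<in> borel_measurable borel"
  shows "(\<integral>\<^sup>+x. f (a + x) \<partial>lborel) = (\<integral>\<^sup>+x. f x \<partial>lborel)"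
proof -
  have "(\<integral>\<^sup>+x. f x \<partial>lborel) = (\<integral>\<^sup>+x. f x \<partial>distr lborel borel ((+) a))"
    by (simp add: lborel_distr_plus)
  also have "\<dots> = (\<integral>\<^sup>+x. f (a + x) \<partial>lborel)"
    by (rule nn_integral_distr) auto
  finally show ?thesis ..
qed

lemma nn_integral_lborel_scaleR:
  fixes f :: "'a::euclidean_space \<Rightarrow> ennreal"
  assumes [measurable]: "f \<in> borel_measurable borel" and "c > 0"
  shows "(\<integral>\<^sup>+x. f x \<partial>lborel) = ennreal (c ^ DIM('a)) * (\<integral>\<^sup>+x. f (c *\<^sub>R x) \<partial>lborel)"
proof -
  have "(\<integral>\<^sup>+x. f x \<partial>lborel)
      = (\<integral>\<^sup>+x. f x \<partial>density (distr lborel borel (\<lambda>x::'a. 0 + c *\<^sub>R x)) (\<lambda>_. \<bar>c\<bar>^DIM('a)))"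
    using \<open>c > 0\<close> by (subst lborel_affine[of c 0]) auto
  also have "\<dots> = ennreal (c ^ DIM('a)) * (\<integral>\<^sup>+x. f (c *\<^sub>R x) \<partial>lborel)"
    using \<open>c > 0\<close> by (simp add: nn_integral_density nn_integral_distr nn_integral_cmult)
  finally show ?thesis .
qed

text \<open>
  Both Lebesgue measure and its image under \<open>f\<close> are translation invariant, hence proportional
  (this is the double integral below), and they agree on the unit ball.
\<close>
lemma nn_integral_lborel_orthogonal:
  fixes f :: "'a::euclidean_space \<Rightarrow> 'a"
  assumes f: "orthogonal_transformation f" and [measurable]: "g \<in> borel_measurable borel"
  shows "(\<integral>\<^sup>+x. g (f x) \<partial>lborel) = (\<integral>\<^sup>+x. g x \<partial>lborel)"
proof -
  have lin: "linear f" using f orthogonal_transformation_linear by blast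
  have [measurable]: "f \<in> borel_measurable borel"
    using lin linear_continuous_on borel_measurable_continuous_onI linear_linear by blast
  have nf: "norm (f x) = norm x" for x using f orthogonal_transformation_norm by blast
  have surj: "surj f" using f orthogonal_transformation_surj by blast
  let ?E = "ball (0::'a) 1"
  have E[measurable]: "?E \<in> sets borel" by simp
  have eq: "emeasure lborel A = emeasure (distr lborel borel f) A" if [measurable]: "A \<in> sets borel" for A
  proof -
    let ?i = "indicator A :: 'a \<Rightarrow> ennreal" and ?e = "indicator ?E :: 'a \<Rightarrow> ennreal"
    have fA: "(\<integral>\<^sup>+x. ?i (f x + y) \<partial>lborel) = (\<integral>\<^sup>+x. ?i (f x) \<partial>lborel)" for y
    proof -
      obtain z where z: "y = f z" using surj by (metis surjD)
      have "(\<integral>\<^sup>+x. ?i (f x + y) \<partial>lborel) = (\<integral>\<^sup>+x. ?i (f (z + x)) \<partial>lborel)"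
        using lin by (simp add: z linear_add add.commute)
      also have "\<dots> = (\<integral>\<^sup>+x. ?i (f x) \<partial>lborel)"
        by (rule nn_integral_lborel_add[where f="\<lambda>x. ?i (f x)"]) auto
      finally show ?thesis .
    qed
    \<comment> \<open>\<open>f\<close> preserves norms, so \<open>y - f x\<close> lies in the unit
      ball exactly when \<open>x\<close> lies in the unit ball around the preimage \<open>z\<close>
      of \<open>y\<close>.\<close>
    have eE: "(\<integral>\<^sup>+x. ?e (y - f x) \<partial>lborel) = emeasure lborel ?E" for y
    proof -
      obtain z where z: "y = f z" using surj by (metis surjD)
      have "?e (y - f x) = ?e (-z + x)" for x
        using lin nf[of "z - x"]
        by (auto simp: z linear_diff indicator_def dist_norm norm_minus_commute)
      then have "(\<integral>\<^sup>+x. ?e (y - f x) \<partial>lborel) = (\<integral>\<^sup>+x. ?e (-z + x) \<partial>lborel)" by simp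
      also have "\<dots> = (\<integral>\<^sup>+x. ?e x \<partial>lborel)"
        by (rule nn_integral_lborel_add) (use E in measurable)
      finally show ?thesis by simp
    qed
    have "(\<integral>\<^sup>+x. ?i (f x) \<partial>lborel) * emeasure lborel ?E
        = (\<integral>\<^sup>+y. ?e y * (\<integral>\<^sup>+x. ?i (f x + y) \<partial>lborel) \<partial>lborel)"
      by (simp add: fA nn_integral_multc mult.commute)
    also have "\<dots> = (\<integral>\<^sup>+y. (\<integral>\<^sup>+x. ?e y * ?i (f x + y) \<partial>lborel) \<partial>lborel)"
      by (intro nn_integral_cong nn_integral_cmult[symmetric]) auto
    also have "\<dots> = (\<integral>\<^sup>+x. (\<integral>\<^sup>+y. ?e y * ?i (f x + y) \<partial>lborel) \<partial>lborel)"
      by (rule lborel_pair.Fubini') measurable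
    also have "\<dots> = (\<integral>\<^sup>+x. (\<integral>\<^sup>+y. ?e (y - f x) * ?i y \<partial>lborel) \<partial>lborel)"
    proof (rule nn_integral_cong)
      fix x
      show "(\<integral>\<^sup>+y. ?e y * ?i (f x + y) \<partial>lborel) = (\<integral>\<^sup>+y. ?e (y - f x) * ?i y \<partial>lborel)"
        using nn_integral_lborel_add[of "\<lambda>y. ?e (y - f x) * ?i y" "f x"] by simp
    qed
    also have "\<dots> = (\<integral>\<^sup>+y. (\<integral>\<^sup>+x. ?e (y - f x) * ?i y \<partial>lborel) \<partial>lborel)"
      by (rule lborel_pair.Fubini') measurable
    also have "\<dots> = (\<integral>\<^sup>+y. emeasure lborel ?E * ?i y \<partial>lborel)"
      by (intro nn_integral_cong) (simp add: nn_integral_multc eE)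
    also have "\<dots> = emeasure lborel A * emeasure lborel ?E"
      by (simp add: nn_integral_cmult nn_integral_multc mult.commute)
    finally have "(\<integral>\<^sup>+x. ?i (f x) \<partial>lborel) * emeasure lborel ?E = emeasure lborel A * emeasure lborel ?E" .
    moreover have "emeasure lborel ?E \<noteq> 0"
      using less_imp_neq[OF unit_ball_vol_pos[of "real DIM('a)"]] by (simp add: emeasure_ball)
    moreover have "emeasure lborel ?E \<noteq> \<infinity>" using emeasure_lborel_ball_finite[of 0 1] by (metis less_irrefl infinity_ennreal_def)
    ultimately have "(\<integral>\<^sup>+x. ?i (f x) \<partial>lborel) = emeasure lborel A"
      by (metis mult_divide_eq_ennreal infinity_ennreal_def)
    moreover have "(\<integral>\<^sup>+x. ?i (f x) \<partial>lborel) = (\<integral>\<^sup>+x. ?i x \<partial>distr lborel borel f)"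
      by (rule nn_integral_distr[symmetric]) measurable
    ultimately show ?thesis by simp
  qed
  have "lborel = distr lborel borel f"
    by (rule measure_eqI) (auto simp: eq)
  then have "(\<integral>\<^sup>+x. g x \<partial>lborel) = (\<integral>\<^sup>+x. g x \<partial>distr lborel borel f)" by simp
  then show ?thesis by (simp add: nn_integral_distr)
qed

text \<open>Relabelling coordinates along a bijection from \<open>Basis\<close> to \<open>B\<close>
  carries the product measure over \<open>B\<close> to \<open>lborel\<close>; the linear map sending
  each basis vector to its partner in \<open>B\<close> is orthogonal and so preserves
  \<open>lborel\<close>.\<close>

lemma nn_integral_lborel_frame:
  fixes g :: "'a::euclidean_space \<Rightarrow> ennreal"
  assumes B: "orthonormal_basis_of UNIV B" and g[measurable]: "g \<in> borel_measurable borel"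
  shows "(\<integral>\<^sup>+x. g x \<partial>lborel) = (\<integral>\<^sup>+y. g (\<Sum>b\<in>B. y b *\<^sub>R b) \<partial>(\<Pi>\<^sub>M b\<in>B. lborel))"
proof -
  interpret product_sigma_finite "\<lambda>_::'a. lborel :: real measure" by standard
  have orth: "pairwise orthogonal B" and nB: "\<And>b. b \<in> B \<Longrightarrow> norm b = 1" and sp: "span B = UNIV"
    using B by (auto simp: orthonormal_basis_of_def)
  have ind: "independent B"
    using orth nB by (intro pairwise_orthogonal_independent) (auto dest: nB[of 0])
  then have fin[simp]: "finite B" by (rule independent_imp_finite)
  have "card B = DIM('a)" using ind sp by (metis dim_UNIV dim_span_eq_card_independent)
  then obtain h where h: "bij_betw h (Basis::'a set) B"
    by (metis bij_betw_iff_card fin finite_Basis)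
  then have hB[simp]: "h i \<in> B" if "i \<in> Basis" for i using that by (auto simp: bij_betw_def)
  have hinj: "h i = h j \<longleftrightarrow> i = j" if "i \<in> Basis" "j \<in> Basis" for i j
    using that h by (auto simp: bij_betw_def inj_on_def)
  let ?x = "\<lambda>y. \<Sum>i\<in>Basis. y (h i) *\<^sub>R i :: 'a"
  have hm: "(\<lambda>y. y (h i)) \<in> borel_measurable (\<Pi>\<^sub>M b\<in>B. lborel)" if "i \<in> Basis" for i
    using that by (auto intro!: measurable_component_singleton)
  then have [measurable]: "?x \<in> borel_measurable (\<Pi>\<^sub>M b\<in>B. lborel)"
    by (auto intro!: borel_measurable_sum borel_measurable_scaleR)
  have coord: "?x y \<bullet> i = y (h i)" if "i \<in> Basis" for y i
    using that by (simp add: inner_sum_left inner_Basis if_distrib cong: if_cong)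
  have "lborel = distr (\<Pi>\<^sub>M b\<in>B. lborel) borel ?x"
  proof (rule lborel_eqI)
    fix l u :: 'a assume le: "\<And>b. b \<in> Basis \<Longrightarrow> l \<bullet> b \<le> u \<bullet> b"
    let ?k = "inv_into Basis h"
    have k: "?k b \<in> Basis" "h (?k b) = b" if "b \<in> B" for b
      using that h by (auto simp: bij_betw_def f_inv_into_f intro: inv_into_into)
    have kh: "?k (h i) = i" if "i \<in> Basis" for i
      using that h by (simp add: bij_betw_def)
    have "?x -` box l u \<inter> space (\<Pi>\<^sub>M b\<in>B. lborel) = (\<Pi>\<^sub>E b\<in>B. {l \<bullet> ?k b<..<u \<bullet> ?k b})"
    proof (intro set_eqI iffI)
      fix y assume "y \<in> ?x -` box l u \<inter> space (\<Pi>\<^sub>M b\<in>B. lborel)"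
      then have y: "\<And>i. i \<in> Basis \<Longrightarrow> l \<bullet> i < y (h i) \<and> y (h i) < u \<bullet> i"
        and e: "y \<in> extensional B"
        by (auto simp: mem_box coord space_PiM PiE_def)
      show "y \<in> (\<Pi>\<^sub>E b\<in>B. {l \<bullet> ?k b<..<u \<bullet> ?k b})"
        using y[OF k(1)] k(2) e by (auto simp: PiE_iff)
    next
      fix y assume "y \<in> (\<Pi>\<^sub>E b\<in>B. {l \<bullet> ?k b<..<u \<bullet> ?k b})"
      then show "y \<in> ?x -` box l u \<inter> space (\<Pi>\<^sub>M b\<in>B. lborel)"
        using bspec[of B _ "h _", OF _ hB] kh
        by (fastforce simp: mem_box coord space_PiM PiE_iff)
    qed
    then have "emeasure (distr (\<Pi>\<^sub>M b\<in>B. lborel) borel ?x) (box l u)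
        = emeasure (\<Pi>\<^sub>M b\<in>B. lborel) (\<Pi>\<^sub>E b\<in>B. {l \<bullet> ?k b<..<u \<bullet> ?k b})"
      by (subst emeasure_distr) auto
    also have "\<dots> = (\<Prod>b\<in>B. emeasure lborel {l \<bullet> ?k b<..<u \<bullet> ?k b})"
      by (rule emeasure_PiM) auto
    also have "\<dots> = (\<Prod>i\<in>Basis. emeasure lborel {l \<bullet> ?k (h i)<..<u \<bullet> ?k (h i)})"
      by (rule prod.reindex_bij_betw[OF h, symmetric])
    also have "\<dots> = (\<Prod>i\<in>Basis. ennreal ((u - l) \<bullet> i))"
      using le by (intro prod.cong) (auto simp: kh inner_diff_left)
    also have "\<dots> = ennreal (\<Prod>i\<in>Basis. (u - l) \<bullet> i)"
      using le by (intro prod_ennreal) (auto simp: inner_diff_left)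
    finally show "emeasure (distr (\<Pi>\<^sub>M b\<in>B. lborel) borel ?x) (box l u) = (\<Prod>b\<in>Basis. (u - l) \<bullet> b)" .
  qed simp
  note * = this
  let ?f = "\<lambda>x::'a. \<Sum>i\<in>Basis. (x \<bullet> i) *\<^sub>R h i"
  have lin: "linear ?f"
    by (intro linearI) (auto simp: inner_add_left scaleR_add_left sum.distrib scaleR_sum_right)
  have "?f x \<bullet> ?f y = x \<bullet> y" for x y
  proof -
    have hh: "h i \<bullet> h j = (if i = j then 1 else 0)" if "i \<in> Basis" "j \<in> Basis" for i j
      using that orth nB[OF hB] hinj[OF that] hB[OF that(1)] hB[OF that(2)]
      by (auto simp: pairwise_def orthogonal_def norm_eq_1)
    have "?f x \<bullet> ?f y = (\<Sum>i\<in>Basis. \<Sum>j\<in>Basis. (x \<bullet> i) * (y \<bullet> j) * (h i \<bullet> h j))"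
      by (subst inner_sum_left, intro sum.cong refl)
        (simp add: inner_sum_right sum_distrib_left mult_ac)
    also have "\<dots> = (\<Sum>i\<in>Basis. \<Sum>j\<in>Basis. (x \<bullet> i) * (y \<bullet> j) * (if i = j then 1 else 0))"
      by (intro sum.cong refl) (simp add: hh)
    also have "\<dots> = (\<Sum>i\<in>Basis. (x \<bullet> i) * (y \<bullet> i))"
      by (simp add: if_distrib cong: if_cong)
    finally show ?thesis by (simp add: euclidean_inner[of x y])
  qed
  then have ot: "orthogonal_transformation ?f"
    using lin by (simp add: orthogonal_transformation_def)
  have [measurable]: "?f \<in> borel_measurable borel" by simp
  have "(\<integral>\<^sup>+x. g x \<partial>lborel) = (\<integral>\<^sup>+x. g (?f x) \<partial>lborel)"
    by (rule nn_integral_lborel_orthogonal[OF ot g, symmetric])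
  also have "\<dots> = (\<integral>\<^sup>+x. g (?f x) \<partial>distr (\<Pi>\<^sub>M b\<in>B. lborel) borel ?x)"
    using * by simp
  also have "\<dots> = (\<integral>\<^sup>+y. g (?f (?x y)) \<partial>(\<Pi>\<^sub>M b\<in>B. lborel))"
    by (rule nn_integral_distr) auto
  also have "\<dots> = (\<integral>\<^sup>+y. g (\<Sum>b\<in>B. y b *\<^sub>R b) \<partial>(\<Pi>\<^sub>M b\<in>B. lborel))"
    by (simp add: coord sum.reindex_bij_betw[OF h, where g="\<lambda>b. _ b *\<^sub>R b"])
  finally show ?thesis .
qed

section \<open>The volume measure of a hyperplane\<close>

text \<open>\<open>B\<close> together with \<open>u\<close> is an orthonormal basis of the whole
  space, and the product measure splits off the \<open>u\<close>-coordinate.\<close>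

lemma nn_integral_lborel_hyperplane_frame:
  fixes u :: "'a::euclidean_space"
  assumes u: "norm u = 1" and B: "orthonormal_basis_of {x. u \<bullet> x = 0} B"
    and [measurable]: "g \<in> borel_measurable borel"
  shows "(\<integral>\<^sup>+x. g x \<partial>lborel)
       = (\<integral>\<^sup>+s. (\<integral>\<^sup>+y. g ((\<Sum>b\<in>B. y b *\<^sub>R b) + s *\<^sub>R u) \<partial>(\<Pi>\<^sub>M b\<in>B. lborel)) \<partial>lborel)"
proof -
  interpret product_sigma_finite "\<lambda>_::'a. lborel :: real measure" by standard
  have orth: "pairwise orthogonal B" and nB: "\<And>b. b \<in> B \<Longrightarrow> norm b = 1"
    and sp: "span B = {x. u \<bullet> x = 0}"
    using B by (auto simp: orthonormal_basis_of_def)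
  have uu: "u \<bullet> u = 1" using u by (simp add: norm_eq_1)
  have uB: "u \<bullet> b = 0" if "b \<in> B" for b
    using span_base[OF that] sp by auto
  have uni: "u \<notin> B" using uB uu by fastforce
  have "independent B"
    using orth nB by (intro pairwise_orthogonal_independent) (auto dest: nB[of 0])
  then have fin[simp]: "finite B" by (rule independent_imp_finite)
  have sm: "(\<Sum>b\<in>insert u B. (y(u := s)) b *\<^sub>R b) = (\<Sum>b\<in>B. y b *\<^sub>R b) + s *\<^sub>R u" for y s
  proof -
    have "(\<Sum>b\<in>B. (y(u := s)) b *\<^sub>R b) = (\<Sum>b\<in>B. y b *\<^sub>R b)"
      using uni by (intro sum.cong) auto
    then show ?thesis using uni by (simp add: add.commute)
  qed
  have "x \<in> span (insert u B)" for x
  proof -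
    have "x - (u \<bullet> x) *\<^sub>R u \<in> span B" by (simp add: sp inner_diff_right uu)
    then show ?thesis by (auto simp: span_insert)
  qed
  then have "orthonormal_basis_of UNIV (insert u B)"
    using orth nB u uB
    by (auto simp: orthonormal_basis_of_def pairwise_insert orthogonal_def inner_commute)
  then have "(\<integral>\<^sup>+x. g x \<partial>lborel)
      = (\<integral>\<^sup>+y. g (\<Sum>b\<in>insert u B. y b *\<^sub>R b) \<partial>(\<Pi>\<^sub>M b\<in>insert u B. lborel))"
    by (rule nn_integral_lborel_frame) auto
  also have "\<dots> = (\<integral>\<^sup>+s. (\<integral>\<^sup>+y. g (\<Sum>b\<in>insert u B. (y(u := s)) b *\<^sub>R b) \<partial>(\<Pi>\<^sub>M b\<in>B. lborel)) \<partial>lborel)"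
    using fin uni by (rule product_nn_integral_insert_rev) measurable
  finally show ?thesis unfolding sm .
qed

text \<open>The arbitrary choices inside \<open>flat_lborel\<close> are opened here once; what is
  recorded about \<open>p\<close> and \<open>B\<close> is all that later arguments use of
  them.\<close>

lemma flat_lborel_hyperplane_frame:
  fixes u :: "'a::euclidean_space"
  assumes "norm u = 1"
  obtains p B where "u \<bullet> p = t" "orthonormal_basis_of {x. u \<bullet> x = 0} B"
    "flat_lborel {x. u \<bullet> x = t} = distr (\<Pi>\<^sub>M b\<in>B. lborel) borel (\<lambda>f. p + (\<Sum>b\<in>B. f b *\<^sub>R b))"
proof -
  let ?S = "{x. u \<bullet> x = t}"
  have uu: "u \<bullet> u = 1" using assms by (simp add: norm_eq_1)
  define p where "p = (SOME p. p \<in> ?S)"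
  have "t *\<^sub>R u \<in> ?S" using uu by simp
  then have p: "u \<bullet> p = t" unfolding p_def by (metis (mono_tags, lifting) mem_Collect_eq someI)
  have im: "(\<lambda>x. x - p) ` ?S = {x. u \<bullet> x = 0}"
  proof (intro set_eqI iffI)
    fix x assume "x \<in> {x. u \<bullet> x = 0}"
    then have "x = (x + p) - p" "x + p \<in> ?S" using p by (auto simp: inner_add_right)
    then show "x \<in> (\<lambda>x. x - p) ` ?S" by blast
  qed (use p in \<open>auto simp: inner_diff_right\<close>)
  define B where "B = (SOME B. orthonormal_basis_of ((\<lambda>x. x - p) ` ?S) B)"
  have "\<exists>B. orthonormal_basis_of {x. u \<bullet> x = 0} B"
    using orthonormal_basis_subspace[OF subspace_hyperplane[of u]]
    unfolding orthonormal_basis_of_def by metis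
  then have "orthonormal_basis_of {x. u \<bullet> x = 0} B"
    unfolding B_def im by (rule someI_ex)
  moreover have "flat_lborel ?S = distr (\<Pi>\<^sub>M b\<in>B. lborel) borel (\<lambda>f. p + (\<Sum>b\<in>B. f b *\<^sub>R b))"
    by (simp add: flat_lborel_def Let_def B_def p_def)
  ultimately show thesis using that p by blast
qed

lemma sets_flat_lborel [measurable_cong, simp]: "sets (flat_lborel S) = sets borel"
  by (simp add: flat_lborel_def Let_def)

lemma space_flat_lborel [simp]: "space (flat_lborel S) = UNIV"
  by (simp add: flat_lborel_def Let_def)

text \<open>Integrating over a slab of thickness 1 along \<open>u\<close> contributes the factor 1.
  The right side mentions no frame, so the properties of \<open>flat_lborel\<close> reduce to those
  of \<open>lborel\<close>.\<close>

lemma nn_integral_flat_lborel_hyperplane: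
  fixes u :: "'a::euclidean_space"
  assumes u: "norm u = 1" and [measurable]: "f \<in> borel_measurable borel"
  shows "(\<integral>\<^sup>+x. f x \<partial>flat_lborel {x. u \<bullet> x = t})
       = (\<integral>\<^sup>+x. f (x - (u \<bullet> x - t) *\<^sub>R u) * indicator {0..1} (u \<bullet> x) \<partial>lborel)"
proof -
  obtain p B where p: "u \<bullet> p = t" and B: "orthonormal_basis_of {x. u \<bullet> x = 0} B"
    and S: "flat_lborel {x. u \<bullet> x = t} = distr (\<Pi>\<^sub>M b\<in>B. lborel) borel (\<lambda>f. p + (\<Sum>b\<in>B. f b *\<^sub>R b))"
    using flat_lborel_hyperplane_frame[OF u] by blast
  have uu: "u \<bullet> u = 1" using u by (simp add: norm_eq_1)
  have ub: "u \<bullet> b = 0" if "b \<in> B" for b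
    using span_base[OF that] B by (auto simp: orthonormal_basis_of_def)
  have us: "u \<bullet> (\<Sum>b\<in>B. y b *\<^sub>R b) = 0" for y
    by (simp add: inner_sum_right ub)
  let ?I = "\<integral>\<^sup>+y. f (p + (\<Sum>b\<in>B. y b *\<^sub>R b)) \<partial>(\<Pi>\<^sub>M b\<in>B. lborel)"
  let ?F = "\<lambda>x. f (x - (u \<bullet> x - t) *\<^sub>R u) * indicator {0..1} (u \<bullet> x)"
  \<comment> \<open>The chosen origin \<open>p\<close> may differ from the foot
    \<open>t *\<^sub>R u\<close> of the perpendicular; the difference \<open>?q\<close> is
    orthogonal to \<open>u\<close>, so translating by it preserves the slab.\<close>
  let ?q = "p - t *\<^sub>R u"
  have F: "?F (?q + ((\<Sum>b\<in>B. y b *\<^sub>R b) + s *\<^sub>R u))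
      = f (p + (\<Sum>b\<in>B. y b *\<^sub>R b)) * indicator {0..1} s" for y s
  proof -
    have 1: "u \<bullet> (?q + ((\<Sum>b\<in>B. y b *\<^sub>R b) + s *\<^sub>R u)) = s"
      using us[of y] p uu by (simp add: inner_add_right inner_diff_right)
    show ?thesis unfolding 1 by (simp add: algebra_simps)
  qed
  have "(\<integral>\<^sup>+x. ?F x \<partial>lborel) = (\<integral>\<^sup>+x. ?F (?q + x) \<partial>lborel)"
    by (rule nn_integral_lborel_add[symmetric]) measurable
  also have "\<dots> = (\<integral>\<^sup>+s. (\<integral>\<^sup>+y. ?F (?q + ((\<Sum>b\<in>B. y b *\<^sub>R b) + s *\<^sub>R u)) \<partial>(\<Pi>\<^sub>M b\<in>B. lborel)) \<partial>lborel)"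
    by (rule nn_integral_lborel_hyperplane_frame[OF u B]) measurable
  also have "\<dots> = (\<integral>\<^sup>+s. ?I * indicator {0..1} s \<partial>(lborel::real measure))"
    unfolding F by (intro nn_integral_cong nn_integral_multc) measurable
  also have "\<dots> = ?I" by (simp add: nn_integral_cmult)
  also have "\<dots> = (\<integral>\<^sup>+x. f x \<partial>flat_lborel {x. u \<bullet> x = t})"
    unfolding S by (rule nn_integral_distr[symmetric]) measurable
  finally show ?thesis ..
qed

lemma nn_integral_lborel_hyperplane:
  fixes u :: "'a::euclidean_space"
  assumes u: "norm u = 1" and [measurable]: "g \<in> borel_measurable borel"
  shows "(\<integral>\<^sup>+x. g x \<partial>lborel)
       = (\<integral>\<^sup>+s. (\<integral>\<^sup>+y. g (y + s *\<^sub>R u) \<partial>flat_lborel {x. u \<bullet> x = 0}) \<partial>lborel)"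
proof -
  obtain p B where p: "u \<bullet> p = 0" and B: "orthonormal_basis_of {x. u \<bullet> x = 0} B"
    and S: "flat_lborel {x. u \<bullet> x = 0} = distr (\<Pi>\<^sub>M b\<in>B. lborel) borel (\<lambda>f. p + (\<Sum>b\<in>B. f b *\<^sub>R b))"
    using flat_lborel_hyperplane_frame[OF u] by blast
  have "(\<integral>\<^sup>+x. g x \<partial>lborel) = (\<integral>\<^sup>+x. g (p + x) \<partial>lborel)"
    by (rule nn_integral_lborel_add[symmetric]) measurable
  also have "\<dots> = (\<integral>\<^sup>+s. (\<integral>\<^sup>+y. g (p + ((\<Sum>b\<in>B. y b *\<^sub>R b) + s *\<^sub>R u)) \<partial>(\<Pi>\<^sub>M b\<in>B. lborel)) \<partial>lborel)"
    by (rule nn_integral_lborel_hyperplane_frame[OF u B]) measurable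
  also have "\<dots> = (\<integral>\<^sup>+s. (\<integral>\<^sup>+y. g (y + s *\<^sub>R u) \<partial>flat_lborel {x. u \<bullet> x = 0}) \<partial>lborel)"
    unfolding S by (intro nn_integral_cong, subst nn_integral_distr) (measurable, simp add: add_ac)
  finally show ?thesis .
qed

text \<open>\<open>flat_lborel\<close> is a measure on the whole space; its concentration on the
  hyperplane is what permits simplifying integrands by \<open>u \<bullet> y = t\<close>.\<close>

lemma AE_flat_lborel_hyperplane:
  fixes u :: "'a::euclidean_space"
  assumes u: "norm u = 1"
  shows "AE y in flat_lborel {x. u \<bullet> x = t}. u \<bullet> y = t"
proof -
  have uu: "u \<bullet> u = 1" using u by (simp add: norm_eq_1)
  have "emeasure (flat_lborel {x. u \<bullet> x = t}) {y. u \<bullet> y \<noteq> t}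
      = (\<integral>\<^sup>+y. indicator {y. u \<bullet> y \<noteq> t} y \<partial>flat_lborel {x. u \<bullet> x = t})"
    by (rule nn_integral_indicator[symmetric]) measurable
  also have "\<dots> = 0"
    by (subst nn_integral_flat_lborel_hyperplane[OF u]) (measurable, simp add: inner_diff_right uu)
  finally show ?thesis by (intro AE_I[where N="{y. u \<bullet> y \<noteq> t}"]) auto
qed

lemma nn_integral_flat_lborel_shift:
  fixes u :: "'a::euclidean_space"
  assumes u: "norm u = 1" and [measurable]: "f \<in> borel_measurable borel"
  shows "(\<integral>\<^sup>+x. f x \<partial>flat_lborel {x. u \<bullet> x = t}) = (\<integral>\<^sup>+y. f (y + t *\<^sub>R u) \<partial>flat_lborel {x. u \<bullet> x = 0})"
  by (subst (1 2) nn_integral_flat_lborel_hyperplane[OF u]) (measurable, simp add: algebra_simps)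

text \<open>Scaling the whole space contributes \<open>c ^ DIM('a)\<close>, while the slab of
  thickness 1 is pulled back to thickness \<open>1 / c\<close>; together they leave the exponent
  \<open>DIM('a) - 1\<close>.\<close>

lemma nn_integral_flat_lborel_scaleR:
  fixes u :: "'a::euclidean_space"
  assumes u: "norm u = 1" and c: "c > 0" and [measurable]: "f \<in> borel_measurable borel"
  shows "(\<integral>\<^sup>+y. f y \<partial>flat_lborel {x. u \<bullet> x = 0})
       = ennreal (c ^ (DIM('a) - 1)) * (\<integral>\<^sup>+y. f (c *\<^sub>R y) \<partial>flat_lborel {x. u \<bullet> x = 0})"
proof -
  have uu: "u \<bullet> u = 1" using u by (simp add: norm_eq_1)
  let ?\<mu> = "flat_lborel {x. u \<bullet> x = 0}"
  let ?g = "\<lambda>x. f (x - (u \<bullet> x) *\<^sub>R u) * indicator {0..1} (u \<bullet> x)"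
  have "(\<integral>\<^sup>+y. f y \<partial>?\<mu>) = (\<integral>\<^sup>+x. ?g x \<partial>lborel)"
    by (simp add: nn_integral_flat_lborel_hyperplane[OF u])
  also have "\<dots> = ennreal (c ^ DIM('a)) * (\<integral>\<^sup>+x. ?g (c *\<^sub>R x) \<partial>lborel)"
    by (rule nn_integral_lborel_scaleR) (use c in measurable)
  also have "(\<integral>\<^sup>+x. ?g (c *\<^sub>R x) \<partial>lborel)
      = (\<integral>\<^sup>+s. (\<integral>\<^sup>+y. ?g (c *\<^sub>R (y + s *\<^sub>R u)) \<partial>?\<mu>) \<partial>lborel)"
    by (rule nn_integral_lborel_hyperplane[OF u]) measurable
  also have "\<dots> = (\<integral>\<^sup>+s. (\<integral>\<^sup>+y. f (c *\<^sub>R y) \<partial>?\<mu>) * indicator {0..1/c} s \<partial>lborel)"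
  proof (rule nn_integral_cong)
    fix s :: real
    have "(\<integral>\<^sup>+y. ?g (c *\<^sub>R (y + s *\<^sub>R u)) \<partial>?\<mu>) = (\<integral>\<^sup>+y. f (c *\<^sub>R y) * indicator {0..1/c} s \<partial>?\<mu>)"
      using AE_flat_lborel_hyperplane[OF u, of 0]
    proof (intro nn_integral_cong_AE, eventually_elim)
      fix y assume y: "u \<bullet> y = 0"
      have "c *\<^sub>R (y + s *\<^sub>R u) - (u \<bullet> (c *\<^sub>R (y + s *\<^sub>R u))) *\<^sub>R u = c *\<^sub>R y"
        using y uu by (simp add: inner_add_right algebra_simps)
      moreover have "indicator {0..1} (u \<bullet> (c *\<^sub>R (y + s *\<^sub>R u))) = (indicator {0..1/c} s :: ennreal)"
        using y uu c by (auto simp: inner_add_right indicator_def field_simps zero_le_mult_iff)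
      ultimately show "?g (c *\<^sub>R (y + s *\<^sub>R u)) = f (c *\<^sub>R y) * indicator {0..1/c} s" by simp
    qed
    also have "\<dots> = (\<integral>\<^sup>+y. f (c *\<^sub>R y) \<partial>?\<mu>) * indicator {0..1/c} s"
      by (rule nn_integral_multc) measurable
    finally show "(\<integral>\<^sup>+y. ?g (c *\<^sub>R (y + s *\<^sub>R u)) \<partial>?\<mu>) = \<dots>" .
  qed
  also have "\<dots> = (\<integral>\<^sup>+y. f (c *\<^sub>R y) \<partial>?\<mu>) * ennreal (1/c)"
    using c by (simp add: nn_integral_cmult)
  finally have "(\<integral>\<^sup>+y. f y \<partial>?\<mu>)
      = (ennreal (c ^ DIM('a)) * ennreal (1/c)) * (\<integral>\<^sup>+y. f (c *\<^sub>R y) \<partial>?\<mu>)"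
    by (simp add: mult_ac)
  also have "ennreal (c ^ DIM('a)) * ennreal (1/c) = ennreal (c ^ (DIM('a) - 1))"
    using c DIM_positive[where 'a='a]
    by (cases "DIM('a)") (auto simp flip: ennreal_mult)
  finally show ?thesis .
qed

text \<open>The slab formula moves the hyperplane integral to \<open>lborel\<close>, where the two
  integrations may be interchanged.\<close>

lemma flat_lborel_hyperplane_Fubini:
  fixes u :: "'a::euclidean_space" and k :: "'a \<Rightarrow> real \<Rightarrow> ennreal"
  assumes u: "norm u = 1" and [measurable]: "case_prod k \<in> borel_measurable (borel \<Otimes>\<^sub>M borel)"
  shows "(\<integral>\<^sup>+y. (\<integral>\<^sup>+s. k y s \<partial>lborel) \<partial>flat_lborel {x. u \<bullet> x = 0})
       = (\<integral>\<^sup>+s. (\<integral>\<^sup>+y. k y s \<partial>flat_lborel {x. u \<bullet> x = 0}) \<partial>lborel)"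
proof -
  let ?\<mu> = "flat_lborel {x. u \<bullet> x = 0}"
  let ?p = "\<lambda>x. x - (u \<bullet> x) *\<^sub>R u" and ?i = "\<lambda>x. indicator {0..1} (u \<bullet> x) :: ennreal"
  have "(\<integral>\<^sup>+y. (\<integral>\<^sup>+s. k y s \<partial>lborel) \<partial>?\<mu>) = (\<integral>\<^sup>+x. (\<integral>\<^sup>+s. k (?p x) s \<partial>lborel) * ?i x \<partial>lborel)"
    by (simp add: nn_integral_flat_lborel_hyperplane[OF u])
  also have "\<dots> = (\<integral>\<^sup>+x. (\<integral>\<^sup>+s. k (?p x) s * ?i x \<partial>lborel) \<partial>lborel)"
    by (intro nn_integral_cong nn_integral_multc[symmetric]) measurable
  also have "\<dots> = (\<integral>\<^sup>+s. (\<integral>\<^sup>+x. k (?p x) s * ?i x \<partial>lborel) \<partial>lborel)"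
    by (rule lborel_pair.Fubini') measurable
  also have "\<dots> = (\<integral>\<^sup>+s. (\<integral>\<^sup>+y. k y s \<partial>?\<mu>) \<partial>lborel)"
    by (simp add: nn_integral_flat_lborel_hyperplane[OF u])
  finally show ?thesis .
qed

section \<open>Volumes of cone sections and cone segments\<close>

lemma nn_integral_power_Icc:
  assumes "0 \<le> a"
  shows "(\<integral>\<^sup>+s. ennreal (s ^ m) * indicator {0..a} s \<partial>lborel) = ennreal (a ^ Suc m / Suc m)"
proof -
  have D: "((\<lambda>s. s ^ Suc m / Suc m) has_real_derivative s ^ m) (at s)" for s :: real
    using DERIV_cdivide[OF DERIV_pow[of "Suc m" s], of "real (Suc m)"] by simp
  have "(\<integral>\<^sup>+s. ennreal (s ^ m) * indicator {0..a} s \<partial>lborel)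
      = ennreal (a ^ Suc m / Suc m - 0 ^ Suc m / Suc m)"
    by (rule nn_integral_FTC_Icc[where F="\<lambda>s. s ^ Suc m / Suc m"])
      (use assms D in auto)
  then show ?thesis by simp
qed

lemma flat_volume_eq_nn_integral:
  "X \<in> sets borel \<Longrightarrow> flat_volume S X = (\<integral>\<^sup>+x. indicator X x \<partial>flat_lborel S)"
  unfolding flat_volume_def by (rule nn_integral_indicator[symmetric]) simp

lemma flat_volume_hyperplane:
  fixes u :: "'a::euclidean_space"
  assumes u: "norm u = 1" and [measurable]: "X \<in> sets borel"
  shows "flat_volume {x. u \<bullet> x = 0} X
       = emeasure lborel {x. x - (u \<bullet> x) *\<^sub>R u \<in> X \<and> 0 \<le> u \<bullet> x \<and> u \<bullet> x \<le> 1}"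
proof -
  have "flat_volume {x. u \<bullet> x = 0} X
      = (\<integral>\<^sup>+x. indicator {x. x - (u \<bullet> x) *\<^sub>R u \<in> X \<and> 0 \<le> u \<bullet> x \<and> u \<bullet> x \<le> 1} x \<partial>lborel)"
    unfolding flat_volume_eq_nn_integral[OF assms(2)]
    by (subst nn_integral_flat_lborel_hyperplane[OF u], simp)
      (intro nn_integral_cong, auto simp: indicator_def)
  also have "\<dots> = emeasure lborel {x. x - (u \<bullet> x) *\<^sub>R u \<in> X \<and> 0 \<le> u \<bullet> x \<and> u \<bullet> x \<le> 1}"
    by (rule nn_integral_indicator) measurable
  finally show ?thesis .
qed

text \<open>Slices of \<open>K\<close> orthogonal to \<open>b\<close> at distance \<open>s\<close>
  are homothetic, with volume \<open>s ^ m\<close> times the volume \<kappa> at distance 1.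
  Integrating up to \<open>1 / norm b\<close> gives the truncated cone; evaluating at
  \<open>1 / norm b\<close> gives the section.\<close>

lemma flat_volume_cone_section:
  fixes K :: "'a::euclidean_space set"
  assumes [measurable]: "K \<in> sets borel" and K: "\<And>c x. c > 0 \<Longrightarrow> c *\<^sub>R x \<in> K \<longleftrightarrow> x \<in> K"
    and b: "b \<noteq> 0" "\<And>x. x \<in> K \<Longrightarrow> 0 \<le> b \<bullet> x"
  shows "flat_volume {x. b \<bullet> x = 1} (K \<inter> {x. b \<bullet> x = 1})
       = ennreal (real DIM('a) * norm b) * emeasure lborel {x \<in> K. b \<bullet> x \<le> 1}"
proof -
  define r where "r = norm b"
  define u where "u = b /\<^sub>R r"
  have r: "r > 0" using b by (simp add: r_def)
  have u: "norm u = 1" using r by (simp add: u_def r_def)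
  have bu: "b = r *\<^sub>R u" using r by (simp add: u_def)
  have uu: "u \<bullet> u = 1" using u by (simp add: norm_eq_1)
  let ?\<mu> = "flat_lborel {x. u \<bullet> x = 0}"
  define m where "m = DIM('a) - 1"
  have m: "Suc m = DIM('a)" using DIM_positive[where 'a='a] by (simp add: m_def)
  define \<kappa> where "\<kappa> = (\<integral>\<^sup>+y. indicator K (y + u) \<partial>?\<mu>)"
  have slice: "(\<integral>\<^sup>+y. indicator K (y + s *\<^sub>R u) \<partial>?\<mu>) = ennreal (s ^ m) * \<kappa>" if s: "s > 0" for s
  proof -
    have "(\<integral>\<^sup>+y. indicator K (y + s *\<^sub>R u) \<partial>?\<mu>)
        = ennreal (s ^ m) * (\<integral>\<^sup>+y. indicator K (s *\<^sub>R y + s *\<^sub>R u) \<partial>?\<mu>)"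
      unfolding m_def by (rule nn_integral_flat_lborel_scaleR[OF u s]) measurable
    also have "(\<integral>\<^sup>+y. indicator K (s *\<^sub>R y + s *\<^sub>R u) \<partial>?\<mu>) = \<kappa>"
      unfolding \<kappa>_def
      using K[OF s, of "_ + u"] by (intro nn_integral_cong) (simp add: indicator_def scaleR_add_right)
    finally show ?thesis .
  qed
  have "emeasure lborel {x \<in> K. b \<bullet> x \<le> 1} = (\<integral>\<^sup>+x. indicator {x \<in> K. b \<bullet> x \<le> 1} x \<partial>lborel)"
    by (rule nn_integral_indicator[symmetric]) measurable
  also have "\<dots> = (\<integral>\<^sup>+s. (\<integral>\<^sup>+y. indicator {x \<in> K. b \<bullet> x \<le> 1} (y + s *\<^sub>R u) \<partial>?\<mu>) \<partial>lborel)"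
    by (rule nn_integral_lborel_hyperplane[OF u]) measurable
  also have "\<dots> = (\<integral>\<^sup>+s. ennreal (s ^ m) * indicator {0..1/r} s * \<kappa> \<partial>lborel)"
  proof (intro nn_integral_cong_AE)
    show "AE s in lborel. (\<integral>\<^sup>+y. indicator {x \<in> K. b \<bullet> x \<le> 1} (y + s *\<^sub>R u) \<partial>?\<mu>)
        = ennreal (s ^ m) * indicator {0..1/r} s * \<kappa>"
      using AE_lborel_singleton[of 0]
    proof eventually_elim
      \<comment> \<open>Homogeneity holds for positive scalars only, so the slice through the vertex
        is discarded as a null level.\<close>
      fix s :: real assume s0: "s \<noteq> 0"
      have "(\<integral>\<^sup>+y. indicator {x \<in> K. b \<bullet> x \<le> 1} (y + s *\<^sub>R u) \<partial>?\<mu>)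
          = (\<integral>\<^sup>+y. indicator K (y + s *\<^sub>R u) * indicator {0..1/r} s \<partial>?\<mu>)"
        using AE_flat_lborel_hyperplane[OF u, of 0]
      proof (intro nn_integral_cong_AE, eventually_elim)
        fix y assume "u \<bullet> y = 0"
        then have "b \<bullet> (y + s *\<^sub>R u) = r * s" by (simp add: bu uu inner_add_right)
        then show "indicator {x \<in> K. b \<bullet> x \<le> 1} (y + s *\<^sub>R u)
            = (indicator K (y + s *\<^sub>R u) * indicator {0..1/r} s :: ennreal)"
          using b(2)[of "y + s *\<^sub>R u"] r
          by (auto simp: indicator_def zero_le_mult_iff field_simps)
      qed
      also have "\<dots> = (\<integral>\<^sup>+y. indicator K (y + s *\<^sub>R u) \<partial>?\<mu>) * indicator {0..1/r} s"
        by (rule nn_integral_multc) measurable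
      also have "\<dots> = ennreal (s ^ m) * indicator {0..1/r} s * \<kappa>"
        using slice[of s] s0 by (auto simp: indicator_def)
      finally show "(\<integral>\<^sup>+y. indicator {x \<in> K. b \<bullet> x \<le> 1} (y + s *\<^sub>R u) \<partial>?\<mu>) = \<dots>" .
    qed
  qed
  also have "\<dots> = ennreal ((1/r) ^ Suc m / Suc m) * \<kappa>"
    using r by (subst nn_integral_multc) (auto simp: nn_integral_power_Icc)
  finally have F: "emeasure lborel {x \<in> K. b \<bullet> x \<le> 1} = ennreal ((1/r) ^ Suc m / Suc m) * \<kappa>" .
  have S: "{x. b \<bullet> x = 1} = {x. u \<bullet> x = 1/r}" using r by (auto simp: bu field_simps)
  have "flat_volume {x. b \<bullet> x = 1} (K \<inter> {x. b \<bullet> x = 1})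
      = (\<integral>\<^sup>+x. indicator (K \<inter> {x. u \<bullet> x = 1/r}) x \<partial>flat_lborel {x. u \<bullet> x = 1/r})"
    unfolding S by (rule flat_volume_eq_nn_integral) measurable
  also have "\<dots> = (\<integral>\<^sup>+x. indicator K x \<partial>flat_lborel {x. u \<bullet> x = 1/r})"
    using AE_flat_lborel_hyperplane[OF u, of "1/r"]
    by (intro nn_integral_cong_AE, eventually_elim) (auto simp: indicator_def)
  also have "\<dots> = (\<integral>\<^sup>+y. indicator K (y + (1/r) *\<^sub>R u) \<partial>?\<mu>)"
    by (rule nn_integral_flat_lborel_shift[OF u]) measurable
  also have "\<dots> = ennreal ((1/r) ^ m) * \<kappa>" using r by (intro slice) simp
  also have "\<dots> = ennreal (real DIM('a) * norm b) * (ennreal ((1/r) ^ Suc m / Suc m) * \<kappa>)"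
  proof -
    have "(1/r) ^ m = real DIM('a) * norm b * ((1/r) ^ Suc m / Suc m)"
      using r unfolding m r_def[symmetric] by (simp flip: m)
    then have "ennreal ((1/r) ^ m) = ennreal (real DIM('a) * norm b) * ennreal ((1/r) ^ Suc m / Suc m)"
      using r by (simp add: ennreal_mult[symmetric])
    then show ?thesis by (simp add: mult.assoc)
  qed
  finally show ?thesis unfolding F .
qed

text \<open>The set on the right is the pyramid of height 1 over the segment. Its slice at height
  \<open>s\<close> is the base scaled by \<open>1 - s\<close>, and \<open>(1 - s) ^ m\<close>
  integrates to \<open>1 / DIM('a)\<close> over the unit interval.\<close>

lemma flat_volume_pyramid:
  fixes u :: "'a::euclidean_space"
  assumes u: "norm u = 1" and [measurable]: "L \<in> sets borel"
    and L: "\<And>c x. c > 0 \<Longrightarrow> c *\<^sub>R x \<in> L \<longleftrightarrow> x \<in> L"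
    and \<beta>: "\<And>x. x \<in> L \<Longrightarrow> 0 \<le> \<beta> \<bullet> x"
  shows "flat_volume {x. u \<bullet> x = 0} {y \<in> L. \<beta> \<bullet> y \<le> 1}
       = ennreal (real DIM('a)) * emeasure lborel
           {z. z - (u \<bullet> z) *\<^sub>R u \<in> L \<and> 0 \<le> u \<bullet> z \<and> \<beta> \<bullet> (z - (u \<bullet> z) *\<^sub>R u) + u \<bullet> z \<le> 1}"
    (is "?V = _ * emeasure lborel ?M")
proof -
  have uu: "u \<bullet> u = 1" using u by (simp add: norm_eq_1)
  let ?\<mu> = "flat_lborel {x. u \<bullet> x = 0}"
  define m where "m = DIM('a) - 1"
  have m: "Suc m = DIM('a)" using DIM_positive[where 'a='a] by (simp add: m_def)
  have V: "?V = (\<integral>\<^sup>+y. indicator {y \<in> L. \<beta> \<bullet> y \<le> 1} y \<partial>?\<mu>)"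
    by (rule flat_volume_eq_nn_integral) measurable
  have slice: "(\<integral>\<^sup>+y. indicator {y \<in> L. \<beta> \<bullet> y \<le> s} y \<partial>?\<mu>) = ennreal (s ^ m) * ?V" if s: "s > 0" for s
  proof -
    have "(\<integral>\<^sup>+y. indicator {y \<in> L. \<beta> \<bullet> y \<le> s} y \<partial>?\<mu>)
        = ennreal (s ^ m) * (\<integral>\<^sup>+y. indicator {y \<in> L. \<beta> \<bullet> y \<le> s} (s *\<^sub>R y) \<partial>?\<mu>)"
      unfolding m_def by (rule nn_integral_flat_lborel_scaleR[OF u s]) measurable
    also have "(\<integral>\<^sup>+y. indicator {y \<in> L. \<beta> \<bullet> y \<le> s} (s *\<^sub>R y) \<partial>?\<mu>) = ?V"
      unfolding V using L[OF s] s by (intro nn_integral_cong) (auto simp: indicator_def)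
    finally show ?thesis .
  qed
  have "emeasure lborel ?M = (\<integral>\<^sup>+x. indicator ?M x \<partial>lborel)"
    by (rule nn_integral_indicator[symmetric]) measurable
  also have "\<dots> = (\<integral>\<^sup>+s. (\<integral>\<^sup>+y. indicator ?M (y + s *\<^sub>R u) \<partial>?\<mu>) \<partial>lborel)"
    by (rule nn_integral_lborel_hyperplane[OF u]) measurable
  also have "\<dots> = (\<integral>\<^sup>+s. ennreal ((1 - s) ^ m) * indicator {0..1} (1 - s) * ?V \<partial>lborel)"
  proof (intro nn_integral_cong_AE)
    show "AE s in lborel. (\<integral>\<^sup>+y. indicator ?M (y + s *\<^sub>R u) \<partial>?\<mu>)
        = ennreal ((1 - s) ^ m) * indicator {0..1} (1 - s) * ?V"
      using AE_lborel_singleton[of 1]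
    proof eventually_elim
      \<comment> \<open>At height 1 the slice is cut from \<open>L\<close> by
        \<open>\<beta> \<bullet> y \<le> 0\<close> and need not be a rescaled base; this single
        height is null.\<close>
      fix s :: real assume s1: "s \<noteq> 1"
      have "(\<integral>\<^sup>+y. indicator ?M (y + s *\<^sub>R u) \<partial>?\<mu>)
          = (\<integral>\<^sup>+y. indicator {y \<in> L. \<beta> \<bullet> y \<le> 1 - s} y * indicator {0..1} (1 - s) \<partial>?\<mu>)"
        using AE_flat_lborel_hyperplane[OF u, of 0]
      proof (intro nn_integral_cong_AE, eventually_elim)
        fix y assume "u \<bullet> y = 0"
        then have "u \<bullet> (y + s *\<^sub>R u) = s" by (simp add: uu inner_add_right)
        then show "indicator ?M (y + s *\<^sub>R u)
            = (indicator {y \<in> L. \<beta> \<bullet> y \<le> 1 - s} y * indicator {0..1} (1 - s) :: ennreal)"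
          using \<beta>[of y] by (auto simp: indicator_def)
      qed
      also have "\<dots> = (\<integral>\<^sup>+y. indicator {y \<in> L. \<beta> \<bullet> y \<le> 1 - s} y \<partial>?\<mu>) * indicator {0..1} (1 - s)"
        by (rule nn_integral_multc) measurable
      also have "\<dots> = ennreal ((1 - s) ^ m) * indicator {0..1} (1 - s) * ?V"
        using slice[of "1 - s"] s1 by (auto simp: indicator_def)
      finally show "(\<integral>\<^sup>+y. indicator ?M (y + s *\<^sub>R u) \<partial>?\<mu>) = \<dots>" .
    qed
  qed
  also have "\<dots> = (\<integral>\<^sup>+s. ennreal ((1 - s) ^ m) * indicator {0..1} (1 - s) \<partial>lborel) * ?V"
    by (rule nn_integral_multc) measurable
  also have "(\<integral>\<^sup>+s. ennreal ((1 - s) ^ m) * indicator {0..1} (1 - s) \<partial>lborel)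
      = (\<integral>\<^sup>+s. ennreal (s ^ m) * indicator {0..1} s \<partial>lborel)"
    using nn_integral_real_affine[of "\<lambda>s. ennreal (s ^ m) * indicator {0..1} s" "-1" 1] by simp
  also have "\<dots> = ennreal (1 / Suc m)" by (simp add: nn_integral_power_Icc)
  finally have "ennreal (real DIM('a)) * emeasure lborel ?M
      = (ennreal (real DIM('a)) * ennreal (1 / real DIM('a))) * ?V"
    by (simp add: m mult.assoc)
  also have "ennreal (real DIM('a)) * ennreal (1 / real DIM('a)) = 1"
    by (simp add: ennreal_mult[symmetric])
  finally show ?thesis by simp
qed

section \<open>Limits and infinite volumes\<close>

text \<open>The frontier of a convex set is negligible. The lower bounds for limits below control
  only interior points of the limiting body, and this closes the gap.\<close>

lemma emeasure_lborel_interior_convex: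
  fixes S :: "'a::euclidean_space set"
  assumes "convex S" and S: "S \<in> sets borel"
  shows "emeasure lborel S = emeasure lborel (interior S)"
proof -
  have "frontier S \<in> null_sets lebesgue"
    using negligible_convex_frontier[OF \<open>convex S\<close>] negligible_iff_null_sets by blast
  then have "frontier S \<in> null_sets lborel"
    by (metis null_sets_completion_iff borel_closed frontier_closed sets_lborel)
  then have "emeasure lborel (interior S \<union> frontier S) = emeasure lborel (interior S)"
    by (intro emeasure_Un_null_set) auto
  moreover have "emeasure lborel S \<le> emeasure lborel (interior S \<union> frontier S)"
    using closure_subset[of S] by (intro emeasure_mono) (auto simp: frontier_def)
  moreover have "emeasure lborel (interior S) \<le> emeasure lborel S"
    using S by (intro emeasure_mono interior_subset) auto
  ultimately show ?thesis by simp
qed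

lemma emeasure_lborel_pos:
  fixes S :: "'a::euclidean_space set"
  assumes "open U" "U \<noteq> {}" "U \<subseteq> S" "S \<in> sets borel"
  shows "emeasure lborel S > 0"
proof -
  have "U \<notin> null_sets lebesgue"
    using open_not_negligible[OF assms(1,2)] negligible_iff_null_sets by blast
  then have "emeasure lborel U \<noteq> 0"
    using assms(1) by (auto simp: null_sets_completion_iff null_sets_def)
  moreover have "emeasure lborel U \<le> emeasure lborel S"
    using assms by (intro emeasure_mono) auto
  ultimately show ?thesis
    by (metis le_zero_eq not_gr_zero)
qed

text \<open>
  The translates \<open>Z + k *\<^sub>R a\<close> decrease with \<open>k\<close>, have the same measure and empty intersection.
\<close>
lemma emeasure_lborel_recession:
  fixes Z :: "'a::euclidean_space set"
  assumes Z[measurable]: "Z \<in> sets borel" and pos: "emeasure lborel Z \<noteq> 0"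
    and add: "\<And>z. z \<in> Z \<Longrightarrow> z + a \<in> Z" and ex: "\<And>z. \<exists>k::nat. z - real k *\<^sub>R a \<notin> Z"
  shows "emeasure lborel Z = \<infinity>"
proof (rule ccontr)
  assume fin: "emeasure lborel Z \<noteq> \<infinity>"
  define T where "T k = {z. z - real k *\<^sub>R a \<in> Z}" for k
  have [measurable]: "T k \<in> sets borel" for k
    unfolding T_def by measurable
  have eq: "emeasure lborel (T k) = emeasure lborel Z" for k
  proof -
    have "emeasure lborel (T k) = (\<integral>\<^sup>+z. indicator (T k) z \<partial>lborel)"
      by (rule nn_integral_indicator[symmetric]) measurable
    also have "\<dots> = (\<integral>\<^sup>+z. indicator Z (- (real k *\<^sub>R a) + z) \<partial>lborel)"
      by (intro nn_integral_cong) (simp add: T_def indicator_def)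
    also have "\<dots> = (\<integral>\<^sup>+z. indicator Z z \<partial>lborel)"
      by (rule nn_integral_lborel_add) measurable
    finally show ?thesis by simp
  qed
  have "z \<in> T k" if "z \<in> T (Suc k)" for z k
    using add[of "z - real (Suc k) *\<^sub>R a"] that by (simp add: T_def algebra_simps)
  then have "decseq T" by (intro decseq_SucI) auto
  then have "(INF k. emeasure lborel (T k)) = emeasure lborel (\<Inter>k. T k)"
    using fin eq by (intro INF_emeasure_decseq) auto
  moreover have "(\<Inter>k. T k) = {}" using ex by (auto simp: T_def)
  ultimately show False using pos by (simp add: eq)
qed

text \<open>Fatou's lemma for scaled indicators. The convergent factor stays inside the integral, so
  no limit of a product with possibly infinite measures has to be split.\<close>

lemma emeasure_le_liminf:
  fixes c :: "nat \<Rightarrow> real"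
  assumes X: "X \<in> sets M" "\<And>k. Y k \<in> sets M" and c: "c \<longlonglongrightarrow> c0"
    and ev: "\<And>z. z \<in> X \<Longrightarrow> eventually (\<lambda>k. z \<in> Y k) sequentially"
  shows "ennreal c0 * emeasure M X \<le> liminf (\<lambda>k. ennreal (c k) * emeasure M (Y k))"
proof -
  let ?u = "\<lambda>k z. ennreal (c k) * indicator (Y k) z"
  have "ennreal c0 * indicator X z \<le> liminf (\<lambda>k. ?u k z)" for z
  proof (cases "z \<in> X")
    case True
    have "(\<lambda>k. ennreal (c k)) \<longlonglongrightarrow> ennreal c0" using c by (rule tendsto_ennrealI)
    then have "(\<lambda>k. ?u k z) \<longlonglongrightarrow> ennreal c0"
      by (rule Lim_transform_eventually) (use ev[OF True] in eventually_elim, simp)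
    then have "liminf (\<lambda>k. ?u k z) = ennreal c0" by (intro lim_imp_Liminf) auto
    then show ?thesis using True by simp
  qed simp
  then have "(\<integral>\<^sup>+z. ennreal c0 * indicator X z \<partial>M) \<le> (\<integral>\<^sup>+z. liminf (\<lambda>k. ?u k z) \<partial>M)"
    by (intro nn_integral_mono) auto
  also have "\<dots> \<le> liminf (\<lambda>k. \<integral>\<^sup>+z. ?u k z \<partial>M)"
    by (rule nn_integral_liminf) (use X in measurable)
  finally show ?thesis using X by (simp add: nn_integral_cmult)
qed

text \<open>The reverse Fatou inequality; the integrable majorant is a bound for the convergent
  factors times the indicator of \<open>W\<close>.\<close>

lemma limsup_le_emeasure:
  fixes c :: "nat \<Rightarrow> real"
  assumes X: "X \<in> sets M" "\<And>k. Y k \<in> sets M" and c: "c \<longlonglongrightarrow> c0"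
    and W: "W \<in> sets M" "emeasure M W < \<infinity>" "\<And>k. Y k \<subseteq> W"
    and ev: "\<And>z. z \<notin> X \<Longrightarrow> eventually (\<lambda>k. z \<notin> Y k) sequentially"
  shows "limsup (\<lambda>k. ennreal (c k) * emeasure M (Y k)) \<le> ennreal c0 * emeasure M X"
proof -
  let ?u = "\<lambda>k z. ennreal (c k) * indicator (Y k) z"
  have lim: "(\<lambda>k. ennreal (c k)) \<longlonglongrightarrow> ennreal c0" using c by (rule tendsto_ennrealI)
  obtain C where C: "\<And>k. norm (c k) \<le> C"
    using c convergent_imp_Bseq[OF convergentI] by (metis BseqE)
  have "limsup (\<lambda>k. ?u k z) \<le> ennreal c0 * indicator X z" for z
  proof (cases "z \<in> X")
    case True
    have "limsup (\<lambda>k. ?u k z) \<le> limsup (\<lambda>k. ennreal (c k))"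
      by (intro Limsup_mono always_eventually allI) (simp add: indicator_def)
    also have "\<dots> = ennreal c0" using lim by (intro lim_imp_Limsup) auto
    finally show ?thesis using True by simp
  next
    case False
    have "(\<lambda>k. ?u k z) \<longlonglongrightarrow> 0"
      by (rule Lim_transform_eventually[OF tendsto_const]) (use ev[OF False] in eventually_elim, simp)
    then show ?thesis using False by (simp add: lim_imp_Limsup)
  qed
  then have le: "(\<integral>\<^sup>+z. limsup (\<lambda>k. ?u k z) \<partial>M) \<le> (\<integral>\<^sup>+z. ennreal c0 * indicator X z \<partial>M)"
    by (intro nn_integral_mono) auto
  have "limsup (\<lambda>k. \<integral>\<^sup>+z. ?u k z \<partial>M) \<le> (\<integral>\<^sup>+z. limsup (\<lambda>k. ?u k z) \<partial>M)"
  proof (rule nn_integral_limsup[where w="\<lambda>z. ennreal C * indicator W z"])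
    show "AE z in M. ?u k z \<le> ennreal C * indicator W z" for k
      using C[of k] W(3)[of k] by (auto simp: indicator_def intro!: ennreal_leI)
    show "(\<integral>\<^sup>+z. ennreal C * indicator W z \<partial>M) < \<infinity>"
      using W by (simp add: nn_integral_cmult ennreal_mult_less_top)
  qed (use X W in measurable)
  then show ?thesis using le X by (simp add: nn_integral_cmult)
qed

text \<open>Slicing along \<open>u\<close> leaves a one-dimensional substitution of ratio
  \<open>r\<close>; the directions of the hyperplane are untouched.\<close>

lemma nn_integral_lborel_stretch:
  fixes u :: "'a::euclidean_space"
  assumes u: "norm u = 1" and l: "r > 0" and [measurable]: "g \<in> borel_measurable borel"
  shows "ennreal r * (\<integral>\<^sup>+x. g x \<partial>lborel)
       = (\<integral>\<^sup>+z. g (z - (u \<bullet> z) *\<^sub>R u + ((u \<bullet> z) / r) *\<^sub>R u) \<partial>lborel)"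
proof -
  have uu: "u \<bullet> u = 1" using u by (simp add: norm_eq_1)
  let ?\<mu> = "flat_lborel {x. u \<bullet> x = 0}"
  have [measurable]: "(\<lambda>s. \<integral>\<^sup>+y. g (y + s *\<^sub>R u) \<partial>?\<mu>) \<in> borel_measurable borel"
    by (subst nn_integral_flat_lborel_hyperplane[OF u]) measurable
  have "(\<integral>\<^sup>+z. g (z - (u \<bullet> z) *\<^sub>R u + ((u \<bullet> z) / r) *\<^sub>R u) \<partial>lborel)
      = (\<integral>\<^sup>+s. (\<integral>\<^sup>+y. g ((y + s *\<^sub>R u) - (u \<bullet> (y + s *\<^sub>R u)) *\<^sub>R u
          + ((u \<bullet> (y + s *\<^sub>R u)) / r) *\<^sub>R u) \<partial>?\<mu>) \<partial>lborel)"
    by (rule nn_integral_lborel_hyperplane[OF u]) measurable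
  also have "\<dots> = (\<integral>\<^sup>+s. (\<integral>\<^sup>+y. g (y + (s / r) *\<^sub>R u) \<partial>?\<mu>) \<partial>lborel)"
  proof (rule nn_integral_cong, rule nn_integral_cong_AE)
    fix s :: real
    show "AE y in ?\<mu>. g ((y + s *\<^sub>R u) - (u \<bullet> (y + s *\<^sub>R u)) *\<^sub>R u
          + ((u \<bullet> (y + s *\<^sub>R u)) / r) *\<^sub>R u) = g (y + (s / r) *\<^sub>R u)"
      using AE_flat_lborel_hyperplane[OF u, of 0]
      by eventually_elim (simp add: inner_add_right uu)
  qed
  also have "\<dots> = ennreal r * (\<integral>\<^sup>+s. (\<integral>\<^sup>+y. g (y + s *\<^sub>R u) \<partial>?\<mu>) \<partial>lborel)"
    using nn_integral_real_affine[of "\<lambda>s. \<integral>\<^sup>+y. g (y + s *\<^sub>R u) \<partial>?\<mu>" "1/r" 0] l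
    by (simp add: mult.assoc[symmetric] ennreal_mult[symmetric])
  also have "(\<integral>\<^sup>+s. (\<integral>\<^sup>+y. g (y + s *\<^sub>R u) \<partial>?\<mu>) \<partial>lborel) = (\<integral>\<^sup>+x. g x \<partial>lborel)"
    by (rule nn_integral_lborel_hyperplane[OF u, symmetric]) measurable
  finally show ?thesis ..
qed

section \<open>Cones and their duals\<close>

lemma coneD: "cone S \<Longrightarrow> x \<in> S \<Longrightarrow> 0 \<le> c \<Longrightarrow> c *\<^sub>R x \<in> S"
  by (simp add: cone_def)

lemma cone_scaleR_iff: "cone S \<Longrightarrow> 0 < c \<Longrightarrow> c *\<^sub>R x \<in> S \<longleftrightarrow> x \<in> S"
  using coneD[of S x c] coneD[of S "c *\<^sub>R x" "1/c"] by auto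

lemma convex_cone_add:
  assumes "cone S" "convex S" "x \<in> S" "y \<in> S"
  shows "x + y \<in> S"
proof -
  have "(1/2) *\<^sub>R x + (1/2) *\<^sub>R y \<in> S" using assms by (intro convexD) auto
  then have "2 *\<^sub>R ((1/2) *\<^sub>R x + (1/2) *\<^sub>R y) \<in> S" using assms(1) by (intro coneD) auto
  then show ?thesis by (simp add: scaleR_add_right)
qed

text \<open>A positive functional has a positive minimum on the compact set of unit vectors of the
  cone, and homogeneity spreads it. The resulting \<epsilon> supplies the radii of the balls that
  enclose caps, pyramids and segments below.\<close>

lemma closed_cone_pos_bound:
  fixes L :: "'a::euclidean_space set"
  assumes "closed L" "cone L" and pos: "\<And>x. x \<in> L \<Longrightarrow> x \<noteq> 0 \<Longrightarrow> 0 < \<beta> \<bullet> x"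
  obtains \<epsilon> where "\<epsilon> > 0" "\<And>x. x \<in> L \<Longrightarrow> \<epsilon> * norm x \<le> \<beta> \<bullet> x"
proof (cases "L \<inter> sphere 0 1 = {}")
  \<comment> \<open>Without unit vectors the cone contains at most the origin, and any \<epsilon>
    will do.\<close>
  case True
  have "x = 0" if "x \<in> L" for x
  proof (rule ccontr)
    assume "x \<noteq> 0"
    then have "x /\<^sub>R norm x \<in> L \<inter> sphere 0 1" using coneD[OF assms(2) that] by simp
    then show False using True by blast
  qed
  then show ?thesis by (intro that[of 1]) fastforce+
next
  case False
  have "compact (L \<inter> sphere 0 1)" using assms(1) by (simp add: closed_Int_compact)
  then obtain x0 where x0: "x0 \<in> L \<inter> sphere 0 1" "\<And>x. x \<in> L \<inter> sphere 0 1 \<Longrightarrow> \<beta> \<bullet> x0 \<le> \<beta> \<bullet> x"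
    using continuous_attains_inf[OF _ False continuous_on_inner[OF continuous_on_const continuous_on_id]]
    by blast
  have "(\<beta> \<bullet> x0) * norm x \<le> \<beta> \<bullet> x" if "x \<in> L" for x
  proof (cases "x = 0")
    case nz: False
    then have "x /\<^sub>R norm x \<in> L \<inter> sphere 0 1" using coneD[OF assms(2) that] by simp
    then show ?thesis using x0(2)[of "x /\<^sub>R norm x"] nz by (simp add: field_simps)
  qed simp
  moreover have "0 < \<beta> \<bullet> x0" using x0(1) by (intro pos) auto
  ultimately show ?thesis using that by blast
qed

text \<open>Moving \<open>b\<close> by \<open>e\<close> against the direction of \<open>x\<close>
  stays in the dual cone only if \<open>b \<bullet> x\<close> is at least \<open>e * norm x\<close>;
  conversely, the uniform bound from compactness absorbs every perturbation of norm at most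
  \<open>e\<close>. Admissibility thus becomes strict positivity.\<close>

lemma interior_dual_cone:
  fixes K :: "'a::euclidean_space set"
  assumes "closed K" "cone K"
  shows "b \<in> interior (dual_cone K) \<longleftrightarrow> (\<forall>x\<in>K - {0}. 0 < b \<bullet> x)"
proof
  assume "b \<in> interior (dual_cone K)"
  then obtain e where e: "e > 0" "cball b e \<subseteq> dual_cone K"
    using mem_interior_cball by blast
  show "\<forall>x\<in>K - {0}. 0 < b \<bullet> x"
  proof
    fix x assume x: "x \<in> K - {0}"
    have "b - (e / norm x) *\<^sub>R x \<in> cball b e" using x e by (simp add: dist_norm)
    then have "b - (e / norm x) *\<^sub>R x \<in> dual_cone K" using e by blast
    then have "0 \<le> (b - (e / norm x) *\<^sub>R x) \<bullet> x" using x by (simp add: dual_cone_def)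
    then have "e * norm x \<le> b \<bullet> x"
      using x by (simp add: inner_diff_left dot_square_norm power2_eq_square)
    moreover have "0 < e * norm x" using x e by simp
    ultimately show "0 < b \<bullet> x" by linarith
  qed
next
  assume pos: "\<forall>x\<in>K - {0}. 0 < b \<bullet> x"
  obtain e where e: "e > 0" "\<And>x. x \<in> K \<Longrightarrow> e * norm x \<le> b \<bullet> x"
    using closed_cone_pos_bound[OF assms, of b] pos by (metis DiffI singletonD)
  have "cball b e \<subseteq> dual_cone K"
  proof
    fix c assume c: "c \<in> cball b e"
    have "0 \<le> c \<bullet> x" if x: "x \<in> K" for x
    proof -
      have "\<bar>(b - c) \<bullet> x\<bar> \<le> norm (b - c) * norm x" by (rule Cauchy_Schwarz_ineq2)
      also have "\<dots> \<le> e * norm x" using c by (intro mult_right_mono) (auto simp: dist_norm)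
      finally show ?thesis using e(2)[OF x] by (simp add: inner_diff_left)
    qed
    then show "c \<in> dual_cone K" by (auto simp: dual_cone_def)
  qed
  then show "b \<in> interior (dual_cone K)" using e(1) mem_interior_cball by blast
qed

text \<open>If \<open>K\<^sup>*\<close> lay in a hyperplane, then its normal would belong to \<open>K \<inter> -K\<close>, because \<open>K\<^sup>*\<^sup>* = K\<close>.\<close>
lemma interior_dual_cone_nonempty:
  fixes K :: "'a::euclidean_space set"
  assumes "closed K" "convex K" "cone K" "K \<inter> uminus ` K = {0}"
  shows "interior (dual_cone K) \<noteq> {}"
proof
  assume empty: "interior (dual_cone K) = {}"
  have "convex (dual_cone K)"
    by (auto simp: convex_def dual_cone_def inner_add_left)
  then obtain a r where a: "a \<noteq> 0" "dual_cone K \<subseteq> {x. a \<bullet> x = r}"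
    using empty_interior_subset_hyperplane[OF _ empty] by metis
  have "0 \<in> dual_cone K" by (simp add: dual_cone_def)
  then have r: "r = 0" using a by auto
  have bidual: "w \<in> K" if w: "\<And>y. y \<in> dual_cone K \<Longrightarrow> 0 \<le> y \<bullet> w" for w
  proof (rule ccontr)
    assume "w \<notin> K"
    then obtain y s where y: "y \<bullet> w < s" "\<And>x. x \<in> K \<Longrightarrow> s < y \<bullet> x"
      using separating_hyperplane_closed_point[OF assms(2,1)] by metis
    have K0: "0 \<in> K" using assms(4) by auto
    then have s: "s < 0" using y(2)[of 0] by simp
    have "0 \<le> y \<bullet> x" if x: "x \<in> K" for x
    proof (rule ccontr)
      assume neg: "\<not> 0 \<le> y \<bullet> x"
      then have "(s / (y \<bullet> x)) *\<^sub>R x \<in> K" using assms(3) x s by (intro coneD divide_nonpos_nonpos) auto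
      from y(2)[OF this] show False using neg by simp
    qed
    then have "y \<in> dual_cone K" by (simp add: dual_cone_def)
    then show False using w[of y] y s by simp
  qed
  have "a \<in> K" "- a \<in> K" using a r by (auto intro!: bidual simp: inner_commute)
  then have "a \<in> K \<inter> uminus ` K" by (metis IntI image_eqI minus_minus)
  then show False using assms(4) a by auto
qed

text \<open>A functional supporting a cone at \<open>A\<close> vanishes there, as comparison with
  the points 0 and \<open>2 *\<^sub>R A\<close> shows. It serves twice: for \<open>K\<close>, to
  produce a supporting hyperplane, and for the cylinder over a face, to produce the functional that
  drives the volume to 0.\<close>

lemma cone_supporting_hyperplane:
  fixes N :: "'a::euclidean_space set"
  assumes "cone N" "convex N" "A \<in> N" "A \<notin> interior N"
  obtains c where "c \<noteq> 0" "c \<bullet> A = 0" "\<And>y. y \<in> N \<Longrightarrow> 0 \<le> c \<bullet> y"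
proof -
  have N0: "0 \<in> N" using coneD[OF assms(1,3), of 0] by simp
  obtain c where c: "c \<noteq> 0" "\<And>y. y \<in> N \<Longrightarrow> c \<bullet> A \<le> c \<bullet> y"
  proof (cases "interior N = {}")
    \<comment> \<open>A convex set without interior lies in a hyperplane, whose normal is constant
      on the set and hence supports it.\<close>
    case True
    then obtain a r where "a \<noteq> 0" "N \<subseteq> {x. a \<bullet> x = r}"
      using empty_interior_subset_hyperplane[OF assms(2)] by metis
    then have "a \<noteq> 0" "\<forall>y\<in>N. a \<bullet> y = r" by auto
    then show ?thesis using assms(3) by (intro that[of a]) simp_all
  next
    case False
    then obtain a r where a: "a \<noteq> 0" "a \<bullet> A \<le> r" "\<And>y. y \<in> interior N \<Longrightarrow> r \<le> a \<bullet> y"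
      using separating_hyperplane_sets[of "{A}" "interior N"] assms by auto
    have "interior N \<subseteq> {y. a \<bullet> A \<le> a \<bullet> y}" using a by force
    then have "closure (interior N) \<subseteq> {y. a \<bullet> A \<le> a \<bullet> y}"
      by (intro closure_minimal) (auto simp: closed_halfspace_ge)
    moreover have "N \<subseteq> closure (interior N)"
      using convex_closure_interior[OF assms(2) False] closure_subset by blast
    ultimately show ?thesis using a(1) by (intro that[of a]) auto
  qed
  have "c \<bullet> A \<le> 0" using c(2)[OF N0] by simp
  moreover have "c \<bullet> A \<ge> 0"
    using c(2)[of "2 *\<^sub>R A"] coneD[OF assms(1,3), of 2] by simp
  ultimately have "c \<bullet> A = 0" by simp
  then show ?thesis using c that by force
qed

text \<open>On the part of \<open>K\<close> where \<beta> is not positive, \<open>c\<close> is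
  positive away from 0, hence at least \<epsilon> times the norm. The choice of \<open>t\<close>
  makes \<open>t * \<epsilon>\<close> exceed \<open>norm \<beta>\<close>, which bounds how negative
  \<beta> can be on unit vectors.\<close>

lemma cone_lift_functional:
  fixes K :: "'a::euclidean_space set"
  assumes "closed K" "cone K" and c: "\<And>x. x \<in> K \<Longrightarrow> 0 \<le> c \<bullet> x"
    and \<beta>: "\<And>x. x \<in> K \<Longrightarrow> c \<bullet> x = 0 \<Longrightarrow> x \<noteq> 0 \<Longrightarrow> 0 < \<beta> \<bullet> x"
  obtains t where "t \<ge> 0" "\<And>x. x \<in> K \<Longrightarrow> x \<noteq> 0 \<Longrightarrow> 0 < (\<beta> + t *\<^sub>R c) \<bullet> x"
proof -
  let ?L = "K \<inter> {x. \<beta> \<bullet> x \<le> 0}"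
  have "closed ?L" using assms(1) by (intro closed_Int closed_halfspace_le)
  moreover have "cone ?L"
    using assms(2) by (auto simp: cone_def mult_nonneg_nonpos)
  moreover have "0 < c \<bullet> x" if "x \<in> ?L" "x \<noteq> 0" for x
    using c[of x] \<beta>[of x] that by force
  ultimately obtain \<epsilon> where \<epsilon>: "\<epsilon> > 0" "\<And>x. x \<in> ?L \<Longrightarrow> \<epsilon> * norm x \<le> c \<bullet> x"
    using closed_cone_pos_bound by blast
  define t where "t = (norm \<beta> + 1) / \<epsilon>"
  have t_pos: "t > 0" using \<epsilon> by (simp add: t_def add_nonneg_pos)
  have "0 < (\<beta> + t *\<^sub>R c) \<bullet> x" if x: "x \<in> K" "x \<noteq> 0" for x
  proof (cases "\<beta> \<bullet> x \<le> 0")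
    case True
    have "norm \<beta> * norm x < (norm \<beta> + 1) * norm x" using x by simp
    also have "\<dots> = t * (\<epsilon> * norm x)" using \<epsilon> by (simp add: t_def)
    also have "\<dots> \<le> t * (c \<bullet> x)" using \<epsilon>(2)[of x] x True t_pos by (intro mult_left_mono) auto
    finally have "norm \<beta> * norm x < t * (c \<bullet> x)" .
    moreover have "- (\<beta> \<bullet> x) \<le> norm \<beta> * norm x"
      using Cauchy_Schwarz_ineq2[of \<beta> x] by linarith
    ultimately show ?thesis by (simp add: inner_add_left)
  next
    case False
    have "0 \<le> t * (c \<bullet> x)" using c[OF x(1)] t_pos by simp
    then show ?thesis using False by (simp add: inner_add_left)
  qed
  then show ?thesis using that[of t] t_pos by auto
qed

text \<open>Otherwise dividing \<open>z - real k *\<^sub>R a\<close> by \<open>k\<close> and letting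
  \<open>k\<close> grow would put \<open>- a\<close> into the closed cone. This supplies the empty
  intersection in the recession argument.\<close>

lemma closed_cone_leaves:
  fixes L :: "'a::euclidean_space set"
  assumes "closed L" "cone L" "- a \<notin> L"
  shows "\<exists>k::nat. z - real k *\<^sub>R a \<notin> L"
proof (rule ccontr)
  assume "\<not> ?thesis"
  then have L: "z - real k *\<^sub>R a \<in> L" for k :: nat by blast
  have "inverse (real (Suc k)) *\<^sub>R (z - real (Suc k) *\<^sub>R a) \<in> L" for k
    by (rule coneD[OF assms(2) L]) simp
  then have "inverse (real (Suc k)) *\<^sub>R z - a \<in> L" for k
    by (simp add: scaleR_diff_right)
  moreover have "(\<lambda>k. inverse (real (Suc k)) *\<^sub>R z - a) \<longlonglongrightarrow> 0 *\<^sub>R z - a"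
    by (intro tendsto_intros LIMSEQ_inverse_real_of_nat)
  ultimately have "0 *\<^sub>R z - a \<in> L"
    using assms(1) closed_sequentially[of L "\<lambda>k. inverse (real (Suc k)) *\<^sub>R z - a"] by blast
  then show False using assms(3) by simp
qed

section \<open>Sections of a pointed cone\<close>

locale pointed_cone =
  fixes K :: "'a::euclidean_space set"
  assumes closed: "closed K" and convex: "convex K" and cone: "cone K"
    and pointed: "K \<inter> uminus ` K = {0}" and solid: "interior K \<noteq> {}"
begin

text \<open>The truncated cone whose volume the overview calls F(b).\<close>

definition cap :: "'a \<Rightarrow> 'a set" where
  "cap b = {x \<in> K. b \<bullet> x \<le> 1}"

definition section_volume :: "'a \<Rightarrow> ennreal" where
  "section_volume b = flat_volume {x. b \<bullet> x = 1} (K \<inter> {x. b \<bullet> x = 1})"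

lemma zero_in [simp]: "0 \<in> K"
  using pointed by auto

lemma borel [measurable]: "K \<in> sets borel"
  using closed by simp

lemma uminus_notin: "x \<in> K \<Longrightarrow> x \<noteq> 0 \<Longrightarrow> - x \<notin> K"
proof
  assume "x \<in> K" "x \<noteq> 0" "- x \<in> K"
  then have "x \<in> K \<inter> uminus ` K" by (metis IntI image_eqI minus_minus)
  then show False using pointed \<open>x \<noteq> 0\<close> by auto
qed

lemma interior_dual_iff: "b \<in> interior (dual_cone K) \<longleftrightarrow> (\<forall>x\<in>K - {0}. 0 < b \<bullet> x)"
  using interior_dual_cone[OF closed cone] .

lemma interior_dual_nonneg: "b \<in> interior (dual_cone K) \<Longrightarrow> x \<in> K \<Longrightarrow> 0 \<le> b \<bullet> x"
  unfolding interior_dual_iff by (cases "x = 0") (auto intro: less_imp_le)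

lemma cap_borel [measurable]: "cap b \<in> sets borel"
  unfolding cap_def by measurable

lemma cap_eq_Int: "cap b = K \<inter> {x. b \<bullet> x \<le> 1}"
  by (auto simp: cap_def)

lemma convex_cap: "convex (cap b)"
  unfolding cap_eq_Int by (intro convex_Int convex convex_halfspace_le)

text \<open>The interior of \<open>K\<close> accumulates at the vertex, where
  \<open>b \<bullet> x < 1\<close> holds for every \<open>b\<close>.\<close>

lemma emeasure_cap_pos: "0 < emeasure lborel (cap b)"
proof -
  let ?U = "interior K \<inter> {x. b \<bullet> x < 1}"
  have "0 \<in> closure (interior K)"
    using convex_closure_interior[OF convex solid] closure_subset by fastforce
  moreover have "open {x. b \<bullet> x < 1}" by (rule open_halfspace_lt)
  moreover have "0 \<in> {x. b \<bullet> x < 1}" by simp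
  ultimately have "?U \<noteq> {}"
    using open_Int_closure_eq_empty[of "{x. b \<bullet> x < 1}" "interior K"] by blast
  moreover have "?U \<subseteq> cap b" using interior_subset by (auto simp: cap_def)
  moreover have "open ?U" by (intro open_Int open_interior open_halfspace_lt)
  ultimately show ?thesis by (intro emeasure_lborel_pos[of ?U]) auto
qed

lemma emeasure_cap_finite:
  assumes "b \<in> interior (dual_cone K)"
  shows "emeasure lborel (cap b) < \<infinity>"
proof -
  obtain e where e: "e > 0" "\<And>x. x \<in> K \<Longrightarrow> e * norm x \<le> b \<bullet> x"
    using closed_cone_pos_bound[OF closed cone, of b] assms
    unfolding interior_dual_iff by (metis DiffI singletonD)
  have "norm x \<le> 1 / e" if "x \<in> cap b" for x
    using e(2)[of x] that e(1) by (auto simp: cap_def field_simps)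
  then have "cap b \<subseteq> cball 0 (1 / e)" by auto
  then have "emeasure lborel (cap b) \<le> emeasure lborel (cball (0::'a) (1 / e))"
    by (intro emeasure_mono) auto
  also have "\<dots> < \<infinity>" by (rule emeasure_lborel_cball_finite)
  finally show ?thesis .
qed

text \<open>\<open>x0\<close> is a direction of recession of the cap, and pointedness forces the
  backward translates of any point out of \<open>K\<close>. This will keep limits of minimizing
  sequences off the boundary of the dual cone.\<close>

lemma emeasure_cap_infinite:
  assumes "x0 \<in> K" "x0 \<noteq> 0" "b \<bullet> x0 \<le> 0"
  shows "emeasure lborel (cap b) = \<infinity>"
proof (rule emeasure_lborel_recession)
  show "emeasure lborel (cap b) \<noteq> 0" using emeasure_cap_pos[of b] by simp
  show "z + x0 \<in> cap b" if "z \<in> cap b" for z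
    using that assms convex_cone_add[OF cone convex, of z x0] by (auto simp: cap_def inner_add_right)
  show "\<exists>k::nat. z - real k *\<^sub>R x0 \<notin> cap b" for z
    using closed_cone_leaves[OF closed cone uminus_notin[OF assms(1,2)], of z] by (auto simp: cap_def)
qed measurable

lemma section_volume_eq:
  assumes "b \<noteq> 0" "\<And>x. x \<in> K \<Longrightarrow> 0 \<le> b \<bullet> x"
  shows "section_volume b = ennreal (real DIM('a) * norm b) * emeasure lborel (cap b)"
  unfolding section_volume_def cap_def
  using cone_scaleR_iff[OF cone] assms by (intro flat_volume_cone_section) auto

lemma section_volume_pos:
  assumes "b \<noteq> 0" "\<And>x. x \<in> K \<Longrightarrow> 0 \<le> b \<bullet> x"
  shows "0 < section_volume b"
  using emeasure_cap_pos[of b] assms by (simp add: section_volume_eq ennreal_zero_less_mult_iff)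

lemma min_section_volume_eq:
  "min_section_volume K A = (INF b \<in> {b \<in> interior (dual_cone K). b \<bullet> A = 1}. section_volume b)"
proof -
  have "{H. admissible K H \<and> A \<in> H} = (\<lambda>b. {x. b \<bullet> x = 1}) ` {b \<in> interior (dual_cone K). b \<bullet> A = 1}"
    by (auto simp: admissible_def)
  then show ?thesis
    unfolding min_section_volume_def section_volume_def by (simp add: image_image)
qed

lemma min_section_volume_le:
  "b \<in> interior (dual_cone K) \<Longrightarrow> b \<bullet> A = 1 \<Longrightarrow> min_section_volume K A \<le> section_volume b"
  unfolding min_section_volume_eq by (intro INF_lower) auto

lemma interior_dual_nonzero: "b \<in> interior (dual_cone K) \<Longrightarrow> b \<bullet> A = 1 \<Longrightarrow> b \<noteq> 0"
  by auto

lemma admissible_functional: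
  assumes "A \<in> K" "A \<noteq> 0"
  obtains b where "b \<in> interior (dual_cone K)" "b \<bullet> A = 1"
proof -
  obtain b where b: "b \<in> interior (dual_cone K)"
    using interior_dual_cone_nonempty[OF closed convex cone pointed] by blast
  then have "0 < b \<bullet> A" using assms by (auto simp: interior_dual_iff)
  then have "b /\<^sub>R (b \<bullet> A) \<in> interior (dual_cone K)" "(b /\<^sub>R (b \<bullet> A)) \<bullet> A = 1"
    using b by (auto simp: interior_dual_iff)
  then show ?thesis using that by blast
qed

lemma min_section_volume_sequence:
  assumes "A \<in> K" "A \<noteq> 0"
  obtains b :: "nat \<Rightarrow> 'a" where "\<And>k. b k \<in> interior (dual_cone K)" "\<And>k. b k \<bullet> A = 1"
    "(\<lambda>k. section_volume (b k)) \<longlonglongrightarrow> min_section_volume K A"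
proof -
  let ?B = "{b \<in> interior (dual_cone K). b \<bullet> A = 1}"
  have "?B \<noteq> {}" using admissible_functional[OF assms] by blast
  then obtain f :: "nat \<Rightarrow> ennreal" where f: "decseq f" "range f \<subseteq> section_volume ` ?B"
    "Inf (section_volume ` ?B) = (INF i. f i)"
    using ennreal_Inf_countable_INF[of "section_volume ` ?B"] by blast
  then have "\<forall>k. \<exists>b. b \<in> ?B \<and> f k = section_volume b" by blast
  then obtain b where b: "\<And>k. b k \<in> ?B" "\<And>k. f k = section_volume (b k)" by metis
  have "f \<longlonglongrightarrow> (INF i. f i)" using f(1) by (rule LIMSEQ_INF)
  then have "(\<lambda>k. section_volume (b k)) \<longlonglongrightarrow> min_section_volume K A"
    using f(3) by (simp add: b(2)[symmetric] min_section_volume_eq)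
  then show ?thesis using that b(1) by blast
qed

lemma min_section_volume_finite:
  assumes "A \<in> K" "A \<noteq> 0"
  shows "min_section_volume K A < \<infinity>"
proof -
  obtain b where b: "b \<in> interior (dual_cone K)" "b \<bullet> A = 1"
    using admissible_functional[OF assms] .
  have "section_volume b < \<infinity>"
    using interior_dual_nonzero[OF b] interior_dual_nonneg[OF b(1)] emeasure_cap_finite[OF b(1)]
    by (simp add: section_volume_eq ennreal_mult_less_top)
  then show ?thesis using min_section_volume_le[OF b] by (metis le_less_trans)
qed

text \<open>Lower semicontinuity, with the limit allowed on the boundary of the dual cone, where the
  volume may be infinite. Interior points of the limit cap satisfy \<open>b0 \<bullet> z < 1\<close>
  strictly and so belong to all late caps.\<close>

lemma section_volume_liminf:
  assumes b: "b \<longlonglongrightarrow> b0" "b0 \<noteq> 0" "\<And>k x. x \<in> K \<Longrightarrow> 0 \<le> b k \<bullet> x" "\<And>k. b k \<noteq> 0"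
  shows "section_volume b0 \<le> liminf (\<lambda>k. section_volume (b k))"
proof -
  have nonneg: "0 \<le> b0 \<bullet> x" if "x \<in> K" for x
    by (rule LIMSEQ_le_const[OF tendsto_inner[OF b(1) tendsto_const]]) (use b(3)[OF that] in auto)
  have "section_volume b0 = ennreal (real DIM('a) * norm b0) * emeasure lborel (interior (cap b0))"
    using b(2) nonneg emeasure_lborel_interior_convex[OF convex_cap cap_borel]
    by (simp add: section_volume_eq)
  also have "\<dots> \<le> liminf (\<lambda>k. ennreal (real DIM('a) * norm (b k)) * emeasure lborel (cap (b k)))"
  proof (rule emeasure_le_liminf)
    show "(\<lambda>k. real DIM('a) * norm (b k)) \<longlonglongrightarrow> real DIM('a) * norm b0"
      using b(1) by (intro tendsto_intros)
  next
    fix z assume z: "z \<in> interior (cap b0)"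
    then obtain e where e: "e > 0" "cball z e \<subseteq> cap b0" using mem_interior_cball by blast
    \<comment> \<open>Moving \<open>z\<close> inside its ball along \<open>b0\<close> increases the
      functional, so there is slack below 1.\<close>
    have "z + (e / norm b0) *\<^sub>R b0 \<in> cball z e" using e b(2) by (simp add: dist_norm)
    then have "b0 \<bullet> (z + (e / norm b0) *\<^sub>R b0) \<le> 1" using e by (auto simp: cap_def)
    moreover have "0 < (e / norm b0) * (b0 \<bullet> b0)" using e b(2) by simp
    ultimately have lt: "b0 \<bullet> z < 1" by (simp add: inner_add_right)
    have "z \<in> K" using z interior_subset by (auto simp: cap_def)
    moreover have "(\<lambda>k. b k \<bullet> z) \<longlonglongrightarrow> b0 \<bullet> z" using b(1) by (intro tendsto_intros)
    then have "eventually (\<lambda>k. b k \<bullet> z < 1) sequentially" using lt by (rule order_tendstoD)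
    ultimately show "eventually (\<lambda>k. z \<in> cap (b k)) sequentially"
      by (auto simp: cap_def elim: eventually_mono)
  qed auto
  also have "\<dots> = liminf (\<lambda>k. section_volume (b k))"
    using b by (simp add: section_volume_eq)
  finally show ?thesis .
qed

end

section \<open>Sections nearly parallel to a supporting hyperplane\<close>

text \<open>Only a supporting hyperplane through \<open>A\<close> is fixed here; the face it cuts
  out may have smaller dimension, as can happen in part (i).\<close>

locale cone_face = pointed_cone +
  fixes u A :: 'a
  assumes unit: "norm u = 1" and supp: "\<And>x. x \<in> K \<Longrightarrow> 0 \<le> u \<bullet> x"
    and A: "A \<in> K" "A \<noteq> 0" "u \<bullet> A = 0"
begin

definition proj :: "'a \<Rightarrow> 'a" where
  "proj z = z - (u \<bullet> z) *\<^sub>R u"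

definition face :: "'a set" where
  "face = K \<inter> {x. u \<bullet> x = 0}"

definition face_volume :: "'a \<Rightarrow> ennreal" where
  "face_volume \<beta> = flat_volume {x. u \<bullet> x = 0} {y \<in> face. \<beta> \<bullet> y \<le> 1}"

text \<open>The limit of the stretched caps: the \<open>u\<close>-coordinate becomes the height
  above the face.\<close>

definition pyramid :: "'a \<Rightarrow> 'a set" where
  "pyramid \<beta> = {z. proj z \<in> face \<and> 0 \<le> u \<bullet> z \<and> \<beta> \<bullet> proj z + u \<bullet> z \<le> 1}"

lemma uu [simp]: "u \<bullet> u = 1"
  using unit by (simp add: norm_eq_1)

lemma inner_proj [simp]: "u \<bullet> proj z = 0"
  by (simp add: proj_def inner_diff_right)

lemma proj_id: "u \<bullet> z = 0 \<Longrightarrow> proj z = z"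
  by (simp add: proj_def)

lemma linear_proj: "linear proj"
  by (intro linearI) (auto simp: proj_def inner_add_right algebra_simps)

lemma proj_borel [measurable]: "proj \<in> borel_measurable borel"
  unfolding proj_def by measurable

lemma proj_tendsto: "(\<lambda>k. proj z + (r k) *\<^sub>R u) \<longlonglongrightarrow> proj z" if "r \<longlonglongrightarrow> 0"
  using tendsto_add[OF tendsto_const[of "proj z"] tendsto_scaleR[OF that tendsto_const[of u]]] by simp

lemma inner_interior_pos:
  assumes "x \<in> interior K"
  shows "0 < u \<bullet> x"
proof -
  obtain d where d: "d > 0" "cball x d \<subseteq> K" using assms mem_interior_cball by blast
  have "x - d *\<^sub>R u \<in> cball x d" using d unit by (simp add: dist_norm)
  then have "0 \<le> u \<bullet> (x - d *\<^sub>R u)" using d by (intro supp) auto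
  then show ?thesis using d by (simp add: inner_diff_right)
qed

lemma face_borel [measurable]: "face \<in> sets borel"
  unfolding face_def by measurable

lemma closed_face: "closed face"
  unfolding face_def by (intro closed_Int closed closed_hyperplane)

lemma convex_face: "convex face"
  unfolding face_def by (intro convex_Int convex convex_hyperplane)

lemma cone_face: "cone face"
  using cone by (auto simp: face_def cone_def)

lemma proj_face_iff: "proj z \<in> face \<longleftrightarrow> proj z \<in> K"
  by (simp add: face_def)

lemma pyramid_borel [measurable]: "pyramid \<beta> \<in> sets borel"
  unfolding pyramid_def by measurable

lemma convex_pyramid: "convex (pyramid \<beta>)"
proof -
  have "pyramid \<beta> = proj -` face \<inter> {z. 0 \<le> u \<bullet> z} \<inter> (\<lambda>z. \<beta> \<bullet> proj z + u \<bullet> z) -` {..1}"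
    by (auto simp: pyramid_def)
  moreover have "linear (\<lambda>z. \<beta> \<bullet> proj z + u \<bullet> z)"
    using linear_proj by (intro linearI) (auto simp: linear_add linear_scale inner_add_right algebra_simps)
  ultimately show ?thesis
    using convex_linear_vimage[OF linear_proj convex_face]
    by (auto intro!: convex_Int convex_halfspace_ge convex_linear_vimage simp: convex_real_interval)
qed

lemma face_volume_pyramid:
  assumes "\<And>x. x \<in> face \<Longrightarrow> 0 \<le> \<beta> \<bullet> x"
  shows "face_volume \<beta> = ennreal (real DIM('a)) * emeasure lborel (pyramid \<beta>)"
  unfolding face_volume_def pyramid_def proj_def
  using cone_scaleR_iff[OF cone_face] assms unit by (intro flat_volume_pyramid) auto

text \<open>For \<open>u \<bullet> \<beta> = 0\<close> and \<open>r > 0\<close>, the image of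
  \<open>cap (\<beta> + r *\<^sub>R u)\<close> when the \<open>u\<close>-coordinate is multiplied by
  \<open>r\<close>. The bounding inequality becomes that of \<open>pyramid \<beta>\<close>; only the
  membership in \<open>K\<close> still depends on \<open>r\<close>.\<close>

definition stretched_cap :: "'a \<Rightarrow> real \<Rightarrow> 'a set" where
  "stretched_cap \<beta> r = {z. proj z + (u \<bullet> z / r) *\<^sub>R u \<in> K \<and> \<beta> \<bullet> proj z + u \<bullet> z \<le> 1}"

lemma stretched_cap_borel [measurable]: "stretched_cap \<beta> r \<in> sets borel"
  unfolding stretched_cap_def by measurable

text \<open>The stretch multiplies volumes by \<open>r\<close>, and the same factor is taken out of
  \<open>norm (\<beta> + r *\<^sub>R u)\<close>, leaving a prefactor that tends to the dimension as
  \<open>r\<close> grows.\<close>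

lemma section_volume_stretched:
  assumes r: "r > 0" and \<beta>: "u \<bullet> \<beta> = 0" and b: "\<And>x. x \<in> K \<Longrightarrow> 0 \<le> (\<beta> + r *\<^sub>R u) \<bullet> x"
  shows "section_volume (\<beta> + r *\<^sub>R u)
       = ennreal (real DIM('a) * norm (\<beta> /\<^sub>R r + u)) * emeasure lborel (stretched_cap \<beta> r)"
proof -
  let ?b = "\<beta> + r *\<^sub>R u"
  have ub: "u \<bullet> ?b = r" using \<beta> by (simp add: inner_add_right)
  have "?b \<noteq> 0" using ub r by auto
  have nb: "norm ?b = norm (\<beta> /\<^sub>R r + u) * r"
  proof -
    have "?b = r *\<^sub>R (\<beta> /\<^sub>R r + u)" using r by (simp add: scaleR_add_right)
    then have "norm ?b = norm (r *\<^sub>R (\<beta> /\<^sub>R r + u))" by (rule arg_cong)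
    then show ?thesis using r by simp
  qed
  have "ennreal r * emeasure lborel (cap ?b) = ennreal r * (\<integral>\<^sup>+x. indicator (cap ?b) x \<partial>lborel)"
    by simp
  also have "\<dots> = (\<integral>\<^sup>+z. indicator (cap ?b) (z - (u \<bullet> z) *\<^sub>R u + ((u \<bullet> z) / r) *\<^sub>R u) \<partial>lborel)"
    by (rule nn_integral_lborel_stretch[OF unit r]) measurable
  also have "\<dots> = (\<integral>\<^sup>+z. indicator (stretched_cap \<beta> r) z \<partial>lborel)"
  proof (rule nn_integral_cong)
    fix z
    have "?b \<bullet> (proj z + ((u \<bullet> z) / r) *\<^sub>R u) = \<beta> \<bullet> proj z + u \<bullet> z"
      using r \<beta> by (simp add: inner_add_right inner_add_left inner_commute[of \<beta> u])
    then show "indicator (cap ?b) (z - (u \<bullet> z) *\<^sub>R u + ((u \<bullet> z) / r) *\<^sub>R u)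
        = (indicator (stretched_cap \<beta> r) z :: ennreal)"
      by (simp add: indicator_def cap_def stretched_cap_def proj_def)
  qed
  also have "\<dots> = emeasure lborel (stretched_cap \<beta> r)" by simp
  finally have "ennreal r * emeasure lborel (cap ?b) = emeasure lborel (stretched_cap \<beta> r)" .
  moreover have "section_volume ?b
      = ennreal (real DIM('a) * norm (\<beta> /\<^sub>R r + u)) * (ennreal r * emeasure lborel (cap ?b))"
    using section_volume_eq[OF \<open>?b \<noteq> 0\<close> b] r
    by (simp add: nb mult.assoc[symmetric] ennreal_mult[symmetric])
  ultimately show ?thesis by simp
qed

lemma norm_stretched_tendsto:
  assumes "\<beta> \<longlonglongrightarrow> \<beta>0" "filterlim r at_top sequentially"
  shows "(\<lambda>k. real DIM('a) * norm (\<beta> k /\<^sub>R r k + u)) \<longlonglongrightarrow> real DIM('a)"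
proof -
  have "(\<lambda>k. inverse (r k)) \<longlonglongrightarrow> 0"
    using assms(2) by (rule tendsto_inverse_0_at_top)
  then have "(\<lambda>k. real DIM('a) * norm (\<beta> k /\<^sub>R r k + u)) \<longlonglongrightarrow> real DIM('a) * norm (0 *\<^sub>R \<beta>0 + u)"
    using assms(1) by (intro tendsto_intros)
  then show ?thesis by (simp add: unit)
qed

text \<open>For large \<open>r\<close> the functionals \<open>\<beta> + r *\<^sub>R u\<close> define
  admissible hyperplanes through \<open>A\<close>, and the reverse Fatou inequality bounds the limit
  of their sections by the pyramid. The work is to enclose all stretched caps in one ball.\<close>

lemma min_section_volume_le_face_volume:
  assumes \<beta>: "u \<bullet> \<beta> = 0" "\<beta> \<bullet> A = 1" "\<And>x. x \<in> face \<Longrightarrow> x \<noteq> 0 \<Longrightarrow> 0 < \<beta> \<bullet> x"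
  shows "min_section_volume K A \<le> face_volume \<beta>"
proof -
  obtain t where t: "t \<ge> 0" "\<And>x. x \<in> K \<Longrightarrow> x \<noteq> 0 \<Longrightarrow> 0 < (\<beta> + t *\<^sub>R u) \<bullet> x"
    using cone_lift_functional[OF closed cone supp, of \<beta>] \<beta>(3) by (auto simp: face_def)
  then obtain e where e: "e > 0" "\<And>x. x \<in> K \<Longrightarrow> e * norm x \<le> (\<beta> + t *\<^sub>R u) \<bullet> x"
    using closed_cone_pos_bound[OF closed cone] by blast
  \<comment> \<open>The bound \<open>2 * t + 1\<close> gives \<open>r k \<ge> 1\<close>, so that the
    stretch does not shorten the \<open>u\<close>-coordinate, and
    \<open>r k \<le> 2 * (r k - t)\<close>, so that at least half of \<open>r k\<close> remains
    beyond the \<open>t\<close> that admissibility uses up.\<close>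
  define r where "r k = 2 * t + 1 + real k" for k
  have r: "r k > 0" "r k \<ge> 2 * t + 1" for k using t by (auto simp: r_def)
  have rlim: "filterlim r at_top sequentially"
    unfolding r_def by (intro filterlim_tendsto_add_at_top[OF tendsto_const] filterlim_real_sequentially)
  have adm: "e * norm x + (r k - t) * (u \<bullet> x) \<le> (\<beta> + r k *\<^sub>R u) \<bullet> x" if "x \<in> K" for x k
    using e(2)[OF that] by (simp add: inner_add_left algebra_simps)
  have int: "\<beta> + r k *\<^sub>R u \<in> interior (dual_cone K)" for k
    unfolding interior_dual_iff
  proof
    fix x assume x: "x \<in> K - {0}"
    have "0 < e * norm x" using e x by simp
    moreover have "0 \<le> (r k - t) * (u \<bullet> x)" using r[of k] t supp[of x] x by simp
    ultimately show "0 < (\<beta> + r k *\<^sub>R u) \<bullet> x" using adm[of x k] x by auto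
  qed
  have "min_section_volume K A
      \<le> ennreal (real DIM('a) * norm (\<beta> /\<^sub>R r k + u)) * emeasure lborel (stretched_cap \<beta> (r k))" for k
  proof -
    have "(\<beta> + r k *\<^sub>R u) \<bullet> A = 1" using \<beta> A by (simp add: inner_add_left)
    then have "min_section_volume K A \<le> section_volume (\<beta> + r k *\<^sub>R u)"
      using int by (intro min_section_volume_le)
    then show ?thesis
      using section_volume_stretched[OF r(1) \<beta>(1) interior_dual_nonneg[OF int]] by simp
  qed
  then have "min_section_volume K A
      \<le> limsup (\<lambda>k. ennreal (real DIM('a) * norm (\<beta> /\<^sub>R r k + u)) * emeasure lborel (stretched_cap \<beta> (r k)))"
    by (intro le_Limsup) auto
  also have "\<dots> \<le> ennreal (real DIM('a)) * emeasure lborel (pyramid \<beta>)"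
  proof (rule limsup_le_emeasure)
    show "(\<lambda>k. real DIM('a) * norm (\<beta> /\<^sub>R r k + u)) \<longlonglongrightarrow> real DIM('a)"
      using tendsto_const rlim by (rule norm_stretched_tendsto)
    \<comment> \<open>The unstretched point has norm at most \<open>1 / e\<close>, and the stretch
      moves it along \<open>u\<close> by at most 2.\<close>
    show "emeasure lborel (cball (0::'a) (1/e + 2)) < \<infinity>" by (rule emeasure_lborel_cball_finite)
    show "stretched_cap \<beta> (r k) \<subseteq> cball 0 (1/e + 2)" for k
    proof
      fix z assume z: "z \<in> stretched_cap \<beta> (r k)"
      let ?x = "proj z + (u \<bullet> z / r k) *\<^sub>R u"
      have x: "?x \<in> K" using z by (simp add: stretched_cap_def)
      have ux: "u \<bullet> ?x = u \<bullet> z / r k" by (simp add: inner_add_right)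
      have uz: "0 \<le> u \<bullet> z" using supp[OF x] r[of k] unfolding ux by (simp add: zero_le_divide_iff)
      have "(\<beta> + r k *\<^sub>R u) \<bullet> ?x = \<beta> \<bullet> proj z + u \<bullet> z"
        using r[of k] \<beta> by (simp add: inner_add_right inner_add_left inner_commute[of \<beta> u])
      then have le1: "e * norm ?x + (r k - t) * (u \<bullet> z / r k) \<le> 1"
        using adm[OF x, of k] z unfolding ux by (simp add: stretched_cap_def)
      have "r k \<le> 2 * (r k - t)" using r[of k] by simp
      then have "r k * (u \<bullet> z / r k) \<le> 2 * (r k - t) * (u \<bullet> z / r k)"
        using uz r[of k] by (intro mult_right_mono) auto
      then have "u \<bullet> z \<le> 2 * ((r k - t) * (u \<bullet> z / r k))"
        using r(1)[of k] by (simp only: mult.assoc) simp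
      moreover have "0 \<le> e * norm ?x" using e by simp
      ultimately have uz2: "u \<bullet> z \<le> 2" using le1 by linarith
      have "0 \<le> (r k - t) * (u \<bullet> z / r k)" using uz r[of k] t by simp
      then have "e * norm ?x \<le> 1" using le1 by linarith
      then have nx: "norm ?x \<le> 1 / e" using e by (simp add: field_simps)
      have "z = ?x + (u \<bullet> z - u \<bullet> z / r k) *\<^sub>R u" by (simp add: proj_def algebra_simps)
      then have "norm z \<le> norm ?x + norm ((u \<bullet> z - u \<bullet> z / r k) *\<^sub>R u)"
        by (metis norm_triangle_ineq)
      also have "norm ((u \<bullet> z - u \<bullet> z / r k) *\<^sub>R u) = u \<bullet> z - u \<bullet> z / r k"
      proof -
        have "1 * (u \<bullet> z) \<le> r k * (u \<bullet> z)" using r[of k] t uz by (intro mult_right_mono) auto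
        then have "u \<bullet> z / r k \<le> u \<bullet> z" using r[of k] by (simp add: field_simps)
        then show ?thesis by (simp add: unit)
      qed
      also have "\<dots> \<le> 2" using uz2 divide_nonneg_pos[OF uz r(1)[of k]] by linarith
      finally show "z \<in> cball 0 (1/e + 2)" using nx by simp
    qed
    \<comment> \<open>If only the condition on \<open>K\<close> fails, \<open>proj z\<close> lies
      outside the closed cone, and so do the points
      \<open>proj z + (u \<bullet> z / r k) *\<^sub>R u\<close> converging to it; otherwise
      \<open>z\<close> is in no stretched cap at all.\<close>
    show "eventually (\<lambda>k. z \<notin> stretched_cap \<beta> (r k)) sequentially" if z: "z \<notin> pyramid \<beta>" for z
    proof (cases "\<beta> \<bullet> proj z + u \<bullet> z \<le> 1 \<and> 0 \<le> u \<bullet> z")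
      case True
      then have "proj z \<notin> K" using z by (simp add: pyramid_def proj_face_iff)
      moreover have "(\<lambda>k. u \<bullet> z / r k) \<longlonglongrightarrow> 0"
        using rlim by (rule real_tendsto_divide_at_top[OF tendsto_const])
      then have "(\<lambda>k. proj z + (u \<bullet> z / r k) *\<^sub>R u) \<longlonglongrightarrow> proj z" by (rule proj_tendsto)
      ultimately have "eventually (\<lambda>k. proj z + (u \<bullet> z / r k) *\<^sub>R u \<in> - K) sequentially"
        using closed by (intro topological_tendstoD) auto
      then show ?thesis by eventually_elim (simp add: stretched_cap_def)
    next
      case False
      have "z \<notin> stretched_cap \<beta> (r k)" for k
      proof
        assume z: "z \<in> stretched_cap \<beta> (r k)"
        then have "0 \<le> u \<bullet> (proj z + (u \<bullet> z / r k) *\<^sub>R u)" by (intro supp) (simp add: stretched_cap_def)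
        then have "0 \<le> u \<bullet> z" using r[of k] by (simp add: inner_add_right zero_le_divide_iff)
        then show False using False z by (simp add: stretched_cap_def)
      qed
      then show ?thesis by simp
    qed
  qed auto
  also have "\<dots> = face_volume \<beta>"
    using \<beta>(3) by (intro face_volume_pyramid[symmetric]) (metis inner_zero_right less_imp_le order_refl)
  finally show ?thesis .
qed

text \<open>
  An interior point \<open>z\<close> of the pyramid has a multiple of \<open>u\<close> to spare: subtracting from \<open>z\<close> a small
  multiple of an interior point of \<open>K\<close> shows that \<open>proj z + s *\<^sub>R u \<in> K\<close> for all small \<open>s \<ge> 0\<close>.
\<close>
lemma face_volume_le_liminf:
  assumes \<beta>: "\<And>k. u \<bullet> \<beta> k = 0" "\<beta> \<longlonglongrightarrow> \<beta>0" and r: "\<And>k. r k > 0" "filterlim r at_top sequentially"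
    and b: "\<And>k x. x \<in> K \<Longrightarrow> 0 \<le> (\<beta> k + r k *\<^sub>R u) \<bullet> x"
  shows "face_volume \<beta>0 \<le> liminf (\<lambda>k. section_volume (\<beta> k + r k *\<^sub>R u))"
proof -
  have nonneg: "0 \<le> \<beta>0 \<bullet> x" if "x \<in> face" for x
  proof (rule LIMSEQ_le_const[OF tendsto_inner[OF \<beta>(2) tendsto_const]])
    show "\<exists>N. \<forall>k\<ge>N. 0 \<le> \<beta> k \<bullet> x"
      using b[of x] that by (auto simp: face_def inner_add_left)
  qed
  have "face_volume \<beta>0 = ennreal (real DIM('a)) * emeasure lborel (interior (pyramid \<beta>0))"
    using emeasure_lborel_interior_convex[OF convex_pyramid pyramid_borel]
    by (simp add: face_volume_pyramid[OF nonneg])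
  also have "\<dots> \<le> liminf (\<lambda>k. ennreal (real DIM('a) * norm (\<beta> k /\<^sub>R r k + u))
      * emeasure lborel (stretched_cap (\<beta> k) (r k)))"
  proof (rule emeasure_le_liminf)
    show "(\<lambda>k. real DIM('a) * norm (\<beta> k /\<^sub>R r k + u)) \<longlonglongrightarrow> real DIM('a)"
      using \<beta>(2) r(2) by (rule norm_stretched_tendsto)
  next
    fix z assume z: "z \<in> interior (pyramid \<beta>0)"
    then obtain e where e: "e > 0" "cball z e \<subseteq> pyramid \<beta>0" using mem_interior_cball by blast
    have zp: "z \<in> pyramid \<beta>0" using z interior_subset by auto
    obtain x0 where x0: "x0 \<in> interior K" using solid by blast
    then have x0K: "x0 \<in> K" using interior_subset by blast
    have ux0: "0 < u \<bullet> x0" using x0 by (rule inner_interior_pos)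
    \<comment> \<open>Room above \<open>z\<close> makes the inequality strict, so that it survives
      the passage from \<open>\<beta>0\<close> to \<open>\<beta> k\<close>.\<close>
    have "z + e *\<^sub>R u \<in> pyramid \<beta>0" using e unit by (intro subsetD[OF e(2)]) (simp add: dist_norm)
    then have "\<beta>0 \<bullet> proj z + u \<bullet> z + e \<le> 1"
      by (simp add: pyramid_def linear_add[OF linear_proj] linear_scale[OF linear_proj]
          proj_def[of u] inner_add_right)
    then have lt: "\<beta>0 \<bullet> proj z + u \<bullet> z < 1" using e by simp
    define d where "d = e / norm x0"
    have "x0 \<noteq> 0" using ux0 by auto
    then have d: "d > 0" using e by (simp add: d_def)
    have "z - d *\<^sub>R x0 \<in> pyramid \<beta>0"
      using e \<open>x0 \<noteq> 0\<close> by (intro subsetD[OF e(2)]) (simp add: dist_norm d_def)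
    then have "proj (z - d *\<^sub>R x0) \<in> K" by (simp add: pyramid_def proj_face_iff)
    \<comment> \<open>Adding \<open>d *\<^sub>R x0\<close> back restores \<open>proj z\<close> and
      leaves the component of \<open>d *\<^sub>R x0\<close> along \<open>u\<close>: room inside the
      face is turned into height above it.\<close>
    then have "proj (z - d *\<^sub>R x0) + d *\<^sub>R x0 \<in> K"
      using coneD[OF cone x0K, of d] d by (intro convex_cone_add[OF cone convex]) auto
    also have "proj (z - d *\<^sub>R x0) + d *\<^sub>R x0 = proj z + (d * (u \<bullet> x0)) *\<^sub>R u"
      by (simp add: proj_def inner_diff_right algebra_simps)
    finally have top: "proj z + (d * (u \<bullet> x0)) *\<^sub>R u \<in> K" .
    have bot: "proj z \<in> K" using zp by (simp add: pyramid_def proj_face_iff)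
    have mid: "proj z + s *\<^sub>R u \<in> K" if s: "0 \<le> s" "s \<le> d * (u \<bullet> x0)" for s
    proof -
      define q where "q = s / (d * (u \<bullet> x0))"
      have q: "0 \<le> q" "q \<le> 1" "q * (d * (u \<bullet> x0)) = s"
        using s d ux0 by (auto simp: q_def)
      have "(1 - q) *\<^sub>R proj z + q *\<^sub>R (proj z + (d * (u \<bullet> x0)) *\<^sub>R u) \<in> K"
        using convex bot top q by (intro convexD) auto
      also have "(1 - q) *\<^sub>R proj z + q *\<^sub>R (proj z + (d * (u \<bullet> x0)) *\<^sub>R u) = proj z + s *\<^sub>R u"
        using q(3) by (simp add: algebra_simps)
      finally show ?thesis .
    qed
    have uz: "0 \<le> u \<bullet> z" using zp by (simp add: pyramid_def)
    have "(\<lambda>k. u \<bullet> z / r k) \<longlonglongrightarrow> 0"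
      using r(2) by (rule real_tendsto_divide_at_top[OF tendsto_const])
    then have "eventually (\<lambda>k. u \<bullet> z / r k < d * (u \<bullet> x0)) sequentially"
      using d ux0 by (intro order_tendstoD(2)[of _ 0]) auto
    moreover have "(\<lambda>k. \<beta> k \<bullet> proj z + u \<bullet> z) \<longlonglongrightarrow> \<beta>0 \<bullet> proj z + u \<bullet> z"
      using \<beta>(2) by (intro tendsto_intros)
    then have "eventually (\<lambda>k. \<beta> k \<bullet> proj z + u \<bullet> z < 1) sequentially"
      using lt by (rule order_tendstoD)
    ultimately show "eventually (\<lambda>k. z \<in> stretched_cap (\<beta> k) (r k)) sequentially"
    proof eventually_elim
      case (elim k)
      then show ?case using mid[of "u \<bullet> z / r k"] uz r(1)[of k] by (simp add: stretched_cap_def)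
    qed
  qed auto
  also have "\<dots> = liminf (\<lambda>k. section_volume (\<beta> k + r k *\<^sub>R u))"
    using section_volume_stretched[OF r(1) \<beta>(1) b] by simp
  finally show ?thesis .
qed

end

section \<open>Sections through a relatively interior point of a facet\<close>

text \<open>Relative interiority of \<open>A\<close> in the face is expressed through the cylinder
  over the face along \<open>u\<close>, whose interior is taken in the whole space.\<close>

locale cone_facet = cone_face +
  assumes facet: "A \<in> interior {z. proj z \<in> K}"
begin

lemma facet_ball:
  obtains e where "e > 0" "\<And>w. norm w \<le> e \<Longrightarrow> proj (A + w) \<in> K"
proof -
  obtain e where e: "e > 0" "cball A e \<subseteq> {z. proj z \<in> K}"
    using facet mem_interior_cball by blast
  have "proj (A + w) \<in> K" if "norm w \<le> e" for w
    using that by (intro CollectD[OF subsetD[OF e(2)]]) (simp add: dist_norm)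
  then show ?thesis using that e by blast
qed

text \<open>The point at distance \<open>e\<close> from \<open>A\<close> in the direction
  \<open>- \<beta>\<close> still belongs to the face, and \<beta> takes the value
  \<open>1 - e * norm \<beta>\<close> there. Interiority of \<open>A\<close> is thus what confines
  tangential components to a compact set.\<close>

lemma facet_functional_bounded:
  obtains R where
    "\<And>\<beta>. u \<bullet> \<beta> = 0 \<Longrightarrow> \<beta> \<bullet> A = 1 \<Longrightarrow> (\<And>x. x \<in> face \<Longrightarrow> 0 \<le> \<beta> \<bullet> x) \<Longrightarrow> norm \<beta> \<le> R"
proof -
  obtain e where e: "e > 0" "\<And>w. norm w \<le> e \<Longrightarrow> proj (A + w) \<in> K" using facet_ball by blast
  have "norm \<beta> \<le> 1 / e"
    if \<beta>: "u \<bullet> \<beta> = 0" "\<beta> \<bullet> A = 1" "\<And>x. x \<in> face \<Longrightarrow> 0 \<le> \<beta> \<bullet> x" for \<beta>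
  proof -
    have nz: "\<beta> \<noteq> 0" using \<beta>(2) by auto
    let ?w = "- (e / norm \<beta>) *\<^sub>R \<beta>"
    have "proj (A + ?w) \<in> K" using nz e(1) by (intro e(2)) simp
    moreover have "proj (A + ?w) = A + ?w" using A \<beta>(1) by (intro proj_id) (simp add: inner_diff_right)
    ultimately have "A + ?w \<in> face" using proj_face_iff[of "A + ?w"] by simp
    then have "0 \<le> \<beta> \<bullet> (A + ?w)" by (rule \<beta>(3))
    moreover have "(e / norm \<beta>) * (\<beta> \<bullet> \<beta>) = e * norm \<beta>"
      using nz by (simp add: dot_square_norm power2_eq_square)
    ultimately have "e * norm \<beta> \<le> 1" using \<beta>(2) by (simp add: inner_diff_right)
    then show ?thesis using e(1) by (simp add: field_simps)
  qed
  then show ?thesis using that by blast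
qed

lemma face_volume_prism:
  "face_volume \<beta> = emeasure lborel {x. proj x \<in> face \<and> \<beta> \<bullet> proj x \<le> 1 \<and> 0 \<le> u \<bullet> x \<and> u \<bullet> x \<le> 1}"
  unfolding face_volume_def proj_def
  by (subst flat_volume_hyperplane[OF unit]) (auto simp: conj_assoc)

text \<open>For every \<beta>, a small multiple of \<open>A\<close> lies in the relative interior of
  the segment; lifted to half height it is an interior point of the prism.\<close>

lemma face_volume_pos: "0 < face_volume \<beta>"
proof -
  obtain e where e: "e > 0" "\<And>w. norm w \<le> e \<Longrightarrow> proj (A + w) \<in> K" using facet_ball by blast
  \<comment> \<open>The added 1 keeps the denominator positive and makes
    \<open>s * (\<beta> \<bullet> A)\<close> strictly less than 1.\<close>
  define s where "s = 1 / (\<bar>\<beta> \<bullet> A\<bar> + 1)"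
  have s: "s > 0" "s * (\<beta> \<bullet> A) < 1"
    by (auto simp: s_def divide_simps)
  define p where "p = s *\<^sub>R A + (1/2) *\<^sub>R u"
  have pp: "proj p = s *\<^sub>R A" and up: "u \<bullet> p = 1/2"
    using A(3) by (auto simp: p_def proj_def inner_add_right)
  let ?U = "ball p (s * e) \<inter> {x. \<beta> \<bullet> proj x < 1} \<inter> {x. 0 < u \<bullet> x} \<inter> {x. u \<bullet> x < 1}"
  have cont: "continuous_on UNIV proj"
    using linear_proj linear_continuous_on linear_linear by blast
  have "open {x. \<beta> \<bullet> proj x < 1}"
    by (intro open_Collect_less continuous_intros cont)
  then have "open ?U" by (intro open_Int open_ball open_halfspace_gt open_halfspace_lt)
  moreover have "p \<in> ?U" using s e by (simp add: pp up)
  then have "?U \<noteq> {}" by blast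
  moreover have "proj z \<in> face" if z: "z \<in> ball p (s * e)" for z
  proof -
    \<comment> \<open>Rescaling by \<open>1 / s\<close> carries the ball around \<open>p\<close> to
      one of radius \<open>e\<close>, where membership is known; the lift by half of
      \<open>u\<close> is invisible to \<open>proj\<close>.\<close>
    define w where "w = (1 / s) *\<^sub>R (z - p)"
    have "norm w = norm (z - p) / s" using s by (simp add: w_def)
    then have "norm w \<le> e" using z s by (simp add: dist_norm norm_minus_commute divide_le_eq mult.commute)
    then have "proj (A + w) \<in> K" by (rule e(2))
    then have "s *\<^sub>R proj (A + w) \<in> K" using s by (intro coneD[OF cone]) auto
    also have "s *\<^sub>R proj (A + w) = proj (s *\<^sub>R A + s *\<^sub>R w)"
      by (simp add: linear_add[OF linear_proj] linear_scale[OF linear_proj] scaleR_add_right)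
    also have "s *\<^sub>R A + s *\<^sub>R w = z - (1/2) *\<^sub>R u"
      using s by (simp add: w_def p_def)
    also have "proj (z - (1/2) *\<^sub>R u) = proj z"
      by (simp add: proj_def inner_diff_right algebra_simps)
    finally show ?thesis by (simp add: proj_face_iff)
  qed
  then have "?U \<subseteq> {x. proj x \<in> face \<and> \<beta> \<bullet> proj x \<le> 1 \<and> 0 \<le> u \<bullet> x \<and> u \<bullet> x \<le> 1}"
    by auto
  ultimately show ?thesis
    unfolding face_volume_prism by (intro emeasure_lborel_pos[of ?U]) auto
qed

text \<open>\<open>x0\<close> is a direction of recession of the prism over the segment, so only
  functionals positive on the face can give a finite volume.\<close>

lemma face_volume_infinite:
  assumes x0: "x0 \<in> face" "x0 \<noteq> 0" "\<beta> \<bullet> x0 \<le> 0"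
  shows "face_volume \<beta> = \<infinity>"
  unfolding face_volume_prism
proof (rule emeasure_lborel_recession)
  let ?Z = "{x. proj x \<in> face \<and> \<beta> \<bullet> proj x \<le> 1 \<and> 0 \<le> u \<bullet> x \<and> u \<bullet> x \<le> 1}"
  have ux0: "u \<bullet> x0 = 0" and "x0 \<in> K" using x0 by (auto simp: face_def)
  then have px0: "proj (z + r *\<^sub>R x0) = proj z + r *\<^sub>R x0" for z r
    by (simp add: proj_def inner_add_right)
  show "emeasure lborel ?Z \<noteq> 0" using face_volume_pos[of \<beta>] unfolding face_volume_prism by simp
  show "z + x0 \<in> ?Z" if "z \<in> ?Z" for z
    using that x0 ux0 px0[of z 1] convex_cone_add[OF cone_face convex_face, of "proj z" x0]
    by (auto simp: inner_add_right)
  show "\<exists>k::nat. z - real k *\<^sub>R x0 \<notin> ?Z" for z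
    using closed_cone_leaves[OF closed cone uminus_notin[OF \<open>x0 \<in> K\<close> x0(2)], of "proj z"]
      px0[of z "- real _"] by (auto simp: face_def)
qed measurable

text \<open>Functionals that are not positive on the face have infinite segments, so the bound
  covers every cutting plane through \<open>A\<close>.\<close>

lemma min_section_volume_le_face_volume':
  assumes \<beta>: "u \<bullet> \<beta> = 0" "\<beta> \<bullet> A = 1"
  shows "min_section_volume K A \<le> face_volume \<beta>"
proof (cases "\<forall>x\<in>face. x \<noteq> 0 \<longrightarrow> 0 < \<beta> \<bullet> x")
  case True
  then show ?thesis using min_section_volume_le_face_volume[OF \<beta>] by blast
next
  case False
  then obtain x0 where "x0 \<in> face" "x0 \<noteq> 0" "\<beta> \<bullet> x0 \<le> 0" by force
  then have "face_volume \<beta> = \<infinity>" by (rule face_volume_infinite)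
  then show ?thesis by simp
qed

text \<open>
  A minimizing sequence \<open>\<beta> k + r k *\<^sub>R u\<close> has bounded \<open>\<beta> k\<close>. Along a subsequence, either \<open>r k\<close>
  converges, and the minimum is attained at the limit, or \<open>r k\<close> tends to infinity, and the sections
  degenerate to a segment of the facet.
\<close>
lemma min_section_volume_attained_or_face_volume:
  obtains b where "b \<in> interior (dual_cone K)" "b \<bullet> A = 1" "section_volume b = min_section_volume K A"
  | \<beta> where "u \<bullet> \<beta> = 0" "\<beta> \<bullet> A = 1" "face_volume \<beta> = min_section_volume K A"
proof -
  obtain b :: "nat \<Rightarrow> 'a" where b: "\<And>k. b k \<in> interior (dual_cone K)" "\<And>k. b k \<bullet> A = 1"
    "(\<lambda>k. section_volume (b k)) \<longlonglongrightarrow> min_section_volume K A"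
    using min_section_volume_sequence[OF A(1,2)] by blast
  obtain R where R: "\<And>\<beta>. u \<bullet> \<beta> = 0 \<Longrightarrow> \<beta> \<bullet> A = 1 \<Longrightarrow> (\<And>x. x \<in> face \<Longrightarrow> 0 \<le> \<beta> \<bullet> x) \<Longrightarrow> norm \<beta> \<le> R"
    using facet_functional_bounded by blast
  have proj_A: "proj x \<bullet> y = x \<bullet> y" if "u \<bullet> y = 0" for x y
    using that by (simp add: proj_def inner_diff_left)
  \<comment> \<open>On the face \<open>b k\<close> agrees with its tangential part, so the bound for
    functionals of the facet applies to \<open>proj (b k)\<close>.\<close>
  have "norm (proj (b k)) \<le> R" for k
  proof (rule R)
    show "0 \<le> proj (b k) \<bullet> x" if "x \<in> face" for x
      using that interior_dual_nonneg[OF b(1), of x k] by (simp add: face_def proj_A)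
  qed (use A b in \<open>simp_all add: proj_A\<close>)
  then have "\<forall>k. proj (b k) \<in> cball 0 R" by simp
  then obtain \<beta>0 q where q: "strict_mono q" "((\<lambda>k. proj (b k)) \<circ> q) \<longlonglongrightarrow> \<beta>0"
    using compact_cball[of "0::'a" R] unfolding compact_def by metis
  define b' where "b' = b \<circ> q"
  have b': "b' k \<in> interior (dual_cone K)" "b' k \<bullet> A = 1" for k
    using b by (auto simp: b'_def)
  have b'v: "(\<lambda>k. section_volume (b' k)) \<longlonglongrightarrow> min_section_volume K A"
    using LIMSEQ_subseq_LIMSEQ[OF b(3) q(1)] by (simp add: b'_def comp_def)
  have b'p: "(\<lambda>k. proj (b' k)) \<longlonglongrightarrow> \<beta>0" using q(2) by (simp add: b'_def comp_def)
  have dec: "proj x + (u \<bullet> x) *\<^sub>R u = x" for x by (simp add: proj_def)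
  show ?thesis
  proof (cases "filterlim (\<lambda>k. u \<bullet> b' k) at_top sequentially")
    case True
    then have "eventually (\<lambda>k. u \<bullet> b' k > 0) sequentially" by (simp add: filterlim_at_top_dense)
    then obtain N where N: "\<And>k. k \<ge> N \<Longrightarrow> u \<bullet> b' k > 0" by (auto simp: eventually_sequentially)
    have "face_volume \<beta>0 \<le> liminf (\<lambda>k. section_volume (proj (b' (k + N)) + (u \<bullet> b' (k + N)) *\<^sub>R u))"
    proof (rule face_volume_le_liminf)
      show "(\<lambda>k. proj (b' (k + N))) \<longlonglongrightarrow> \<beta>0" using b'p by (rule LIMSEQ_ignore_initial_segment)
      show "filterlim (\<lambda>k. u \<bullet> b' (k + N)) at_top sequentially"
        using filterlim_compose[OF True filterlim_add_const_nat_at_top[of N]] .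
      show "0 \<le> (proj (b' (k + N)) + (u \<bullet> b' (k + N)) *\<^sub>R u) \<bullet> x" if "x \<in> K" for k x
        unfolding dec using b'(1) that by (rule interior_dual_nonneg)
    qed (auto simp: N)
    also have "\<dots> = min_section_volume K A"
      unfolding dec using LIMSEQ_ignore_initial_segment[OF b'v, of N] by (intro lim_imp_Liminf) auto
    finally have le: "face_volume \<beta>0 \<le> min_section_volume K A" .
    have "u \<bullet> \<beta>0 = 0"
      using LIMSEQ_unique[OF tendsto_inner[OF tendsto_const[of u] b'p]] by simp
    moreover have "\<beta>0 \<bullet> A = 1"
      using LIMSEQ_unique[OF tendsto_inner[OF b'p tendsto_const[of A]]] b'(2) A(3) by (simp add: proj_A)
    ultimately show ?thesis
      using that(2) le min_section_volume_le_face_volume' by (metis antisym)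
  next
    case False
    \<comment> \<open>Divergence to infinity fails, so infinitely many normal components stay below
      one \<open>Z\<close>; these form the subsequence.\<close>
    then obtain Z where Z: "\<exists>\<^sub>F k in sequentially. u \<bullet> b' k \<le> Z"
      by (auto simp: filterlim_at_top_dense not_eventually not_less)
    then have "infinite {k. u \<bullet> b' k \<le> Z}"
      by (simp add: frequently_sequentially infinite_nat_iff_unbounded_le)
    from infinite_enumerate[OF this] obtain p :: "nat \<Rightarrow> nat"
      where p: "strict_mono p" "\<And>k. u \<bullet> b' (p k) \<le> Z"
      by auto
    obtain x0 where x0: "x0 \<in> interior K" using solid by blast
    then have x0K: "x0 \<in> K" using interior_subset by blast
    have ux0: "0 < u \<bullet> x0" using x0 by (rule inner_interior_pos)
    obtain C where C: "\<And>k. norm (proj (b' k)) \<le> C"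
      using convergent_imp_Bseq[OF convergentI[OF b'p]] by (metis BseqE)
    \<comment> \<open>Nonnegativity of \<open>b' k\<close> at the point \<open>x0\<close>, where
      \<open>u\<close> is positive, bounds the normal component from below.\<close>
    have "- (C * norm x0) / (u \<bullet> x0) \<le> u \<bullet> b' k" for k
    proof -
      have "0 \<le> (proj (b' k) + (u \<bullet> b' k) *\<^sub>R u) \<bullet> x0"
        unfolding dec using b'(1) x0K by (rule interior_dual_nonneg)
      moreover have "proj (b' k) \<bullet> x0 \<le> C * norm x0"
        using norm_cauchy_schwarz[of "proj (b' k)" x0] mult_right_mono[OF C[of k] norm_ge_zero[of x0]]
        by linarith
      ultimately have "- (C * norm x0) \<le> (u \<bullet> b' k) * (u \<bullet> x0)" by (simp add: inner_add_left)
      then show ?thesis using ux0 by (subst pos_divide_le_eq) auto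
    qed
    then have "\<forall>k. u \<bullet> b' (p k) \<in> {- (C * norm x0) / (u \<bullet> x0)..Z}" using p by simp
    then obtain r0 p' where p': "strict_mono p'" "((\<lambda>k. u \<bullet> b' (p k)) \<circ> p') \<longlonglongrightarrow> r0"
      using compact_Icc[of "- (C * norm x0) / (u \<bullet> x0)" Z] unfolding compact_def by metis
    define c where "c k = b' (p (p' k))" for k
    have pp': "strict_mono (p \<circ> p')" using p p' by (simp add: strict_mono_o)
    have c: "c k \<in> interior (dual_cone K)" "c k \<bullet> A = 1" for k using b' by (auto simp: c_def)
    define c0 where "c0 = \<beta>0 + r0 *\<^sub>R u"
    have "(\<lambda>k. proj (c k) + (u \<bullet> c k) *\<^sub>R u) \<longlonglongrightarrow> c0"
      unfolding c0_def using LIMSEQ_subseq_LIMSEQ[OF b'p pp'] p'(2)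
      by (intro tendsto_intros) (simp_all add: c_def comp_def)
    then have clim: "c \<longlonglongrightarrow> c0" unfolding dec .
    have c0A: "c0 \<bullet> A = 1"
      using LIMSEQ_unique[OF tendsto_inner[OF clim tendsto_const[of A]]] c(2) by simp
    then have nz: "c0 \<noteq> 0" by auto
    have nonneg: "0 \<le> c0 \<bullet> x" if "x \<in> K" for x
      by (rule LIMSEQ_le_const[OF tendsto_inner[OF clim tendsto_const]])
        (use interior_dual_nonneg[OF c(1) that] in auto)
    have "section_volume c0 \<le> liminf (\<lambda>k. section_volume (c k))"
      using clim nz interior_dual_nonneg[OF c(1)] interior_dual_nonzero[OF c]
      by (intro section_volume_liminf) auto
    also have "\<dots> = min_section_volume K A"
      using LIMSEQ_subseq_LIMSEQ[OF b'v pp'] by (intro lim_imp_Liminf) (simp_all add: c_def comp_def)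
    finally have le: "section_volume c0 \<le> min_section_volume K A" .
    \<comment> \<open>A limit on the boundary of the dual cone would have an infinite section,
      whereas the infimum is finite.\<close>
    have int: "c0 \<in> interior (dual_cone K)"
      unfolding interior_dual_iff
    proof (rule ccontr)
      assume "\<not> (\<forall>x\<in>K - {0}. 0 < c0 \<bullet> x)"
      then obtain x where "x \<in> K" "x \<noteq> 0" "c0 \<bullet> x \<le> 0" by force
      then have "emeasure lborel (cap c0) = \<infinity>" by (rule emeasure_cap_infinite)
      then have "section_volume c0 = \<infinity>"
        using section_volume_eq[OF nz nonneg] nz by (simp add: ennreal_mult_top)
      then show False using le min_section_volume_finite[OF A(1,2)] by simp
    qed
    show ?thesis
      using that(1)[OF int c0A] le min_section_volume_le[OF int c0A] by (metis antisym)
  qed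
qed

lemma min_section_volume_pos: "0 < min_section_volume K A"
proof (rule min_section_volume_attained_or_face_volume)
  fix b assume "b \<in> interior (dual_cone K)" "b \<bullet> A = 1" "section_volume b = min_section_volume K A"
  then show ?thesis
    using section_volume_pos[OF interior_dual_nonzero interior_dual_nonneg] by metis
next
  fix \<beta> assume "face_volume \<beta> = min_section_volume K A"
  then show ?thesis using face_volume_pos by metis
qed

end

section \<open>The centroid of a minimal segment\<close>

lemma emeasure_lborel_hyperplane:
  fixes a :: "'a::euclidean_space"
  assumes "a \<noteq> 0"
  shows "emeasure lborel {x. a \<bullet> x = r} = 0"
proof -
  have "{x. a \<bullet> x = r} \<in> null_sets lebesgue"
    using negligible_hyperplane[of a r] assms negligible_iff_null_sets by blast
  then have "{x. a \<bullet> x = r} \<in> null_sets lborel"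
    by (metis null_sets_completion_iff borel_closed closed_hyperplane sets_lborel)
  then show ?thesis by auto
qed

section \<open>The segment volume as an integral over the hyperplane\<close>

context cone_face
begin

definition segment :: "'a \<Rightarrow> 'a set" where
  "segment \<beta> = {y \<in> face. \<beta> \<bullet> y \<le> 1}"

text \<open>The height of the pyramid above \<open>y\<close>. It is convex in \<beta>, which lets a
  subgradient inequality replace differentiation of the volume.\<close>

definition tent :: "'a \<Rightarrow> 'a \<Rightarrow> real" where
  "tent \<beta> y = indicator face y * max 0 (1 - \<beta> \<bullet> y)"

abbreviation face_lborel :: "'a measure" where
  "face_lborel \<equiv> flat_lborel {x. u \<bullet> x = 0}"

lemma segment_borel [measurable]: "segment \<beta> \<in> sets borel"
  unfolding segment_def by measurable

lemma tent_borel [measurable]: "tent \<beta> \<in> borel_measurable borel"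
  unfolding tent_def by measurable

lemma tent_nonneg: "0 \<le> tent \<beta> y"
  by (simp add: tent_def)

lemma integral_tent_nonneg: "0 \<le> (\<integral>y. tent \<beta> y \<partial>face_lborel)"
  by (simp add: integral_nonneg_AE tent_nonneg)

lemma face_volume_segment: "face_volume \<beta> = emeasure face_lborel (segment \<beta>)"
  by (simp add: face_volume_def segment_def flat_volume_def)

text \<open>Fubini on the region under the graph of \<open>tent \<beta>\<close>: lines along
  \<open>u\<close> give the tent, slices parallel to the hyperplane give the pyramid.\<close>

lemma nn_integral_tent: "(\<integral>\<^sup>+y. ennreal (tent \<beta> y) \<partial>face_lborel) = emeasure lborel (pyramid \<beta>)"
proof -
  let ?S = "{p. fst p \<in> face \<and> 0 \<le> snd p \<and> snd p \<le> 1 - \<beta> \<bullet> fst p} :: ('a \<times> real) set"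
  let ?k = "\<lambda>y s. indicator ?S (y, s) :: ennreal"
  have "{p \<in> space (borel \<Otimes>\<^sub>M borel). fst p \<in> face \<and> 0 \<le> snd p \<and> snd p \<le> 1 - \<beta> \<bullet> fst p}
      \<in> sets (borel \<Otimes>\<^sub>M borel)"
    by measurable
  then have S[measurable]: "?S \<in> sets (borel \<Otimes>\<^sub>M borel)"
    by (simp add: space_pair_measure)
  have "(\<integral>\<^sup>+s. ?k y s \<partial>lborel) = ennreal (tent \<beta> y)" for y
  proof -
    have "(\<integral>\<^sup>+s. ?k y s \<partial>lborel) = (\<integral>\<^sup>+s. indicator face y * indicator {0..1 - \<beta> \<bullet> y} s \<partial>lborel)"
      by (intro nn_integral_cong) (auto simp: indicator_def)
    also have "\<dots> = indicator face y * emeasure lborel {0..1 - \<beta> \<bullet> y}"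
      by (simp add: nn_integral_cmult)
    also have "\<dots> = ennreal (tent \<beta> y)"
      by (auto simp: tent_def indicator_def emeasure_lborel_Icc_eq max_def)
    finally show ?thesis .
  qed
  then have "(\<integral>\<^sup>+y. ennreal (tent \<beta> y) \<partial>face_lborel) = (\<integral>\<^sup>+y. (\<integral>\<^sup>+s. ?k y s \<partial>lborel) \<partial>face_lborel)"
    by simp
  also have "\<dots> = (\<integral>\<^sup>+s. (\<integral>\<^sup>+y. ?k y s \<partial>face_lborel) \<partial>lborel)"
    by (rule flat_lborel_hyperplane_Fubini[OF unit]) measurable
  also have "\<dots> = (\<integral>\<^sup>+s. (\<integral>\<^sup>+y. indicator (pyramid \<beta>) (y + s *\<^sub>R u) \<partial>face_lborel) \<partial>lborel)"
  proof (rule nn_integral_cong, rule nn_integral_cong_AE)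
    fix s :: real
    show "AE y in face_lborel. ?k y s = indicator (pyramid \<beta>) (y + s *\<^sub>R u)"
      using AE_flat_lborel_hyperplane[OF unit, of 0]
      by eventually_elim (auto simp: indicator_def pyramid_def proj_def inner_add_right)
  qed
  also have "\<dots> = (\<integral>\<^sup>+z. indicator (pyramid \<beta>) z \<partial>lborel)"
    by (rule nn_integral_lborel_hyperplane[OF unit, symmetric]) measurable
  finally show ?thesis by simp
qed

lemma emeasure_face_lborel_cball: "emeasure face_lborel (cball 0 R) < \<infinity>"
proof -
  have "emeasure face_lborel (cball 0 R)
      = emeasure lborel {x. x - (u \<bullet> x) *\<^sub>R u \<in> cball 0 R \<and> 0 \<le> u \<bullet> x \<and> u \<bullet> x \<le> 1}"
    using flat_volume_hyperplane[OF unit, of "cball 0 R"] by (simp add: flat_volume_def)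
  also have "\<dots> \<le> emeasure lborel (cball (0::'a) (R + 1))"
  proof (intro emeasure_mono subsetI)
    fix x assume "x \<in> {x. x - (u \<bullet> x) *\<^sub>R u \<in> cball 0 R \<and> 0 \<le> u \<bullet> x \<and> u \<bullet> x \<le> 1}"
    then have "norm (x - (u \<bullet> x) *\<^sub>R u) \<le> R" "norm ((u \<bullet> x) *\<^sub>R u) \<le> 1"
      by (auto simp: unit)
    then have "norm (x - (u \<bullet> x) *\<^sub>R u + (u \<bullet> x) *\<^sub>R u) \<le> R + 1"
      by (intro norm_triangle_mono)
    then show "x \<in> cball 0 (R + 1)" by simp
  qed simp
  also have "\<dots> < \<infinity>" by (rule emeasure_lborel_cball_finite)
  finally show ?thesis .
qed

lemma integrable_face_lborel:
  fixes f :: "'a \<Rightarrow> 'b::{banach, second_countable_topology}"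
  assumes "f \<in> borel_measurable borel" and le: "\<And>y. norm (f y) \<le> C * indicator (cball 0 R) y"
  shows "integrable face_lborel f"
proof (rule Bochner_Integration.integrable_bound)
  have "integrable face_lborel (indicator (cball 0 R) :: 'a \<Rightarrow> real)"
    using emeasure_face_lborel_cball[of R] by (simp add: integrable_indicator_iff less_top)
  then show "integrable face_lborel (\<lambda>y. C * indicator (cball 0 R) y :: real)"
    by (rule integrable_mult_right)
  show "f \<in> borel_measurable face_lborel" using assms(1) by measurable
  show "AE y in face_lborel. norm (f y) \<le> norm (C * indicator (cball 0 R) y :: real)"
    using le order_trans[OF _ abs_ge_self] by (intro AE_I2) auto
qed

text \<open>As \<beta> is orthogonal to \<open>u\<close>, the prism over its level set lies in a
  hyperplane of the whole space. Points on the cutting plane can therefore be ignored when segments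
  converge.\<close>

lemma AE_face_lborel_neq:
  assumes "\<beta> \<noteq> 0" "u \<bullet> \<beta> = 0"
  shows "AE y in face_lborel. \<beta> \<bullet> y \<noteq> r"
proof -
  have "emeasure face_lborel {y. \<beta> \<bullet> y = r}
      = emeasure lborel {x. x - (u \<bullet> x) *\<^sub>R u \<in> {y. \<beta> \<bullet> y = r} \<and> 0 \<le> u \<bullet> x \<and> u \<bullet> x \<le> 1}"
    using flat_volume_hyperplane[OF unit, of "{y. \<beta> \<bullet> y = r}"] by (simp add: flat_volume_def)
  also have "\<dots> \<le> emeasure lborel {x. \<beta> \<bullet> x = r}"
    using assms(2) by (intro emeasure_mono) (auto simp: inner_diff_right inner_commute[of \<beta> u])
  also have "\<dots> = 0" using assms(1) by (rule emeasure_lborel_hyperplane)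
  finally show ?thesis by (intro AE_I[where N="{y. \<beta> \<bullet> y = r}"]) auto
qed

lemma segment_subset_cball:
  assumes "e > 0" "\<And>x. x \<in> face \<Longrightarrow> e * norm x \<le> \<beta> \<bullet> x"
  shows "segment \<beta> \<subseteq> cball 0 (1 / e)"
proof
  fix x assume "x \<in> segment \<beta>"
  then have "e * norm x \<le> 1" using assms(2)[of x] by (auto simp: segment_def)
  then show "x \<in> cball 0 (1 / e)" using assms(1) by (simp add: field_simps)
qed

lemma integrable_tent:
  assumes e: "e > 0" "\<And>x. x \<in> face \<Longrightarrow> e * norm x \<le> \<beta> \<bullet> x"
  shows "integrable face_lborel (tent \<beta>)"
proof (rule integrable_face_lborel)
  fix y
  have nn: "0 \<le> \<beta> \<bullet> y" if "y \<in> face"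
    using order_trans[OF mult_nonneg_nonneg[OF less_imp_le[OF e(1)] norm_ge_zero] e(2)[OF that]] .
  show "norm (tent \<beta> y) \<le> 1 * indicator (cball 0 (1 / e)) y"
  proof (cases "y \<in> segment \<beta>")
    case True
    then show ?thesis using segment_subset_cball[OF e] nn by (auto simp: tent_def segment_def indicator_def)
  next
    case False
    then show ?thesis by (auto simp: tent_def segment_def indicator_def)
  qed
qed measurable

lemma face_volume_tent:
  assumes e: "e > 0" "\<And>x. x \<in> face \<Longrightarrow> e * norm x \<le> \<beta> \<bullet> x"
  shows "face_volume \<beta> = ennreal (real DIM('a) * (\<integral>y. tent \<beta> y \<partial>face_lborel))"
proof -
  have "0 \<le> \<beta> \<bullet> y" if "y \<in> face" for y
    using order_trans[OF mult_nonneg_nonneg[OF less_imp_le[OF e(1)] norm_ge_zero] e(2)[OF that]] .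
  then have "face_volume \<beta> = ennreal (real DIM('a)) * (\<integral>\<^sup>+y. ennreal (tent \<beta> y) \<partial>face_lborel)"
    unfolding nn_integral_tent by (rule face_volume_pyramid)
  also have "(\<integral>\<^sup>+y. ennreal (tent \<beta> y) \<partial>face_lborel) = ennreal (\<integral>y. tent \<beta> y \<partial>face_lborel)"
    using integrable_tent[OF e] tent_nonneg by (intro nn_integral_eq_integral) auto
  finally show ?thesis by (simp add: ennreal_mult[symmetric] integral_tent_nonneg)
qed

end

section \<open>First variation and centroid\<close>

context cone_facet
begin

text \<open>Finiteness of the minimum forces \<beta> to be positive on the face, and compactness
  makes this uniform, which leaves room to perturb \<beta>.\<close>

lemma minimal_functional_bound:
  assumes "face_volume \<beta> = min_section_volume K A"
  obtains e where "e > 0" "\<And>x. x \<in> face \<Longrightarrow> e * norm x \<le> \<beta> \<bullet> x"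
proof -
  have "0 < \<beta> \<bullet> x" if "x \<in> face" "x \<noteq> 0" for x
    using face_volume_infinite[OF that, of \<beta>] min_section_volume_finite[OF A(1,2)] assms
    by (metis linorder_not_less less_irrefl)
  then show ?thesis using closed_cone_pos_bound[OF closed_face cone_face, of \<beta>] that by blast
qed

text \<open>
  The tent functions are convex in the functional, with subgradient \<open>- y\<close> on the segment. Hence
  minimality of \<open>\<beta>\<close> makes the integral of \<open>v \<bullet> y\<close> over the segment of \<open>\<beta> + t *\<^sub>R v\<close> nonpositive
  for \<open>t > 0\<close>.
\<close>
lemma minimal_segment_variation:
  assumes \<beta>: "u \<bullet> \<beta> = 0" "\<beta> \<bullet> A = 1" and min: "face_volume \<beta> = min_section_volume K A"
    and v: "u \<bullet> v = 0" "v \<bullet> A = 0"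
  shows "(\<integral>y. indicator (segment \<beta>) y * (v \<bullet> y) \<partial>face_lborel) \<le> 0"
proof -
  obtain e where e: "e > 0" "\<And>x. x \<in> face \<Longrightarrow> e * norm x \<le> \<beta> \<bullet> x"
    using minimal_functional_bound[OF min] by blast
  \<comment> \<open>With \<open>d * norm v \<le> e / 2\<close> every perturbed functional keeps half
    of the lower bound, so all segments lie in the ball of radius \<open>2 / e\<close>.\<close>
  define d where "d = e / (2 * (norm v + 1))"
  have d: "d > 0" "d * norm v \<le> e / 2"
    using e(1) by (auto simp: d_def field_simps add_pos_nonneg)
  define t where "t k = d * inverse (real (Suc k))" for k
  have t: "0 < t k" "t k \<le> d" for k using d(1) by (auto simp: t_def field_simps)
  have tlim: "t \<longlonglongrightarrow> 0"
    unfolding t_def using tendsto_mult_right_zero[OF LIMSEQ_inverse_real_of_nat, of d] by simp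
  define \<gamma> where "\<gamma> k = \<beta> + t k *\<^sub>R v" for k
  have \<gamma>: "e / 2 * norm x \<le> \<gamma> k \<bullet> x" if "x \<in> face" for k x
  proof -
    have "\<bar>t k * (v \<bullet> x)\<bar> \<le> t k * (norm v * norm x)"
      using t(1)[of k] Cauchy_Schwarz_ineq2[of v x] by (simp add: abs_mult)
    also have "\<dots> \<le> d * (norm v * norm x)" using t(2)[of k] by (intro mult_right_mono) auto
    also have "\<dots> \<le> e / 2 * norm x" using mult_right_mono[OF d(2), of "norm x"] by (simp add: mult.assoc)
    finally show ?thesis using e(2)[OF that] by (simp add: \<gamma>_def inner_add_left)
  qed
  have e2: "e / 2 > 0" using e(1) by simp
  let ?W = "cball (0::'a) (2 / e)"
  have W: "segment (\<gamma> k) \<subseteq> ?W" for k using segment_subset_cball[OF e2 \<gamma>, of k] by simp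
  have W0: "segment \<beta> \<subseteq> ?W"
  proof -
    have "1 / e \<le> 2 / e" using e(1) by (simp add: divide_right_mono)
    then show ?thesis using segment_subset_cball[OF e] by (auto intro: order_trans)
  qed
  define C where "C = norm v * (2 / e)"
  have bd: "norm (indicator S y * (v \<bullet> y)) \<le> C * indicator ?W y" if "S \<subseteq> ?W" for S y
  proof (cases "y \<in> S")
    case True
    then have "norm y \<le> 2 / e" using that by auto
    have "\<bar>v \<bullet> y\<bar> \<le> norm v * norm y" by (rule Cauchy_Schwarz_ineq2)
    also have "\<dots> \<le> C" unfolding C_def using \<open>norm y \<le> 2 / e\<close> by (intro mult_left_mono) auto
    finally show ?thesis using True that by (auto simp: indicator_def)
  next
    case False
    then show ?thesis using e(1) by (simp add: C_def)
  qed
  have int: "integrable face_lborel (\<lambda>y. indicator (segment (\<gamma> k)) y * (v \<bullet> y))" for k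
    by (rule integrable_face_lborel[OF _ bd[OF W]]) measurable
  \<comment> \<open>The subgradient is taken at \<open>\<gamma> k\<close> rather than at \<beta>, so
    that convexity and minimality of \<beta> enclose the tent integral of \<beta> and force
    \<open>t k * ?I k \<le> 0\<close>. Pointwise, the left integrand is
    \<open>1 - \<beta> \<bullet> y\<close> on \<open>segment (\<gamma> k)\<close> and 0
    elsewhere.\<close>
  have le0: "(\<integral>y. indicator (segment (\<gamma> k)) y * (v \<bullet> y) \<partial>face_lborel) \<le> 0" (is "?I k \<le> 0") for k
  proof -
    have "(\<integral>y. tent (\<gamma> k) y + t k * (indicator (segment (\<gamma> k)) y * (v \<bullet> y)) \<partial>face_lborel)
        \<le> (\<integral>y. tent \<beta> y \<partial>face_lborel)"
    proof (rule integral_mono)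
      show "integrable face_lborel (\<lambda>y. tent (\<gamma> k) y + t k * (indicator (segment (\<gamma> k)) y * (v \<bullet> y)))"
        using integrable_tent[OF e2 \<gamma>] int by (intro Bochner_Integration.integrable_add integrable_mult_right)
      show "integrable face_lborel (tent \<beta>)" using integrable_tent[OF e] .
      show "tent (\<gamma> k) y + t k * (indicator (segment (\<gamma> k)) y * (v \<bullet> y)) \<le> tent \<beta> y" for y
        by (auto simp: tent_def segment_def indicator_def \<gamma>_def inner_add_left max_def)
    qed
    moreover have "(\<integral>y. tent (\<gamma> k) y + t k * (indicator (segment (\<gamma> k)) y * (v \<bullet> y)) \<partial>face_lborel)
        = (\<integral>y. tent (\<gamma> k) y \<partial>face_lborel) + t k * ?I k"
      using integrable_tent[OF e2 \<gamma>] int by simp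
    moreover have "(\<integral>y. tent \<beta> y \<partial>face_lborel) \<le> (\<integral>y. tent (\<gamma> k) y \<partial>face_lborel)"
    proof -
      have "face_volume \<beta> \<le> face_volume (\<gamma> k)"
        unfolding min using \<beta> v
        by (intro min_section_volume_le_face_volume') (auto simp: \<gamma>_def inner_add_left inner_add_right)
      then have "ennreal (real DIM('a) * (\<integral>y. tent \<beta> y \<partial>face_lborel))
          \<le> ennreal (real DIM('a) * (\<integral>y. tent (\<gamma> k) y \<partial>face_lborel))"
        using face_volume_tent[OF e] face_volume_tent[OF e2 \<gamma>, of k] by simp
      then have "real DIM('a) * (\<integral>y. tent \<beta> y \<partial>face_lborel) \<le> real DIM('a) * (\<integral>y. tent (\<gamma> k) y \<partial>face_lborel)"
        using integral_tent_nonneg[of "\<gamma> k"] by (subst (asm) ennreal_le_iff) auto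
      then show ?thesis by simp
    qed
    ultimately have "t k * ?I k \<le> 0" by linarith
    then show ?thesis using t(1)[of k] by (simp add: mult_le_0_iff)
  qed
  \<comment> \<open>The indicators can fail to converge only where
    \<open>\<beta> \<bullet> y = 1\<close>, a null set of the hyperplane.\<close>
  have "(\<lambda>k. ?I k) \<longlonglongrightarrow> (\<integral>y. indicator (segment \<beta>) y * (v \<bullet> y) \<partial>face_lborel)"
  proof (rule integral_dominated_convergence)
    show "integrable face_lborel (\<lambda>y. C * indicator ?W y :: real)"
      using e(1) by (intro integrable_face_lborel[where C=C and R="2/e"]) (auto simp: C_def indicator_def)
    show "AE y in face_lborel. norm (indicator (segment (\<gamma> k)) y * (v \<bullet> y)) \<le> C * indicator ?W y" for k
      using bd[OF W] by (intro AE_I2)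
    have "\<beta> \<noteq> 0" using \<beta>(2) by auto
    from AE_face_lborel_neq[OF this \<beta>(1), of 1]
    show "AE y in face_lborel. (\<lambda>k. indicator (segment (\<gamma> k)) y * (v \<bullet> y))
        \<longlonglongrightarrow> indicator (segment \<beta>) y * (v \<bullet> y)"
    proof eventually_elim
      fix y assume ne: "\<beta> \<bullet> y \<noteq> 1"
      have "(\<lambda>k. \<beta> \<bullet> y + t k * (v \<bullet> y)) \<longlonglongrightarrow> \<beta> \<bullet> y + 0 * (v \<bullet> y)"
        using tlim by (intro tendsto_intros)
      then have lim: "(\<lambda>k. \<gamma> k \<bullet> y) \<longlonglongrightarrow> \<beta> \<bullet> y"
        by (simp add: \<gamma>_def inner_add_left)
      have "eventually (\<lambda>k. (\<gamma> k \<bullet> y \<le> 1) = (\<beta> \<bullet> y \<le> 1)) sequentially"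
      proof (cases "\<beta> \<bullet> y < 1")
        case True
        from order_tendstoD(2)[OF lim this] show ?thesis by eventually_elim (use True in auto)
      next
        case False
        then have "1 < \<beta> \<bullet> y" using ne by simp
        from order_tendstoD(1)[OF lim this] show ?thesis by eventually_elim (use False ne in auto)
      qed
      then have "eventually (\<lambda>k. indicator (segment \<beta>) y * (v \<bullet> y)
          = indicator (segment (\<gamma> k)) y * (v \<bullet> y)) sequentially"
        by eventually_elim (simp add: segment_def indicator_def)
      then show "(\<lambda>k. indicator (segment (\<gamma> k)) y * (v \<bullet> y)) \<longlonglongrightarrow> indicator (segment \<beta>) y * (v \<bullet> y)"
        by (rule Lim_transform_eventually[OF tendsto_const])
    qed
  qed measurable
  then show ?thesis by (rule LIMSEQ_le_const2) (use le0 in auto)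
qed

text \<open>The first moment \<open>J\<close> is orthogonal to \<open>u\<close>, and the variation
  in a direction and its opposite makes it orthogonal to everything perpendicular to both
  \<open>u\<close> and \<open>A\<close>; so it is a multiple of \<open>A\<close>. Evaluating the
  tent integral both as \<open>g / ?n\<close> and as \<open>g - \<beta> \<bullet> J\<close> fixes
  the multiple.\<close>

lemma minimal_segment_centroid:
  assumes \<beta>: "u \<bullet> \<beta> = 0" "\<beta> \<bullet> A = 1" and min: "face_volume \<beta> = min_section_volume K A"
  shows "flat_centroid {x. u \<bullet> x = 0} (segment \<beta>) = ((real DIM('a) - 1) / real DIM('a)) *\<^sub>R A"
proof -
  obtain e where e: "e > 0" "\<And>x. x \<in> face \<Longrightarrow> e * norm x \<le> \<beta> \<bullet> x"
    using minimal_functional_bound[OF min] by blast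
  let ?n = "real DIM('a)"
  let ?W = "cball (0::'a) (1 / e)"
  have W: "segment \<beta> \<subseteq> ?W" using segment_subset_cball[OF e] .
  define J where "J = (\<integral>y. indicator (segment \<beta>) y *\<^sub>R y \<partial>face_lborel)"
  define g where "g = measure face_lborel (segment \<beta>)"
  have intJ: "integrable face_lborel (\<lambda>y. indicator (segment \<beta>) y *\<^sub>R y)"
    using W e(1) by (intro integrable_face_lborel[where C="1/e" and R="1/e"]) (auto simp: indicator_def)
  have inner_J: "a \<bullet> J = (\<integral>y. indicator (segment \<beta>) y * (a \<bullet> y) \<partial>face_lborel)" for a
    unfolding J_def by (subst integral_inner_right[symmetric]) (use intJ in auto)
  have fin: "emeasure face_lborel (segment \<beta>) < \<infinity>"
    using min min_section_volume_finite[OF A(1,2)] by (simp add: face_volume_segment)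
  then have g: "emeasure face_lborel (segment \<beta>) = ennreal g"
    by (simp add: g_def emeasure_eq_ennreal_measure less_top)
  then have gpos: "g > 0" using face_volume_pos[of \<beta>] by (simp add: face_volume_segment)
  have "ennreal g = ennreal (?n * (\<integral>y. tent \<beta> y \<partial>face_lborel))"
    using face_volume_tent[OF e] by (simp add: face_volume_segment g)
  then have gt: "g = ?n * (\<integral>y. tent \<beta> y \<partial>face_lborel)"
    using gpos integral_tent_nonneg[of \<beta>] by (subst (asm) ennreal_inj) auto
  have "(\<integral>y. tent \<beta> y \<partial>face_lborel)
      = (\<integral>y. indicator (segment \<beta>) y - indicator (segment \<beta>) y * (\<beta> \<bullet> y) \<partial>face_lborel)"
    by (intro Bochner_Integration.integral_cong) (auto simp: tent_def segment_def indicator_def)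
  also have "\<dots> = g - \<beta> \<bullet> J"
  proof -
    have "integrable face_lborel (indicator (segment \<beta>) :: 'a \<Rightarrow> real)"
      using fin by (simp add: integrable_indicator_iff less_top)
    moreover have "integrable face_lborel (\<lambda>y. indicator (segment \<beta>) y * (\<beta> \<bullet> y))"
      using integrable_inner_right[OF intJ, of \<beta>] by simp
    ultimately show ?thesis by (simp add: inner_J g_def)
  qed
  finally have "(\<integral>y. tent \<beta> y \<partial>face_lborel) = g - \<beta> \<bullet> J" .
  moreover have "(\<integral>y. tent \<beta> y \<partial>face_lborel) = g / ?n" using gt by simp
  ultimately have "\<beta> \<bullet> J = g - g / ?n" by simp
  then have \<beta>J: "\<beta> \<bullet> J = g * ((?n - 1) / ?n)"
    by (simp add: field_simps)
  have uJ: "u \<bullet> J = 0"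
    unfolding inner_J
  proof (rule integral_eq_zero_AE)
    show "AE y in face_lborel. indicator (segment \<beta>) y * (u \<bullet> y) = 0"
      using AE_flat_lborel_hyperplane[OF unit, of 0] by eventually_elim simp
  qed
  have vJ: "v \<bullet> J = 0" if v: "u \<bullet> v = 0" "v \<bullet> A = 0" for v
  proof -
    have "w \<bullet> J \<le> 0" if "u \<bullet> w = 0" "w \<bullet> A = 0" for w
      unfolding inner_J using that by (rule minimal_segment_variation[OF \<beta> min])
    from this[of v] this[of "- v"] show ?thesis using v by simp
  qed
  \<comment> \<open>\<open>w\<close> is the deviation from the claimed moment and \<open>v\<close>
    its part orthogonal to \<open>A\<close>. Since \<open>v \<bullet> v = v \<bullet> w = 0\<close>,
    only a multiple of \<open>A\<close> remains, and \<beta>, which is 1 at \<open>A\<close> and 0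
    at \<open>w\<close>, shows it to be 0.\<close>
  define w where "w = J - (g * ((?n - 1) / ?n)) *\<^sub>R A"
  define v where "v = w - (w \<bullet> A / (A \<bullet> A)) *\<^sub>R A"
  have uv: "u \<bullet> v = 0" using uJ A(3) by (simp add: v_def w_def inner_diff_right)
  have vA: "v \<bullet> A = 0" using A(2) by (simp add: v_def inner_diff_left)
  have "v \<bullet> w = 0" using vJ[OF uv vA] vA by (simp add: w_def inner_diff_right)
  then have "v \<bullet> v = 0" using vA by (simp add: v_def inner_diff_right)
  then have w: "w = (w \<bullet> A / (A \<bullet> A)) *\<^sub>R A" by (simp add: v_def)
  have "\<beta> \<bullet> w = 0" using \<beta>J \<beta>(2) by (simp add: w_def inner_diff_right)
  moreover have "\<beta> \<bullet> w = w \<bullet> A / (A \<bullet> A)" using \<beta>(2) by (subst w) simp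
  ultimately have "w \<bullet> A / (A \<bullet> A) = 0" by metis
  with w have "w = 0" by (metis scaleR_zero_left)
  then have J: "J = (g * ((?n - 1) / ?n)) *\<^sub>R A" by (simp add: w_def)
  have "flat_centroid {x. u \<bullet> x = 0} (segment \<beta>) = (1 / g) *\<^sub>R J"
    by (simp add: flat_centroid_def g_def J_def set_lebesgue_integral_def)
  then show ?thesis using gpos by (simp add: J)
qed

end

section \<open>Facets and cutting planes\<close>

context cone_face
begin

lemma convex_cylinder: "convex {z. proj z \<in> K}"
  using convex_linear_vimage[OF linear_proj convex] by (simp add: vimage_def)

lemma cone_cylinder: "cone {z. proj z \<in> K}"
  using cone by (auto simp: cone_def linear_scale[OF linear_proj])

lemma frontier_Int_hyperplane: "frontier K \<inter> {x. u \<bullet> x = 0} = face"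
  using inner_interior_pos by (force simp: face_def frontier_def closure_closed[OF closed])

text \<open>The open witness is the trace on the hyperplane of the interior of the cylinder, because
  \<open>proj\<close> is the identity there.\<close>

lemma facet_hyperplane_of_interior:
  assumes "A \<in> interior {z. proj z \<in> K}"
  shows "facet_hyperplane K A {x. u \<bullet> x = 0}"
  unfolding facet_hyperplane_def frontier_Int_hyperplane
proof (intro conjI)
  have "u \<noteq> 0" using unit by auto
  then show "aff_dim {x. u \<bullet> x = 0} = int DIM('a) - 1"
    using DIM_positive[where 'a='a] by (subst aff_dim_hyperplane) auto
  let ?U = "{x. u \<bullet> x = 0} \<inter> interior {z. proj z \<in> K}"
  have "openin (top_of_set {x. u \<bullet> x = 0}) ?U" by (intro openin_open_Int) auto
  moreover have "?U \<subseteq> face"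
    using interior_subset proj_id by (force simp: face_def)
  ultimately show "A \<in> top_of_set {x. u \<bullet> x = 0} interior_of face"
    using assms A(3) by (auto simp: interior_of_def)
qed (auto simp: affine_hyperplane)

text \<open>
  The functional \<open>c\<close> vanishes at \<open>A\<close>, so adding multiples of it to an admissible functional keeps
  the section through \<open>A\<close>, while its limiting pyramid shrinks to a subset of a hyperplane.
\<close>
lemma min_section_volume_zero:
  assumes c: "c \<noteq> 0" "u \<bullet> c = 0" "c \<bullet> A = 0" "\<And>x. x \<in> face \<Longrightarrow> 0 \<le> c \<bullet> x"
  shows "min_section_volume K A = 0"
proof -
  obtain b where b: "b \<in> interior (dual_cone K)" "b \<bullet> A = 1"
    using admissible_functional[OF A(1,2)] by blast
  define \<beta> where "\<beta> k = proj b + real k *\<^sub>R c" for k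
  have pb: "proj b \<bullet> x = b \<bullet> x" if "u \<bullet> x = 0" for x
    using that by (simp add: proj_def inner_diff_left)
  have u\<beta>: "u \<bullet> \<beta> k = 0" for k using c by (simp add: \<beta>_def inner_add_right)
  have \<beta>A: "\<beta> k \<bullet> A = 1" for k using c b A by (simp add: \<beta>_def inner_add_left pb)
  have \<beta>pos: "0 < \<beta> k \<bullet> x" if x: "x \<in> face" "x \<noteq> 0" for k x
  proof -
    have "0 < b \<bullet> x" using b(1) x by (auto simp: interior_dual_iff face_def)
    moreover have "proj b \<bullet> x = b \<bullet> x" using x by (intro pb) (simp add: face_def)
    ultimately show ?thesis using c(4)[OF x(1)] by (simp add: \<beta>_def inner_add_left add_pos_nonneg)
  qed
  have \<beta>nn: "0 \<le> \<beta> k \<bullet> x" if x: "x \<in> face" for k x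
    using \<beta>pos[OF x] by (cases "x = 0") (auto intro: less_imp_le)
  have bound: "min_section_volume K A \<le> ennreal (real DIM('a)) * emeasure lborel (pyramid (\<beta> k))" for k
    using min_section_volume_le_face_volume[OF u\<beta> \<beta>A \<beta>pos] face_volume_pyramid[OF \<beta>nn] by simp
  have "(\<lambda>k. emeasure lborel (pyramid (\<beta> k))) \<longlonglongrightarrow> emeasure lborel (\<Inter>k. pyramid (\<beta> k))"
  proof (rule Lim_emeasure_decseq)
    show dec: "decseq (\<lambda>k. pyramid (\<beta> k))"
    proof (intro decseq_SucI subsetI)
      fix k z assume z: "z \<in> pyramid (\<beta> (Suc k))"
      have "\<beta> (Suc k) \<bullet> proj z = \<beta> k \<bullet> proj z + c \<bullet> proj z"
        by (simp add: \<beta>_def inner_add_left algebra_simps)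
      then show "z \<in> pyramid (\<beta> k)"
        using z c(4)[of "proj z"] by (simp add: pyramid_def)
    qed
    obtain e where e: "e > 0" "\<And>x. x \<in> face \<Longrightarrow> e * norm x \<le> \<beta> 0 \<bullet> x"
      using closed_cone_pos_bound[OF closed_face cone_face \<beta>pos[of _ 0]] by blast
    have sub: "pyramid (\<beta> 0) \<subseteq> cball 0 (1 / e + 1)"
    proof
      fix z assume z: "z \<in> pyramid (\<beta> 0)"
      then have "e * norm (proj z) + u \<bullet> z \<le> 1" "0 \<le> u \<bullet> z"
        using e(2)[of "proj z"] by (auto simp: pyramid_def)
      moreover have "0 \<le> e * norm (proj z)" using e(1) by simp
      ultimately have "e * norm (proj z) \<le> 1" "norm ((u \<bullet> z) *\<^sub>R u) \<le> 1" by (auto simp: unit)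
      then have "norm (proj z) \<le> 1 / e" "norm ((u \<bullet> z) *\<^sub>R u) \<le> 1"
        using e(1) by (auto simp: field_simps)
      then have "norm (proj z + (u \<bullet> z) *\<^sub>R u) \<le> 1 / e + 1" by (rule norm_triangle_mono)
      then show "z \<in> cball 0 (1 / e + 1)" by (simp add: proj_def)
    qed
    have "emeasure lborel (pyramid (\<beta> k)) < \<infinity>" for k
    proof -
      have "pyramid (\<beta> k) \<subseteq> pyramid (\<beta> 0)"
        using dec by (auto simp: decseq_def)
      then have "emeasure lborel (pyramid (\<beta> k)) \<le> emeasure lborel (cball (0::'a) (1 / e + 1))"
        using sub by (intro emeasure_mono) auto
      also have "\<dots> < \<infinity>" by (rule emeasure_lborel_cball_finite)
      finally show ?thesis .
    qed
    then show "emeasure lborel (pyramid (\<beta> k)) \<noteq> \<infinity>" for k by (simp add: less_top)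
  qed auto
  moreover have "emeasure lborel (\<Inter>k. pyramid (\<beta> k)) = 0"
  proof -
    have "(\<Inter>k. pyramid (\<beta> k)) \<subseteq> {z. c \<bullet> z = 0}"
    proof
      fix z assume "z \<in> (\<Inter>k. pyramid (\<beta> k))"
      then have z: "proj z \<in> face" "\<And>k. \<beta> k \<bullet> proj z + u \<bullet> z \<le> 1" by (auto simp: pyramid_def)
      have cz: "c \<bullet> proj z = c \<bullet> z" using c(2) by (simp add: proj_def inner_diff_right inner_commute)
      have "real k * (c \<bullet> z) \<le> 1 - proj b \<bullet> proj z - u \<bullet> z" for k
        using z(2)[of k] by (simp add: \<beta>_def inner_add_left cz)
      then have "\<not> 0 < c \<bullet> z"
        using ex_less_of_nat_mult[of "c \<bullet> z" "1 - proj b \<bullet> proj z - u \<bullet> z"] by (meson not_less)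
      moreover have "0 \<le> c \<bullet> z" using c(4)[OF z(1)] cz by simp
      ultimately show "z \<in> {z. c \<bullet> z = 0}" by simp
    qed
    then have "emeasure lborel (\<Inter>k. pyramid (\<beta> k)) \<le> emeasure lborel {z. c \<bullet> z = 0}"
      by (intro emeasure_mono) auto
    then show ?thesis using emeasure_lborel_hyperplane[OF c(1), of 0] by simp
  qed
  ultimately have "(\<lambda>k. emeasure lborel (pyramid (\<beta> k))) \<longlonglongrightarrow> 0" by simp
  then have "(\<lambda>k. ennreal (real DIM('a)) * emeasure lborel (pyramid (\<beta> k)))
      \<longlonglongrightarrow> ennreal (real DIM('a)) * 0"
    by (intro ennreal_tendsto_cmult) auto
  then have "min_section_volume K A \<le> ennreal (real DIM('a)) * 0"
    by (rule LIMSEQ_le_const) (use bound in auto)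
  then show ?thesis by simp
qed

text \<open>The cylinder over the face contains both \<open>u\<close> and \<open>- u\<close>, so a
  functional supporting it at \<open>A\<close> is automatically orthogonal to
  \<open>u\<close>.\<close>

lemma min_section_volume_zero_of_not_interior:
  assumes "A \<notin> interior {z. proj z \<in> K}"
  shows "min_section_volume K A = 0"
proof -
  have "A \<in> {z. proj z \<in> K}" using A by (simp add: proj_id)
  then obtain c where c: "c \<noteq> 0" "c \<bullet> A = 0" "\<And>y. y \<in> {z. proj z \<in> K} \<Longrightarrow> 0 \<le> c \<bullet> y"
    using cone_supporting_hyperplane[OF cone_cylinder convex_cylinder _ assms] by blast
  have "proj u = 0" "proj (- u) = 0" by (simp_all add: proj_def)
  then have "0 \<le> c \<bullet> u" "0 \<le> c \<bullet> (- u)" using c(3)[of u] c(3)[of "- u"] by auto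
  then have "u \<bullet> c = 0" by (simp add: inner_commute)
  moreover have "0 \<le> c \<bullet> x" if "x \<in> face" for x
    using that by (intro c(3)) (simp add: face_def proj_id)
  ultimately show ?thesis using c by (intro min_section_volume_zero) auto
qed

text \<open>The segment from 0 to \<open>y\<close> meets the plane exactly when
  \<open>\<beta> \<bullet> y \<ge> 1\<close>, at \<open>y\<close> divided by
  \<open>\<beta> \<bullet> y\<close>. Points with equality enter through the clause
  \<open>x \<in> T'\<close> of \<open>cone_segment\<close>.\<close>

lemma cone_segment_eq:
  "cone_segment face ({x. u \<bullet> x = 0} \<inter> {x. \<beta> \<bullet> x = 1}) = segment \<beta>"
proof -
  have seg: "closed_segment 0 y \<inter> ({x. u \<bullet> x = 0} \<inter> {x. \<beta> \<bullet> x = 1}) = {} \<longleftrightarrow> \<beta> \<bullet> y < 1"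
    if y: "y \<in> face" for y
  proof
    assume empty: "closed_segment 0 y \<inter> ({x. u \<bullet> x = 0} \<inter> {x. \<beta> \<bullet> x = 1}) = {}"
    show "\<beta> \<bullet> y < 1"
    proof (rule ccontr)
      assume ge: "\<not> \<beta> \<bullet> y < 1"
      define x where "x = (1 / (\<beta> \<bullet> y)) *\<^sub>R y"
      have "x \<in> closed_segment 0 y"
        unfolding closed_segment_def x_def using ge
        by (intro CollectI exI[of _ "1 / (\<beta> \<bullet> y)"]) auto
      moreover have "u \<bullet> x = 0" "\<beta> \<bullet> x = 1" using ge y by (auto simp: x_def face_def)
      ultimately show False using empty by blast
    qed
  next
    assume lt: "\<beta> \<bullet> y < 1"
    have "\<beta> \<bullet> x \<noteq> 1" if x: "x \<in> closed_segment 0 y" for x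
    proof -
      obtain s where s: "0 \<le> s" "s \<le> 1" "x = s *\<^sub>R y" using x by (auto simp: closed_segment_def)
      show ?thesis
      proof (cases "0 \<le> \<beta> \<bullet> y")
        case True
        then have "s * (\<beta> \<bullet> y) \<le> 1 * (\<beta> \<bullet> y)" using s by (intro mult_right_mono) auto
        then show ?thesis using lt s by simp
      next
        case False
        then have "s * (\<beta> \<bullet> y) \<le> 0" using s by (simp add: mult_nonneg_nonpos)
        then show ?thesis using s by auto
      qed
    qed
    then show "closed_segment 0 y \<inter> ({x. u \<bullet> x = 0} \<inter> {x. \<beta> \<bullet> x = 1}) = {}" by blast
  qed
  show ?thesis
  proof (intro set_eqI)
    fix y
    show "y \<in> cone_segment face ({x. u \<bullet> x = 0} \<inter> {x. \<beta> \<bullet> x = 1}) \<longleftrightarrow> y \<in> segment \<beta>"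
    proof (cases "y \<in> face")
      case True
      then have "u \<bullet> y = 0" by (simp add: face_def)
      then show ?thesis using True seg[OF True] by (auto simp: cone_segment_def segment_def)
    qed (simp add: cone_segment_def segment_def)
  qed
qed

lemma flat_volume_cone_segment:
  "flat_volume {x. u \<bullet> x = 0} (cone_segment face ({x. u \<bullet> x = 0} \<inter> {x. \<beta> \<bullet> x = 1})) = face_volume \<beta>"
  unfolding cone_segment_eq by (simp add: face_volume_def segment_def)

end

section \<open>Cutting planes as level sets of tangential functionals\<close>

lemma aff_dim_Int_hyperplanes:
  fixes u :: "'a::euclidean_space"
  assumes "u \<noteq> 0" "u \<bullet> A = 0" "\<beta> \<bullet> A = 1"
  shows "aff_dim ({x. u \<bullet> x = 0} \<inter> {x. \<beta> \<bullet> x = 1}) = int DIM('a) - 2"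
proof -
  have "A \<in> {x. u \<bullet> x = 0} \<inter> {x. \<beta> \<bullet> x = 1}" using assms by simp
  then have ne: "{x. u \<bullet> x = 0} \<inter> {x. \<beta> \<bullet> x = 1} \<noteq> {}" by blast
  have "0 \<in> {x. u \<bullet> x = 0} - {x. \<beta> \<bullet> x = 1}" by simp
  then have "\<not> {x. u \<bullet> x = 0} \<subseteq> {x. \<beta> \<bullet> x = 1}" by blast
  then show ?thesis
    using aff_dim_affine_Int_hyperplane[OF affine_hyperplane[of u 0], of \<beta> 1] ne
      aff_dim_hyperplane[OF assms(1), of 0] by simp
qed

text \<open>\<beta> is the foot of the perpendicular from 0 to \<open>T'\<close>, divided by its
  squared norm; it is orthogonal to \<open>u\<close> because the foot lies in the
  hyperplane.\<close>

lemma cutting_plane_iff: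
  fixes u :: "'a::euclidean_space"
  assumes u: "u \<noteq> 0" "u \<bullet> A = 0"
  shows "cutting_plane {x. u \<bullet> x = 0} A T' \<longleftrightarrow>
    (\<exists>\<beta>. u \<bullet> \<beta> = 0 \<and> \<beta> \<bullet> A = 1 \<and> T' = {x. u \<bullet> x = 0} \<inter> {x. \<beta> \<bullet> x = 1})"
proof
  assume "cutting_plane {x. u \<bullet> x = 0} A T'"
  then have T': "affine T'" "aff_dim T' = int DIM('a) - 2" "T' \<subseteq> {x. u \<bullet> x = 0}" "0 \<notin> T'" "A \<in> T'"
    by (auto simp: cutting_plane_def)
  define p where "p = closest_point T' 0"
  have cl: "closed T'" "convex T'" using T'(1) affine_closed affine_imp_convex by auto
  have p: "p \<in> T'" unfolding p_def using cl(1) T'(5) by (intro closest_point_in_set) auto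
  then have "p \<noteq> 0" using T'(4) by auto
  \<comment> \<open>The reflection of \<open>y\<close> in \<open>p\<close> also lies in
    \<open>T'\<close>, so the closest point inequality holds in both directions.\<close>
  have pp: "p \<bullet> y = p \<bullet> p" if y: "y \<in> T'" for y
  proof -
    have "2 *\<^sub>R p + (- 1) *\<^sub>R y \<in> T'" using T'(1) p y by (intro mem_affine) auto
    then have "(0 - p) \<bullet> (2 *\<^sub>R p + (- 1) *\<^sub>R y - p) \<le> 0"
      unfolding p_def using cl by (intro closest_point_dot) auto
    moreover have "(0 - p) \<bullet> (y - p) \<le> 0"
      unfolding p_def using cl y by (intro closest_point_dot)
    ultimately show ?thesis by (simp add: inner_diff_right)
  qed
  define \<beta> where "\<beta> = p /\<^sub>R (p \<bullet> p)"
  have \<beta>: "\<beta> \<bullet> y = 1" if "y \<in> T'" for y using pp[OF that] \<open>p \<noteq> 0\<close> by (simp add: \<beta>_def)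
  have "u \<bullet> \<beta> = 0" using p T'(3) by (auto simp: \<beta>_def)
  moreover have "T' = {x. u \<bullet> x = 0} \<inter> {x. \<beta> \<bullet> x = 1}"
  proof (rule affine_dim_equal)
    show "aff_dim T' = aff_dim ({x. u \<bullet> x = 0} \<inter> {x. \<beta> \<bullet> x = 1})"
      using T'(2) aff_dim_Int_hyperplanes[OF u \<beta>[OF T'(5)]] by simp
  qed (use T' \<beta> in \<open>auto intro!: affine_Int affine_hyperplane\<close>)
  ultimately show "\<exists>\<beta>. u \<bullet> \<beta> = 0 \<and> \<beta> \<bullet> A = 1 \<and> T' = {x. u \<bullet> x = 0} \<inter> {x. \<beta> \<bullet> x = 1}"
    using \<beta>[OF T'(5)] by blast
next
  assume "\<exists>\<beta>. u \<bullet> \<beta> = 0 \<and> \<beta> \<bullet> A = 1 \<and> T' = {x. u \<bullet> x = 0} \<inter> {x. \<beta> \<bullet> x = 1}"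
  then show "cutting_plane {x. u \<bullet> x = 0} A T'"
    unfolding cutting_plane_def using aff_dim_Int_hyperplanes[OF u] u
    by (auto intro!: affine_Int affine_hyperplane)
qed

section \<open>Facet hyperplanes as supporting hyperplanes\<close>

context pointed_cone
begin

text \<open>That \<open>T\<close> supports \<open>K\<close> has to be derived: an interior point of
  \<open>K\<close> in \<open>T\<close> could be joined through \<open>A\<close> to a further point
  of \<open>K\<close>, which would make \<open>A\<close> interior.\<close>

lemma facet_hyperplane_cone_facet:
  assumes A: "A \<in> frontier K" "A \<noteq> 0" and T: "facet_hyperplane K A T"
  obtains u where "cone_facet K u A" "T = {x. u \<bullet> x = 0}"
proof -
  have AK: "A \<in> K" "A \<notin> interior K" using A(1) closed by (auto simp: frontier_def)
  have T': "affine T" "aff_dim T = int DIM('a) - 1" "0 \<in> T"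
    "A \<in> (top_of_set T) interior_of (frontier K \<inter> T)"
    using T by (auto simp: facet_hyperplane_def)
  have sub: "subspace T" using T' by (simp add: subspace_affine)
  have "aff_dim T = int (dim T)" using T'(3) by (intro aff_dim_zero) (simp add: hull_inc)
  then have dimT: "dim T = DIM('a) - 1" using T'(2) DIM_positive[where 'a='a] by linarith
  then have "dim T < DIM('a)" using DIM_positive[where 'a='a] by linarith
  then obtain a where a: "a \<noteq> 0" "span T \<subseteq> {x. a \<bullet> x = 0}"
    using lowdim_subset_hyperplane by blast
  have Ta: "T = {x. a \<bullet> x = 0}"
    using a sub dimT dim_hyperplane[OF a(1)]
    by (intro subspace_dim_equal subspace_hyperplane) (auto simp: span_eq_iff[THEN iffD2])
  obtain U where U: "openin (top_of_set T) U" "A \<in> U" "U \<subseteq> frontier K \<inter> T"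
    using T'(4) by (auto simp: interior_of_def)
  then obtain e where e: "e > 0" "ball A e \<inter> T \<subseteq> frontier K \<inter> T"
    using openin_contains_ball[of T U] by (meson subset_trans)
  have AT: "A \<in> T" using U by blast
  have disj: "p \<notin> T" if p: "p \<in> interior K" for p
  proof
    assume pT: "p \<in> T"
    have "p \<noteq> A" using p AK by auto
    \<comment> \<open>\<open>x\<close> continues the line from \<open>p\<close> slightly beyond
      \<open>A\<close>, within the ball; shrinking from \<open>x\<close> towards \<open>p\<close>
      with ratio \<open>s / (1 + s)\<close> returns to \<open>A\<close>.\<close>
    define s where "s = e / (2 * norm (A - p))"
    have s: "s > 0" "norm (s *\<^sub>R (A - p)) < e" using e \<open>p \<noteq> A\<close> by (auto simp: s_def)
    define x where "x = A + s *\<^sub>R (A - p)"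
    have "x \<in> T" unfolding x_def using sub AT pT by (intro subspace_add subspace_scale subspace_diff)
    moreover have "x \<in> ball A e" using s by (simp add: x_def dist_norm)
    ultimately have "x \<in> K" using e(2) closed by (auto simp: frontier_def)
    then have "x - (s / (1 + s)) *\<^sub>R (x - p) \<in> interior K"
      using convex p s by (intro mem_interior_convex_shrink) auto
    also have "x - (s / (1 + s)) *\<^sub>R (x - p) = A"
    proof -
      have "x - p = (1 + s) *\<^sub>R (A - p)" by (simp add: x_def algebra_simps)
      then have "(s / (1 + s)) *\<^sub>R (x - p) = s *\<^sub>R (A - p)" using s by simp
      then show ?thesis by (simp add: x_def)
    qed
    finally show False using AK by simp
  qed
  \<comment> \<open>Were the signs opposite, the convex combination with the weights below would be
    an interior point of \<open>K\<close> on \<open>T\<close>.\<close>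
  have same: "0 < (a \<bullet> x) * (a \<bullet> y)" if x: "x \<in> interior K" and y: "y \<in> interior K" for x y
  proof (rule ccontr)
    assume neg: "\<not> 0 < (a \<bullet> x) * (a \<bullet> y)"
    have nz: "a \<bullet> x \<noteq> 0" "a \<bullet> y \<noteq> 0" using disj x y by (auto simp: Ta)
    define D where "D = \<bar>a \<bullet> x\<bar> + \<bar>a \<bullet> y\<bar>"
    have D: "D > 0" using nz by (simp add: D_def add_pos_nonneg)
    have "(\<bar>a \<bullet> y\<bar> / D) *\<^sub>R x + (\<bar>a \<bullet> x\<bar> / D) *\<^sub>R y \<in> interior K"
      using convex_interior[OF convex] x y D
      by (intro convexD) (auto simp: add_divide_distrib[symmetric] D_def add.commute)
    moreover have "a \<bullet> ((\<bar>a \<bullet> y\<bar> / D) *\<^sub>R x + (\<bar>a \<bullet> x\<bar> / D) *\<^sub>R y) = 0"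
    proof -
      have "\<bar>a \<bullet> y\<bar> * (a \<bullet> x) + \<bar>a \<bullet> x\<bar> * (a \<bullet> y) = 0"
        using neg by (auto simp: abs_if zero_less_mult_iff split: if_splits)
      then show ?thesis by (simp add: inner_add_right add_divide_distrib[symmetric])
    qed
    ultimately show False using disj by (auto simp: Ta)
  qed
  obtain x0 where x0: "x0 \<in> interior K" using solid by blast
  \<comment> \<open>The sign orients the normal towards the interior of \<open>K\<close>.\<close>
  define u where "u = (sgn (a \<bullet> x0) / norm a) *\<^sub>R a"
  have nz: "a \<bullet> x0 \<noteq> 0" using disj[OF x0] by (simp add: Ta)
  have unit: "norm u = 1" using a nz by (simp add: u_def abs_sgn_eq)
  have Tu: "T = {x. u \<bullet> x = 0}" using a nz by (auto simp: Ta u_def sgn_eq_0_iff)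
  have "0 \<le> u \<bullet> x" if "x \<in> interior K" for x
    using same[OF x0 that] a by (auto simp: u_def sgn_if zero_less_mult_iff intro!: divide_nonneg_pos divide_nonpos_pos)
  then have "interior K \<subseteq> {x. u \<bullet> x \<ge> 0}" by auto
  then have "closure (interior K) \<subseteq> {x. u \<bullet> x \<ge> 0}" by (intro closure_minimal closed_halfspace_ge)
  then have supp: "0 \<le> u \<bullet> x" if "x \<in> K" for x
    using that convex_closure_interior[OF convex solid] closure_subset[of K] by auto
  interpret cone_face K u A
    using unit supp AK A(2) AT by unfold_locales (auto simp: Tu)
  \<comment> \<open>The projection is nonexpansive and fixes \<open>A\<close>, so it maps the ball
    into the relative ball, which lies in the frontier.\<close>
  have "ball A e \<subseteq> {z. proj z \<in> K}"
  proof
    fix z assume z: "z \<in> ball A e"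
    have "norm (proj w) \<le> norm w" for w
    proof -
      have "(norm (proj w))\<^sup>2 = (norm w)\<^sup>2 - (u \<bullet> w)\<^sup>2"
        unfolding power2_norm_eq_inner
        by (simp add: proj_def inner_diff_left inner_diff_right inner_commute[of w u] power2_eq_square)
      then have "(norm (proj w))\<^sup>2 \<le> (norm w)\<^sup>2" by simp
      then show ?thesis by (rule power2_le_imp_le) simp
    qed
    then have "norm (proj (z - A)) \<le> norm (z - A)" .
    moreover have "proj (z - A) = proj z - A"
      using AT by (simp add: linear_diff[OF linear_proj] proj_id Tu)
    ultimately have "proj z \<in> ball A e \<inter> T"
      using z by (simp add: dist_norm norm_minus_commute Tu)
    then show "z \<in> {z. proj z \<in> K}" using e(2) closed by (auto simp: frontier_def)
  qed
  then have "A \<in> interior {z. proj z \<in> K}"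
    using e(1) by (intro interiorI[of "ball A e"]) auto
  then have "cone_facet K u A" by unfold_locales
  then show ?thesis using that Tu by blast
qed

text \<open>For small \<open>w\<close> in the first hyperplane both \<open>A + w\<close> and
  \<open>A - w\<close> lie in \<open>K\<close>; the second supporting functional vanishes at
  \<open>A\<close> and is nonnegative at both points, so it vanishes at \<open>w\<close>.\<close>

lemma cone_facet_hyperplane_subset:
  assumes "cone_facet K u A" "cone_facet K u' A"
  shows "{x. u \<bullet> x = 0} \<subseteq> {x. u' \<bullet> x = 0}"
proof
  interpret F: cone_facet K u A by fact
  interpret F': cone_facet K u' A by fact
  fix x assume x: "x \<in> {x. u \<bullet> x = 0}"
  obtain e where e: "e > 0" "\<And>w. norm w \<le> e \<Longrightarrow> F.proj (A + w) \<in> K"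
    using F.facet_ball by blast
  define w where "w = (e / (norm x + 1)) *\<^sub>R x"
  have "e * norm x \<le> e * (norm x + 1)" using e(1) by simp
  then have "norm w \<le> e" using e(1) by (simp add: w_def pos_divide_le_eq add_nonneg_pos)
  then have "F.proj (A + w) \<in> K" "F.proj (A - w) \<in> K" using e(2)[of w] e(2)[of "- w"] by auto
  then have "A + w \<in> K" "A - w \<in> K"
    using x F.A(3) by (simp_all add: F.proj_id w_def inner_add_right inner_diff_right)
  then have "0 \<le> u' \<bullet> (A + w)" "0 \<le> u' \<bullet> (A - w)" by (auto intro: F'.supp)
  then have "u' \<bullet> w = 0" using F'.A(3) by (simp add: inner_add_right inner_diff_right)
  then show "x \<in> {x. u' \<bullet> x = 0}" using e(1) by (simp add: w_def) (smt (verit) norm_ge_zero)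
qed

lemma facet_hyperplane_unique:
  assumes "A \<in> frontier K" "A \<noteq> 0" "facet_hyperplane K A T" "facet_hyperplane K A T'"
  shows "T = T'"
  using facet_hyperplane_cone_facet[OF assms(1,2,3)] facet_hyperplane_cone_facet[OF assms(1,2,4)]
    cone_facet_hyperplane_subset by (metis subset_antisym)

text \<open>Some supporting hyperplane at \<open>A\<close> exists; as it is not a facet hyperplane,
  \<open>A\<close> is not interior to the cylinder over its face.\<close>

lemma min_section_volume_no_facet:
  assumes A: "A \<in> frontier K" "A \<noteq> 0" and no: "\<nexists>T. facet_hyperplane K A T"
  shows "min_section_volume K A = 0"
proof -
  have AK: "A \<in> K" "A \<notin> interior K" using A(1) closed by (auto simp: frontier_def)
  obtain c where c: "c \<noteq> 0" "c \<bullet> A = 0" "\<And>y. y \<in> K \<Longrightarrow> 0 \<le> c \<bullet> y"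
    using cone_supporting_hyperplane[OF cone convex AK] by blast
  interpret cone_face K "c /\<^sub>R norm c" A
    using c AK A(2) by unfold_locales auto
  show ?thesis
    using facet_hyperplane_of_interior min_section_volume_zero_of_not_interior no by blast
qed

lemma facet_min_section_volume_pos:
  assumes "A \<in> frontier K" "A \<noteq> 0" "facet_hyperplane K A T"
  shows "0 < min_section_volume K A"
  using facet_hyperplane_cone_facet[OF assms] cone_facet.min_section_volume_pos by metis

text \<open>Under \<open>no\<close> the dichotomy for the minimum leaves only a segment of the
  facet. Parametrising cutting planes by functionals carries existence, minimality and the centroid
  over from \<open>face_volume\<close>.\<close>

lemma degenerate_min_section_volume:
  assumes A: "A \<in> frontier K" "A \<noteq> 0" and T: "facet_hyperplane K A T"
    and no: "\<nexists>H. admissible K H \<and> A \<in> H \<and> flat_volume H (K \<inter> H) = min_section_volume K A"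
  shows "\<exists>T'. cutting_plane T A T' \<and>
      flat_volume T (cone_segment (frontier K \<inter> T) T') = min_section_volume K A"
    and "cutting_plane T A T' \<Longrightarrow>
      min_section_volume K A \<le> flat_volume T (cone_segment (frontier K \<inter> T) T')"
    and "cutting_plane T A T' \<Longrightarrow>
      flat_volume T (cone_segment (frontier K \<inter> T) T') = min_section_volume K A \<Longrightarrow>
      flat_centroid T (cone_segment (frontier K \<inter> T) T') = ((real DIM('a) - 1) / real DIM('a)) *\<^sub>R A"
proof -
  obtain u where u: "cone_facet K u A" and Tu: "T = {x. u \<bullet> x = 0}"
    using facet_hyperplane_cone_facet[OF A T] by blast
  interpret cone_facet K u A by fact
  have "u \<noteq> 0" using unit by auto
  note cut = cutting_plane_iff[OF this A(3), folded Tu]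
  note vol = flat_volume_cone_segment[folded Tu]
  have fr: "frontier K \<inter> T = face" unfolding Tu by (rule frontier_Int_hyperplane)
  show "\<exists>T'. cutting_plane T A T' \<and>
      flat_volume T (cone_segment (frontier K \<inter> T) T') = min_section_volume K A"
  proof (rule min_section_volume_attained_or_face_volume)
    fix b assume "b \<in> interior (dual_cone K)" "b \<bullet> A = 1" "section_volume b = min_section_volume K A"
    then have "admissible K {x. b \<bullet> x = 1} \<and> A \<in> {x. b \<bullet> x = 1} \<and>
        flat_volume {x. b \<bullet> x = 1} (K \<inter> {x. b \<bullet> x = 1}) = min_section_volume K A"
      by (auto simp: admissible_def section_volume_def)
    then show ?thesis using no by blast
  next
    fix \<beta> assume \<beta>: "u \<bullet> \<beta> = 0" "\<beta> \<bullet> A = 1" "face_volume \<beta> = min_section_volume K A"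
    then show ?thesis unfolding cut fr using vol[of \<beta>] by auto
  qed
  {
    assume "cutting_plane T A T'"
    then obtain \<beta> where \<beta>: "u \<bullet> \<beta> = 0" "\<beta> \<bullet> A = 1" "T' = T \<inter> {x. \<beta> \<bullet> x = 1}"
      unfolding cut by blast
    then show "min_section_volume K A \<le> flat_volume T (cone_segment (frontier K \<inter> T) T')"
      using min_section_volume_le_face_volume' by (simp add: fr vol)
    assume "flat_volume T (cone_segment (frontier K \<inter> T) T') = min_section_volume K A"
    then have "face_volume \<beta> = min_section_volume K A" by (simp add: fr vol \<beta>(3))
    then have "flat_centroid T (segment \<beta>) = ((real DIM('a) - 1) / real DIM('a)) *\<^sub>R A"
      unfolding Tu by (rule minimal_segment_centroid[OF \<beta>(1,2)])
    then show "flat_centroid T (cone_segment (frontier K \<inter> T) T')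
        = ((real DIM('a) - 1) / real DIM('a)) *\<^sub>R A"
      by (simp add: fr \<beta>(3) cone_segment_eq[folded Tu])
  }
qed

end

text \<open>\<open>closest_point T 0\<close> is the orthogonal projection H of the origin.
  Minimality is split into attainment by some cutting plane and a lower bound for all of them; the
  centroid relation is claimed for every minimal segment.\<close>

theorem proposition5:
  fixes K :: "(real ^ 'n) set" and A :: "real ^ 'n"
  assumes "CARD('n) \<ge> 2"
    and "closed K" and "convex K" and "cone K"
    and "K \<inter> uminus ` K = {0}"
    and "interior K \<noteq> {}"
    and "A \<in> frontier K - {0}"
  shows
    "((\<nexists>T. facet_hyperplane K A T) \<longrightarrow> min_section_volume K A = 0) \<and>
     ((\<exists>T. facet_hyperplane K A T) \<longrightarrow>
        (\<exists>!T. facet_hyperplane K A T) \<and>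
        min_section_volume K A > 0 \<and>
        ((\<nexists>H. admissible K H \<and> A \<in> H \<and> flat_volume H (K \<inter> H) = min_section_volume K A) \<longrightarrow>
          (\<forall>T. facet_hyperplane K A T \<longrightarrow>
            (\<exists>T'. cutting_plane T A T' \<and>
               flat_volume T (cone_segment (frontier K \<inter> T) T') = min_section_volume K A) \<and>
            (\<forall>T'. cutting_plane T A T' \<longrightarrow>
               min_section_volume K A \<le> flat_volume T (cone_segment (frontier K \<inter> T) T')) \<and>
            closest_point T 0 = 0 \<and>
            (\<forall>T'. cutting_plane T A T' \<and>
               flat_volume T (cone_segment (frontier K \<inter> T) T') = min_section_volume K A \<longrightarrow>
               0 - A = real CARD('n) *\<^sub>R
                 (flat_centroid T (cone_segment (frontier K \<inter> T) T') - A)))))"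
proof -
  interpret pointed_cone K
    using assms by unfold_locales auto
  have A: "A \<in> frontier K" "A \<noteq> 0" using assms(7) by auto
  \<comment> \<open>With n the dimension, the centroid (n - 1) / n times \<open>A\<close> differs
    from \<open>A\<close> by -1 / n times \<open>A\<close>.\<close>
  have centroid: "0 - A = real CARD('n) *\<^sub>R (c - A)"
    if "c = ((real DIM(real^'n) - 1) / real DIM(real^'n)) *\<^sub>R A" for c
  proof -
    have "real CARD('n) *\<^sub>R (c - A) = (real CARD('n) * ((real CARD('n) - 1) / real CARD('n)) - real CARD('n)) *\<^sub>R A"
      using that by (simp add: algebra_simps)
    also have "real CARD('n) * ((real CARD('n) - 1) / real CARD('n)) - real CARD('n) = - 1"
      by simp
    finally show ?thesis by simp
  qed
  have closest: "closest_point T 0 = 0" if "facet_hyperplane K A T" for T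
    using that by (intro closest_point_self) (simp add: facet_hyperplane_def)
  note degenerate = degenerate_min_section_volume[OF A]
  show ?thesis
  proof (intro conjI impI allI)
    assume "\<nexists>T. facet_hyperplane K A T"
    then show "min_section_volume K A = 0" by (rule min_section_volume_no_facet[OF A])
  next
    assume "\<exists>T. facet_hyperplane K A T"
    then show "\<exists>!T. facet_hyperplane K A T"
      using facet_hyperplane_unique[OF A] by blast
  next
    assume "\<exists>T. facet_hyperplane K A T"
    then show "0 < min_section_volume K A"
      using facet_min_section_volume_pos[OF A] by blast
  next
    fix T
    assume no: "\<nexists>H. admissible K H \<and> A \<in> H \<and> flat_volume H (K \<inter> H) = min_section_volume K A"
      and T: "facet_hyperplane K A T"
    show "\<exists>T'. cutting_plane T A T' \<and>
        flat_volume T (cone_segment (frontier K \<inter> T) T') = min_section_volume K A"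
      by (rule degenerate(1)[OF T no])
    show "closest_point T 0 = 0" by (rule closest[OF T])
    fix T'
    show "min_section_volume K A \<le> flat_volume T (cone_segment (frontier K \<inter> T) T')"
      if "cutting_plane T A T'"
      by (rule degenerate(2)[OF T no that])
    show "0 - A = real CARD('n) *\<^sub>R (flat_centroid T (cone_segment (frontier K \<inter> T) T') - A)"
      if "cutting_plane T A T' \<and>
        flat_volume T (cone_segment (frontier K \<inter> T) T') = min_section_volume K A"
      using that by (intro centroid degenerate(3)[OF T no]) auto
  qed
qed

end
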